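(* Let $n\ge3$, $2\le i\le n-1$, $\mathfrak g=\mathfrak{sp}(n,\mathbb C)$, and $\mathfrak q=\mathfrak l\oplus\mathfrak n$ the maximal parabolic subalgebra of type $C_n(i)$. Let $V(\mu+\epsilon_\gamma)$ be the irreducible $\mathfrak l$-submodule of $\mathfrak l_\gamma\otimes\mathfrak z(\mathfrak n)$ of highest weight $\varepsilon_1+\varepsilon_2$. The $\Omega_2|_{V(\mu+\epsilon_\gamma)^*}$ system is conformally invariant on $\mathcal L_s$ if and only if $s=n-i+1$.
   Context: $\mathfrak g=\mathfrak{sp}(n,\mathbb C)$ (rank $n$) with Cartan $\mathfrak h$, roots $\pm\varepsilon_j\pm\varepsilon_k$ ($j<k$), $\pm2\varepsilon_j$, simple roots $\alpha_j=\varepsilon_j-\varepsilon_{j+1}$ ($j<n$), $\alpha_n=2\varepsilon_n$, Killing form $\kappa$, root vectors $X_\alpha$. $\mathfrak q=\mathfrak l\oplus\mathfrak n$ is the standard maximal parabolic subalgebra determined by $\alpha_{\mathfrak q}=\alpha_i$ with fundamental weight $\lambda_{\mathfrak q}=\lambda_i=\varepsilon_1+\dots+\varepsilon_i$; grading $\mathfrak g=\bigoplus_{j=-2}^2\mathfrak g(j)$ by the $\alpha_i$-coefficient, $\mathfrak l=\mathfrak g(0)$, $\Delta(\mathfrak g(1))=\{\varepsilon_j\pm\varepsilon_k:1\le j\le i<k\le n\}$, $\mathfrak z(\mathfrak n)=\mathfrak g(2)$ (roots $\varepsilon_j+\varepsilon_k$, $j<k\le i$, and $2\varepsilon_j$,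 $j\le i$), $\mathfrak n=\mathfrak g(1)\oplus\mathfrak g(2)$, $\bar{\mathfrak n}=\mathfrak g(-1)\oplus\mathfrak g(-2)$. $\mathfrak l_\gamma\cong\mathfrak{sl}(i,\mathbb C)$ is the simple ideal of $[\mathfrak l,\mathfrak l]$ with simple roots $\alpha_1,\dots,\alpha_{i-1}$. ($\mu=\varepsilon_1+\varepsilon_{i+1}$, $\epsilon_\gamma=\varepsilon_2-\varepsilon_{i+1}$.) Construction: $\omega=\sum_{\gamma\in\Delta(\mathfrak z(\mathfrak n))}X^*_\gamma\otimes X_\gamma$ ($X^*_\gamma\in\mathfrak g_{-\gamma}$ $\kappa$-dual), $\tau_2(X)=\tfrac12(\mathrm{ad}(X)^2\otimes\mathrm{Id})\omega$; for an irreducible constituent $W$ of $\mathfrak l\otimes\mathfrak z(\mathfrak n)$ and $Y^*\in W^*\subset\mathfrak l\otimes\mathfrak z(\bar{\mathfrak n})$ (via $\kappa$), $\tilde\tau_2(Y^* )(X)=Y^*(\tau_2(X))\in\mathcal P^2(\mathfrak g(1))\cong\mathrm{Sym}^2(\mathfrak g(-1))$ and $\omega_2(Y^* )=\sigma(\tilde\tau_2(Y^* ))\in\mathcal U(\bar{\mathfrak n})$, $\sigma(ab)=\tfrac12(ab+ba)$. The $\Omega_2|_{W^*}$ system is the system of operators $R(\omega_2(Y^* ))$ ($R$ infinitesimal right translation) on the line bundle $\mathcal L_s$ over $\bar N_0$ induced by the character of $Q_0$ with differential $s\lambda_{\mathfrak q}$. Let $\mathbb C_{-s}$ be the one-dimensional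 $\mathfrak q$-module of weight $-s\lambda_{\mathfrak q}$ with $[\mathfrak l,\mathfrak l]+\mathfrak n$ acting by $0$, and $1_{-s}$ the generator of $M_{\mathfrak q}[\mathbb C_{-s}]=\mathcal U(\mathfrak g)\otimes_{\mathcal U(\mathfrak q)}\mathbb C_{-s}$. The system is conformally invariant on $\mathcal L_s$ if and only if (Barchini–Kable–Zierau; may be taken as definition) $X\cdot(\omega_2(Y^* )\otimes1_{-s})=0$ for all $X\in\mathfrak n$, $Y^*\in W^*$. *)

theory Defs
  imports Complex_Main
begin

text \<open>Matrices are functions nat => nat => complex; only entries with both
indices below 2n are relevant (elements of sp n vanish outside that range).
Index 0..n-1 corresponds to e_1..e_n, index n..2n-1 to the dual basis.\<close>

type_synonym mat = "nat \<Rightarrow> nat \<Rightarrow> complex"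
type_synonym tensor = "nat \<Rightarrow> nat \<Rightarrow> nat \<Rightarrow> nat \<Rightarrow> complex"
type_synonym wt = "nat \<Rightarrow> int"
type_synonym fa = "mat list \<Rightarrow> complex"

definition mmul :: "nat \<Rightarrow> mat \<Rightarrow> mat \<Rightarrow> mat" where
  "mmul n A B = (\<lambda>a b. \<Sum>e<2*n. A a e * B e b)"
definition madd :: "mat \<Rightarrow> mat \<Rightarrow> mat" where
  "madd A B = (\<lambda>a b. A a b + B a b)"
definition msc :: "complex \<Rightarrow> mat \<Rightarrow> mat" where
  "msc c A = (\<lambda>a b. c * A a b)"
definition mzero :: mat where
  "mzero = (\<lambda>a b. 0)"
definition mtr :: "mat \<Rightarrow> mat" where
  "mtr A = (\<lambda>a b. A b a)"
definition eunit :: "nat \<Rightarrow> nat \<Rightarrow> mat" where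
  "eunit i j = (\<lambda>a b. if a = i \<and> b = j then 1 else 0)"

definition br :: "nat \<Rightarrow> mat \<Rightarrow> mat \<Rightarrow> mat" where
  "br n A B = (\<lambda>a b. mmul n A B a b - mmul n B A a b)"

definition Jm :: "nat \<Rightarrow> mat" where
  "Jm n = (\<lambda>a b. if a < n \<and> b = a + n then 1
                 else if n \<le> a \<and> a < 2*n \<and> b + n = a then -1 else 0)"

definition sp :: "nat \<Rightarrow> mat set" where
  "sp n = {X. (\<forall>a b. 2*n \<le> a \<or> 2*n \<le> b \<longrightarrow> X a b = 0) \<and>
              madd (mmul n (mtr X) (Jm n)) (mmul n (Jm n) X) = mzero}"

definition EA :: "nat \<Rightarrow> nat \<Rightarrow> nat \<Rightarrow> mat" where
  "EA n j k = (\<lambda>a b. (if a = j \<and> b = k then 1 else 0) - (if a = n + k \<and> b = n + j then 1 else 0))"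
definition EB :: "nat \<Rightarrow> nat \<Rightarrow> nat \<Rightarrow> mat" where
  "EB n j k = (\<lambda>a b. if (a = j \<and> b = n + k) \<or> (a = k \<and> b = n + j) then 1 else 0)"
definition EC :: "nat \<Rightarrow> nat \<Rightarrow> nat \<Rightarrow> mat" where
  "EC n j k = (\<lambda>a b. if (a = n + j \<and> b = k) \<or> (a = n + k \<and> b = j) then 1 else 0)"

text \<open>Trace of an endomorphism T of sp(n), w.r.t. the basis
EA j k (j,k<n), EB j k (j<=k<n), EC j k (j<=k<n), whose dual coordinates are
the matrix entries (j,k), (j,n+k), (n+j,k) respectively.\<close>
definition sp_trace :: "nat \<Rightarrow> (mat \<Rightarrow> mat) \<Rightarrow> complex" where
  "sp_trace n T =
     (\<Sum>j<n. \<Sum>k<n. T (EA n j k) j k)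
   + (\<Sum>j<n. \<Sum>k\<in>{j..<n}. T (EB n j k) j (n + k))
   + (\<Sum>j<n. \<Sum>k\<in>{j..<n}. T (EC n j k) (n + j) k)"

definition kil :: "nat \<Rightarrow> mat \<Rightarrow> mat \<Rightarrow> complex" where
  "kil n A B = sp_trace n (\<lambda>E. br n A (br n B E))"

definition cartan :: "nat \<Rightarrow> mat set" where
  "cartan n = {H \<in> sp n. \<forall>a b. a \<noteq> b \<longrightarrow> H a b = 0}"

text \<open>A weight is given by its coordinates w.r.t. epsilon_1..epsilon_n
(0-based: eps 0 = epsilon_1); epsilon_j(H) = H j j.\<close>
definition wev :: "nat \<Rightarrow> wt \<Rightarrow> mat \<Rightarrow> complex" where
  "wev n \<alpha> H = (\<Sum>j<n. of_int (\<alpha> j) * H j j)"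

definition rootsp :: "nat \<Rightarrow> wt \<Rightarrow> mat set" where
  "rootsp n \<alpha> = {X \<in> sp n. \<forall>H \<in> cartan n. br n H X = msc (wev n \<alpha> H) X}"

definition rv :: "nat \<Rightarrow> wt \<Rightarrow> mat" where
  "rv n \<alpha> = (SOME X. X \<in> rootsp n \<alpha> \<and> X \<noteq> mzero)"
definition rvd :: "nat \<Rightarrow> wt \<Rightarrow> mat" where
  "rvd n \<alpha> = (THE Y. Y \<in> rootsp n (\<lambda>j. - \<alpha> j) \<and> kil n Y (rv n \<alpha>) = 1)"

definition eps :: "nat \<Rightarrow> wt" where
  "eps j = (\<lambda>k. if k = j then 1 else 0)"
definition wplus :: "wt \<Rightarrow> wt \<Rightarrow> wt" where
  "wplus \<alpha> \<beta> = (\<lambda>k. \<alpha> k + \<beta> k)"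
definition wminus :: "wt \<Rightarrow> wt \<Rightarrow> wt" where
  "wminus \<alpha> \<beta> = (\<lambda>k. \<alpha> k - \<beta> k)"

text \<open>Positive roots of C_n and the alpha_i coefficient
(coefficient of alpha_i in sum a_j epsilon_j is a_1 + ... + a_i).\<close>
definition posroots :: "nat \<Rightarrow> wt set" where
  "posroots n = {wminus (eps j) (eps k) | j k. j < k \<and> k < n}
              \<union> {wplus (eps j) (eps k) | j k. j < k \<and> k < n}
              \<union> {wplus (eps j) (eps j) | j. j < n}"
definition grade :: "nat \<Rightarrow> wt \<Rightarrow> int" where
  "grade i \<alpha> = (\<Sum>j<i. \<alpha> j)"
definition lpos :: "nat \<Rightarrow> nat \<Rightarrow> wt set" where
  "lpos n i = {\<alpha> \<in> posroots n. grade i \<alpha> = 0}"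

text \<open>Delta(z(n)) and Delta(g(1)) (i is the paper's i; 0-based j<i means 1<=j<=i).\<close>
definition Dz :: "nat \<Rightarrow> wt set" where
  "Dz i = {wplus (eps j) (eps k) | j k. j < k \<and> k < i} \<union> {wplus (eps j) (eps j) | j. j < i}"
definition Dg1 :: "nat \<Rightarrow> nat \<Rightarrow> wt set" where
  "Dg1 n i = {wplus (eps j) (eps k) | j k. j < i \<and> i \<le> k \<and> k < n}
           \<union> {wminus (eps j) (eps k) | j k. j < i \<and> i \<le> k \<and> k < n}"

text \<open>Grading element H_q with alpha_j(H_q) = delta_{ij}; g(k) is its k-eigenspace,
i.e. the span of root spaces with alpha_i-coefficient k (plus h for k = 0).\<close>
definition Hq :: "nat \<Rightarrow> nat \<Rightarrow> mat" where
  "Hq n i = (\<lambda>a b. if a = b \<and> a < i then 1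
                   else if a = b \<and> n \<le> a \<and> a < n + i then -1 else 0)"
definition grd :: "nat \<Rightarrow> nat \<Rightarrow> int \<Rightarrow> mat set" where
  "grd n i k = {X \<in> sp n. br n (Hq n i) X = msc (of_int k) X}"
definition levi :: "nat \<Rightarrow> nat \<Rightarrow> mat set" where
  "levi n i = grd n i 0"
definition nilr :: "nat \<Rightarrow> nat \<Rightarrow> mat set" where
  "nilr n i = {madd A B | A B. A \<in> grd n i 1 \<and> B \<in> grd n i 2}"
definition par :: "nat \<Rightarrow> nat \<Rightarrow> mat set" where
  "par n i = {madd L N | L N. L \<in> levi n i \<and> N \<in> nilr n i}"

text \<open>l_gamma = sl(i), the simple ideal of [l,l] with simple roots alpha_1..alpha_{i-1}:
matrices diag(A, -A^T) with A supported in the leading i x i block and trace A = 0.\<close>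
definition lgam :: "nat \<Rightarrow> nat \<Rightarrow> mat set" where
  "lgam n i = {X \<in> sp n. (\<forall>a b. X a b \<noteq> 0 \<longrightarrow>
                   (a < i \<and> b < i) \<or> (n \<le> a \<and> a < n + i \<and> n \<le> b \<and> b < n + i))
                 \<and> (\<Sum>j<i. X j j) = 0}"

definition tens :: "(mat \<times> mat) list \<Rightarrow> tensor" where
  "tens L = (\<lambda>a b c d. \<Sum>(P, Q)\<leftarrow>L. P a b * Q c d)"
definition tspan :: "mat set \<Rightarrow> mat set \<Rightarrow> tensor set" where
  "tspan A B = {tens L | L. \<forall>(P, Q) \<in> set L. P \<in> A \<and> Q \<in> B}"
definition tzero :: tensor where "tzero = (\<lambda>a b c d. 0)"
definition tadd :: "tensor \<Rightarrow> tensor \<Rightarrow> tensor" where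
  "tadd S T = (\<lambda>a b c d. S a b c d + T a b c d)"
definition tsc :: "complex \<Rightarrow> tensor \<Rightarrow> tensor" where
  "tsc c T = (\<lambda>a b c' d. c * T a b c' d)"

text \<open>Action of X (adjoint on each factor): ad X (x) 1 + 1 (x) ad X.\<close>
definition lact :: "nat \<Rightarrow> mat \<Rightarrow> tensor \<Rightarrow> tensor" where
  "lact n X T = (\<lambda>a b c d.
      (\<Sum>e<2*n. X a e * T e b c d - T a e c d * X e b)
    + (\<Sum>e<2*n. X c e * T a b e d - T a b c e * X e d))"

definition tpair :: "nat \<Rightarrow> tensor \<Rightarrow> tensor \<Rightarrow> complex" where
  "tpair n S T = (\<Sum>a<2*n. \<Sum>b<2*n. \<Sum>c<2*n. \<Sum>d<2*n.
                   \<Sum>a'<2*n. \<Sum>b'<2*n. \<Sum>c'<2*n. \<Sum>d'<2*n.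
                   kil n (eunit a b) (eunit a' b') * kil n (eunit c d) (eunit c' d')
                   * S a b c d * T a' b' c' d')"

definition tsubspace :: "tensor set \<Rightarrow> bool" where
  "tsubspace U \<longleftrightarrow> tzero \<in> U \<and> (\<forall>x\<in>U. \<forall>y\<in>U. tadd x y \<in> U) \<and> (\<forall>c. \<forall>x\<in>U. tsc c x \<in> U)"
definition lstable :: "nat \<Rightarrow> nat \<Rightarrow> tensor set \<Rightarrow> bool" where
  "lstable n i U \<longleftrightarrow> (\<forall>X \<in> levi n i. \<forall>T \<in> U. lact n X T \<in> U)"
definition lirred :: "nat \<Rightarrow> nat \<Rightarrow> tensor set \<Rightarrow> bool" where
  "lirred n i U \<longleftrightarrow> U \<noteq> {tzero} \<and>
     (\<forall>V. tsubspace V \<and> V \<subseteq> U \<and> lstable n i V \<longrightarrow> V = {tzero} \<or> V = U)"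

definition is_Vmu :: "nat \<Rightarrow> nat \<Rightarrow> tensor set \<Rightarrow> bool" where
  "is_Vmu n i W \<longleftrightarrow> tsubspace W \<and> W \<subseteq> tspan (lgam n i) (grd n i 2)
     \<and> lstable n i W \<and> lirred n i W
     \<and> (\<exists>v\<in>W. v \<noteq> tzero
          \<and> (\<forall>H \<in> cartan n. lact n H v = tsc (H 0 0 + H 1 1) v)
          \<and> (\<forall>\<alpha> \<in> lpos n i. \<forall>X \<in> rootsp n \<alpha>. lact n X v = tzero))"

text \<open>W^* inside l (x) z(nbar), identified with the dual of W via kappa:
the irreducible l-submodule of l (x) z(nbar) pairing nontrivially with W.\<close>
definition is_dual :: "nat \<Rightarrow> nat \<Rightarrow> tensor set \<Rightarrow> tensor set \<Rightarrow> bool" where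
  "is_dual n i W Wd \<longleftrightarrow> tsubspace Wd \<and> Wd \<subseteq> tspan (levi n i) (grd n i (-2))
     \<and> lstable n i Wd \<and> lirred n i Wd \<and> (\<exists>w\<in>W. \<exists>y\<in>Wd. tpair n y w \<noteq> 0)"

definition fa_zero :: fa where "fa_zero = (\<lambda>w. 0)"
definition fa_one :: fa where "fa_one = (\<lambda>w. if w = [] then 1 else 0)"
definition fa_add :: "fa \<Rightarrow> fa \<Rightarrow> fa" where "fa_add p q = (\<lambda>w. p w + q w)"
definition fa_sc :: "complex \<Rightarrow> fa \<Rightarrow> fa" where "fa_sc c p = (\<lambda>w. c * p w)"
definition fa_mul :: "fa \<Rightarrow> fa \<Rightarrow> fa" where
  "fa_mul p q = (\<lambda>w. \<Sum>k\<le>length w. p (take k w) * q (drop k w))"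
definition fa_gen :: "mat \<Rightarrow> fa" where "fa_gen X = (\<lambda>w. if w = [X] then 1 else 0)"

definition fa_ok :: "nat \<Rightarrow> fa \<Rightarrow> bool" where
  "fa_ok n p \<longleftrightarrow> finite {w. p w \<noteq> 0} \<and> (\<forall>w. p w \<noteq> 0 \<longrightarrow> set w \<subseteq> sp n)"

definition lin_rel :: "complex \<Rightarrow> complex \<Rightarrow> mat \<Rightarrow> mat \<Rightarrow> fa" where
  "lin_rel c d X Y = fa_add (fa_gen (madd (msc c X) (msc d Y)))
                       (fa_add (fa_sc (- c) (fa_gen X)) (fa_sc (- d) (fa_gen Y)))"
definition comm_rel :: "nat \<Rightarrow> mat \<Rightarrow> mat \<Rightarrow> fa" where
  "comm_rel n X Y = fa_add (fa_mul (fa_gen X) (fa_gen Y))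
                      (fa_add (fa_sc (-1) (fa_mul (fa_gen Y) (fa_gen X))) (fa_sc (-1) (fa_gen (br n X Y))))"

text \<open>Character of q on C_{-s}: weight -s lambda_q, zero on [l,l] + n.\<close>
definition chi :: "nat \<Rightarrow> complex \<Rightarrow> mat \<Rightarrow> complex" where
  "chi i s Y = - s * (\<Sum>j<i. Y j j)"

text \<open>vid n i s: the kernel of T(g) -> M_q[C_{-s}], u |-> u (x) 1_{-s}; i.e. the
two-sided ideal defining U(g) plus the left ideal generated by Y - chi(Y), Y in q.\<close>
inductive_set vid :: "nat \<Rightarrow> nat \<Rightarrow> complex \<Rightarrow> fa set" for n i s where
  zero: "fa_zero \<in> vid n i s"
| add: "p \<in> vid n i s \<Longrightarrow> q \<in> vid n i s \<Longrightarrow> fa_add p q \<in> vid n i s"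
| lin: "fa_ok n a \<Longrightarrow> fa_ok n b \<Longrightarrow> X \<in> sp n \<Longrightarrow> Y \<in> sp n \<Longrightarrow>
        fa_mul a (fa_mul (lin_rel c d X Y) b) \<in> vid n i s"
| comm: "fa_ok n a \<Longrightarrow> fa_ok n b \<Longrightarrow> X \<in> sp n \<Longrightarrow> Y \<in> sp n \<Longrightarrow>
        fa_mul a (fa_mul (comm_rel n X Y) b) \<in> vid n i s"
| parab: "fa_ok n a \<Longrightarrow> Y \<in> par n i \<Longrightarrow>
        fa_mul a (fa_add (fa_gen Y) (fa_sc (- chi i s Y) fa_one)) \<in> vid n i s"

definition tau2 :: "nat \<Rightarrow> nat \<Rightarrow> mat \<Rightarrow> tensor" where
  "tau2 n i X = (\<lambda>a b c d. (1/2) *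
      (\<Sum>\<gamma>\<in>Dz i. br n X (br n X (rvd n \<gamma>)) a b * rv n \<gamma> c d))"

definition ttau2 :: "nat \<Rightarrow> nat \<Rightarrow> tensor \<Rightarrow> mat \<Rightarrow> complex" where
  "ttau2 n i Y X = tpair n Y (tau2 n i X)"

definition polar :: "(mat \<Rightarrow> complex) \<Rightarrow> mat \<Rightarrow> mat \<Rightarrow> complex" where
  "polar f x y = (f (madd x y) - f x - f y) / 2"

text \<open>omega_2(Y*) = sigma(tilde tau_2(Y*)): with x_beta = kappa(X*_beta, -) the
coordinates on g(1) w.r.t. the root basis X_beta, a quadratic f = sum c x_beta x_beta'
(c symmetric, c = polarization of f on basis vectors) corresponds to
sum c X*_beta X*_beta' in Sym^2(g(-1)), which sigma symmetrizes.\<close>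
definition omega2 :: "nat \<Rightarrow> nat \<Rightarrow> tensor \<Rightarrow> fa" where
  "omega2 n i Y = (\<lambda>w. \<Sum>\<beta>\<in>Dg1 n i. \<Sum>\<beta>'\<in>Dg1 n i.
      polar (ttau2 n i Y) (rv n \<beta>) (rv n \<beta>') * ((1/2) *
        (fa_mul (fa_gen (rvd n \<beta>)) (fa_gen (rvd n \<beta>')) w
       + fa_mul (fa_gen (rvd n \<beta>')) (fa_gen (rvd n \<beta>)) w)))"

text \<open>Conformal invariance (Barchini-Kable-Zierau criterion):
X . (omega_2(Y*) (x) 1_{-s}) = 0 for all X in n and Y* in W*.\<close>
definition conf_inv :: "nat \<Rightarrow> nat \<Rightarrow> complex \<Rightarrow> tensor set \<Rightarrow> bool" where
  "conf_inv n i s Wd \<longleftrightarrow>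
     (\<forall>X \<in> nilr n i. \<forall>Y \<in> Wd. fa_mul (fa_gen X) (omega2 n i Y) \<in> vid n i s)"

end

theory Submission
  imports Defs
begin

text \<open>
  For $Y \in W^*$ the quadratic form $\tilde\tau_2(Y)$ on
  $\mathfrak g(1) \cong \mathbb C^i \otimes \mathbb C^{2(n-i)}$ is
  $X \mapsto \sum_{j,k} M_{jk} (X^2)_{j,n+k}$ for a skew matrix $M$: the pairing between $W$ and $W^*$ is
  nondegenerate by irreducibility, and $\mathfrak{sp}(n-i)$ kills $W$, hence kills $W^*$, so the
  $\mathfrak{sp}(n-i)$-component of $Y$ vanishes. The explicit highest weight vector of $W$ shows that
  $M_{12} \ne 0$ for some $Y$. Modulo the relations of the generalized Verma module,
  $X \cdot \omega_2(Y)$ for a root vector $X$ of weight $\varepsilon_r - \xi$ with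
  $\xi \in \{\pm\varepsilon_k : k > i\}$ becomes a nonzero multiple of
  $(n-i+1-s) \sum_q M_{rq} X_{-\xi-\varepsilon_q}$, while $\mathfrak g(2)$ kills $\omega_2(Y)$
  because $M$ is skew. That a nonzero element of
  $\mathfrak g(-1)$ survives in the module, for every $s$, is seen by letting
  $\mathfrak{gl}(2n) \supset \mathfrak{sp}(n)$ act by first-order operators on polynomial functions on
  a chart of the Grassmannian of $i$-planes and evaluating at the base point; this replaces an appeal to
  the Poincare-Birkhoff-Witt theorem.
\<close>

text \<open>The constant n-i+1 comes from contracting over the 2(n-i) indices c of degree 0, each
  coupled with its symplectic partner. The sp(n-i)-part of the first bracket with X gives one equal
  term for every c, together 2(n-i). The two indices c that meet X add 1-s when the first index of M
  is r, and s-1 when the second one is. Skewness of M turns s-1 into another 1-s, so the total is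
  2(n-i+1-s).

  W and W^* are known only through abstract properties, and each root vector only as a chosen
  nonzero element of its root space. So information about W^* has to pass through the pairing with
  W, and the unknown scalar of every root vector has to cancel against that of its kappa-dual.

  The module is a quotient of a free algebra by an inductively generated set. Membership is shown by
  rewriting words; non-membership needs a functional that vanishes on all generators. The vector
  fields form an anti-representation, so a word acts with its first letter first. The last letter,
  where the relations of q apply, is thereby the one evaluated at the base point.\<close>

text \<open>
  With $\bar a$ the index paired with $a$ by the symplectic form and $\sigma_a = \pm 1$ its sign, the
  matrices $E_{ab} - \sigma_a \sigma_b E_{\bar b \bar a}$ span $\mathfrak{sp}(n)$ and contain all root
  vectors; they treat the families EA, EB, EC uniformly, except that EB and EC on the
  diagonal are doubled.
\<close>

definition cj :: "nat \<Rightarrow> nat \<Rightarrow> nat" where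
  "cj n a = (if a < n then a + n else a - n)"
definition sg :: "nat \<Rightarrow> nat \<Rightarrow> complex" where
  "sg n a = (if a < n then 1 else -1)"
definition sb :: "nat \<Rightarrow> nat \<Rightarrow> nat \<Rightarrow> mat" where
  "sb n a b = (\<lambda>x y. eunit a b x y - sg n a * sg n b * eunit (cj n b) (cj n a) x y)"

lemma cj_less[simp]: "a < 2*n \<Longrightarrow> cj n a < 2*n"
  and cj_cj[simp]: "a < 2*n \<Longrightarrow> cj n (cj n a) = a"
  and cj_neq[simp]: "a < 2*n \<Longrightarrow> cj n a \<noteq> a"
  and cj_neq'[simp]: "a < 2*n \<Longrightarrow> a \<noteq> cj n a"
  by (auto simp: cj_def)

lemma sg_cj[simp]: "a < 2*n \<Longrightarrow> sg n (cj n a) = - sg n a"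
  by (auto simp: cj_def sg_def)

lemma sg_mult_self[simp]: "sg n a * sg n a = 1" "sg n a * (sg n a * x) = x"
  by (auto simp: sg_def)

lemma sg_nonzero[simp]: "sg n a \<noteq> 0"
  by (auto simp: sg_def)

lemma cj_eq_iff: "a < 2*n \<Longrightarrow> b < 2*n \<Longrightarrow> cj n a = b \<longleftrightarrow> a = cj n b"
  by (auto simp: cj_def split: if_splits)

lemma cj_inj: "a < 2*n \<Longrightarrow> b < 2*n \<Longrightarrow> cj n a = cj n b \<longleftrightarrow> a = b"
  by (metis cj_cj)

lemma bij_betw_cj: "bij_betw (cj n) {..<2*n} {..<2*n}"
  by (rule bij_betw_byWitness[where f' = "cj n"]) auto

lemma sum_cj: "(\<Sum>a<2*n. f (cj n a)) = (\<Sum>a<2*n. f a)"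
  using sum.reindex_bij_betw[OF bij_betw_cj, of f] by simp

text \<open>Kronecker delta with complex values: products of deltas remain polynomial expressions,
  and sums over them collapse by \<open>sum_dl\<close> without case splits.\<close>

definition dl :: "nat \<Rightarrow> nat \<Rightarrow> complex" where
  "dl a b = (if a = b then 1 else 0)"

lemma eunit_dl: "eunit a b x y = dl x a * dl y b"
  by (cases "x = a"; cases "y = b") (simp_all add: eunit_def dl_def)

lemma sb_dl: "sb n a b x y = dl x a * dl y b - sg n a * sg n b * (dl x (cj n b) * dl y (cj n a))"
  by (simp add: sb_def eunit_dl)

lemma dl_cj: "x < 2*n \<Longrightarrow> a < 2*n \<Longrightarrow> dl (cj n x) a = dl x (cj n a)"
  "x < 2*n \<Longrightarrow> a < 2*n \<Longrightarrow> dl (cj n x) (cj n a) = dl x a"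
  by (simp_all add: dl_def cj_inj cj_eq_iff)

lemma dl_self[simp]: "dl a a = 1"
  by (simp add: dl_def)

lemma dl_sym: "dl a b = dl b a"
  by (simp add: dl_def)

lemma sum_dl: "finite S \<Longrightarrow> (\<Sum>e\<in>S. dl e a * f e) = (if a \<in> S then f a else 0)"
  "finite S \<Longrightarrow> (\<Sum>e\<in>S. dl a e * f e) = (if a \<in> S then f a else 0)"
  by (simp_all add: dl_def if_distrib[of "\<lambda>x. x * _"] cong: if_cong)

lemma sum_split_double: "(\<Sum>a<2*n. f a) = (\<Sum>a<n. f a) + (\<Sum>a<n. f (n + a :: nat))"
  for f :: "nat \<Rightarrow> 'a::comm_monoid_add"
proof -
  have "{..<2*n} = {..<n} \<union> {n..<n+n}" by auto
  then have "(\<Sum>a<2*n. f a) = sum f {..<n} + sum f {n..<n+n}"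
    by (simp add: sum.union_disjoint ivl_disj_int)
  also have "sum f {n..<n+n} = (\<Sum>a<n. f (n + a))"
    using sum.shift_bounds_nat_ivl[of f 0 n n] by (simp add: lessThan_atLeast0 add.commute)
  finally show ?thesis .
qed

section \<open>Membership in sp(n) as a symmetry of matrix entries\<close>

lemma sp_iff:
  "X \<in> sp n \<longleftrightarrow> (\<forall>a b. 2*n \<le> a \<or> 2*n \<le> b \<longrightarrow> X a b = 0) \<and>
     (\<forall>a<2*n. \<forall>b<2*n. X a b = - (sg n a * sg n b * X (cj n b) (cj n a)))"
  (is "_ \<longleftrightarrow> ?S \<and> ?R")
proof -
  \<comment> \<open>Multiplication by \<open>Jm\<close> permutes rows or columns by
    \<open>cj\<close> up to the sign \<open>sg\<close>. The defining equation at position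
    (\<open>cj n a\<close>, b) is then the claimed symmetry at (a, b).\<close>
  have JL: "mmul n (Jm n) X a b = (if a < 2*n then sg n a * X (cj n a) b else 0)" for a b
  proof -
    have "Jm n a e * X e b = (if e = cj n a then (if a < 2*n then sg n a * X (cj n a) b else 0) else 0)"
      if "e < 2*n" for e
      using that by (auto simp: Jm_def cj_def sg_def)
    then have "mmul n (Jm n) X a b
        = (\<Sum>e<2*n. if e = cj n a then (if a < 2*n then sg n a * X (cj n a) b else 0) else 0)"
      unfolding mmul_def by (intro sum.cong) auto
    then show ?thesis by (auto simp: sum.delta)
  qed
  have JR: "mmul n (mtr X) (Jm n) a b = (if b < 2*n then - sg n b * X (cj n b) a else 0)" for a b
  proof -
    have "mtr X a e * Jm n e b = (if e = cj n b then (if b < 2*n then - sg n b * X (cj n b) a else 0) else 0)"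
      if "e < 2*n" for e
      using that by (auto simp: Jm_def cj_def sg_def mtr_def)
    then have "mmul n (mtr X) (Jm n) a b
        = (\<Sum>e<2*n. if e = cj n b then (if b < 2*n then - sg n b * X (cj n b) a else 0) else 0)"
      unfolding mmul_def by (intro sum.cong) auto
    then show ?thesis by (auto simp: sum.delta)
  qed
  show ?thesis
  proof (intro iffI)
    assume "X \<in> sp n"
    then have S: ?S and E: "\<And>a b. mmul n (mtr X) (Jm n) a b + mmul n (Jm n) X a b = 0"
      unfolding sp_def madd_def mzero_def by (auto dest: fun_cong)
    have ?R
    proof (intro allI impI)
      fix a b assume "a < 2*n" "b < 2*n"
      then have "sg n a * X a b = - (sg n b * X (cj n b) (cj n a))"
        using E[of "cj n a" b] by (simp add: JL JR)
      then have "sg n a * (sg n a * X a b) = sg n a * - (sg n b * X (cj n b) (cj n a))" by simp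
      then show "X a b = - (sg n a * sg n b * X (cj n b) (cj n a))" by simp
    qed
    with S show "?S \<and> ?R" by blast
  next
    assume *: "?S \<and> ?R"
    then have S: ?S by (rule conjunct1)
    have "mmul n (mtr X) (Jm n) a b + mmul n (Jm n) X a b = 0" for a b
    proof (cases "a < 2*n \<and> b < 2*n")
      case True
      then have "X (cj n b) a = - (sg n (cj n b) * sg n a * X (cj n a) (cj n (cj n b)))"
        using *[THEN conjunct2, rule_format, of "cj n b" a] by simp
      then show ?thesis using True by (simp add: JL JR)
    next
      case False
      then show ?thesis using S by (auto simp: JL JR)
    qed
    then show "X \<in> sp n" using S unfolding sp_def madd_def mzero_def by auto
  qed
qed

lemma sp_outside: "X \<in> sp n \<Longrightarrow> 2*n \<le> a \<or> 2*n \<le> b \<Longrightarrow> X a b = 0"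
  unfolding sp_iff by blast

lemma sp_sym:
  assumes "X \<in> sp n" "a < 2*n" "b < 2*n"
  shows "X (cj n b) (cj n a) = - (sg n a * sg n b * X a b)"
proof -
  have "X a b = - (sg n a * sg n b * X (cj n b) (cj n a))"
    using assms unfolding sp_iff by blast
  then have "sg n a * sg n b * X a b = - (X (cj n b) (cj n a))"
    by (simp add: mult.assoc mult.left_commute[of "sg n b"])
  then show ?thesis by simp
qed

lemma spI:
  assumes "\<And>a b. 2*n \<le> a \<or> 2*n \<le> b \<Longrightarrow> X a b = 0"
    and "\<And>a b. a < 2*n \<Longrightarrow> b < 2*n \<Longrightarrow> X (cj n b) (cj n a) = - (sg n a * sg n b * X a b)"
  shows "X \<in> sp n"
proof -
  have "X a b = - (sg n a * sg n b * X (cj n b) (cj n a))" if "a < 2*n" "b < 2*n" for a b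
    unfolding assms(2)[OF that] by (simp add: sg_def)
  with assms(1) show ?thesis unfolding sp_iff by blast
qed

lemma sb_in_sp:
  assumes ab: "a < 2*n" "b < 2*n"
  shows "sb n a b \<in> sp n"
proof (rule spI)
  fix x y :: nat assume "2*n \<le> x \<or> 2*n \<le> y"
  then have "\<not> (x = a \<and> y = b)" "\<not> (x = cj n b \<and> y = cj n a)"
    using ab cj_less[OF ab(1)] cj_less[OF ab(2)] by linarith+
  then show "sb n a b x y = 0" unfolding sb_def eunit_def
    by (simp only: if_False mult_zero_right diff_zero)
next
  fix x y assume that: "x < 2*n" "y < 2*n"
  have e: "sg n x * sg n y * (dl x c * dl y d) = sg n c * sg n d * (dl x c * dl y d)" for c d
    by (cases "x = c"; cases "y = d") (simp_all add: dl_def)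
  have "sg n x * sg n y * sb n a b x y
      = sg n x * sg n y * (dl x a * dl y b) - sg n a * sg n b * (sg n x * sg n y * (dl x (cj n b) * dl y (cj n a)))"
    by (simp add: sb_dl right_diff_distrib mult_ac)
  also have "\<dots> = sg n a * sg n b * (dl x a * dl y b) - dl x (cj n b) * dl y (cj n a)"
    unfolding e sg_cj[OF ab(1)] sg_cj[OF ab(2)] by (simp add: mult_ac)
  finally show "sb n a b (cj n y) (cj n x) = - (sg n x * sg n y * sb n a b x y)"
    using ab that by (simp add: sb_dl dl_cj mult.commute)
qed

lemma mzero_in_sp: "mzero \<in> sp n"
  by (rule spI) (auto simp: mzero_def)

lemma msc_in_sp: "X \<in> sp n \<Longrightarrow> msc c X \<in> sp n"
  by (rule spI) (auto simp: sp_outside sp_sym msc_def)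

lemma madd_in_sp: "X \<in> sp n \<Longrightarrow> Y \<in> sp n \<Longrightarrow> madd X Y \<in> sp n"
  by (rule spI) (auto simp: sp_outside sp_sym madd_def algebra_simps)

text \<open>Elements of sp(n) are the -1 eigenvectors of the symplectic transpose, which reverses
  products. In coordinates: reindex the inner sum by \<open>cj\<close>; the sign of the inner index
  occurs twice and disappears. Closure under \<open>br\<close> follows.\<close>

lemma mmul_cj:
  assumes "X \<in> sp n" "Y \<in> sp n" "a < 2*n" "b < 2*n"
  shows "mmul n X Y (cj n b) (cj n a) = sg n a * sg n b * mmul n Y X a b"
proof -
  have "mmul n X Y (cj n b) (cj n a) = (\<Sum>e<2*n. X (cj n b) (cj n e) * Y (cj n e) (cj n a))"
    unfolding mmul_def by (rule sum_cj[symmetric])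
  also have "\<dots> = (\<Sum>e<2*n. sg n a * sg n b * (Y a e * X e b))"
    using assms by (intro sum.cong refl) (simp add: sp_sym mult.commute mult.left_commute)
  finally show ?thesis by (simp add: mmul_def sum_distrib_left)
qed

lemma br_in_sp:
  assumes "X \<in> sp n" "Y \<in> sp n"
  shows "br n X Y \<in> sp n"
proof (rule spI)
  show "br n X Y a b = 0" if "2*n \<le> a \<or> 2*n \<le> b" for a b
    using that assms by (auto simp: br_def mmul_def sp_outside)
qed (use assms in \<open>simp add: br_def mmul_cj algebra_simps\<close>)

lemma mmul_sb_left:
  assumes "a < 2*n" "b < 2*n"
  shows "mmul n (sb n a b) M x y = dl x a * M b y - sg n a * sg n b * (dl x (cj n b) * M (cj n a) y)"
proof -
  have "sb n a b x e * M e y = dl x a * (dl e b * M e y)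
      - sg n a * sg n b * (dl x (cj n b) * (dl e (cj n a) * M e y))" for e
    by (simp add: sb_dl algebra_simps)
  then show ?thesis unfolding mmul_def
    using assms by (simp add: sum_subtractf sum_distrib_left[symmetric] sum_dl)
qed

lemma mmul_sb_right:
  assumes "a < 2*n" "b < 2*n"
  shows "mmul n M (sb n a b) x y = dl y b * M x a - sg n a * sg n b * (dl y (cj n a) * M x (cj n b))"
proof -
  have "M x e * sb n a b e y = dl y b * (dl e a * M x e)
      - sg n a * sg n b * (dl y (cj n a) * (dl e (cj n b) * M x e))" for e
    by (simp add: sb_dl algebra_simps)
  then show ?thesis unfolding mmul_def
    using assms by (simp add: sum_subtractf sum_distrib_left[symmetric] sum_dl)
qed

lemma trace_sp: "X \<in> sp n \<Longrightarrow> (\<Sum>a<2*n. X a a) = 0"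
proof -
  assume "X \<in> sp n"
  then have "(\<Sum>a<2*n. X (cj n a) (cj n a)) = (\<Sum>a<2*n. - X a a)"
    by (intro sum.cong) (auto simp: sp_sym)
  then show ?thesis using sum_cj[of "\<lambda>a. X a a" n] by (simp add: sum_negf)
qed

lemma br_msc: "br n X (msc c Y) = msc c (br n X Y)" "br n (msc c X) Y = msc c (br n X Y)"
  by (auto simp: br_def mmul_def msc_def sum_distrib_left algebra_simps)

lemma br_madd: "br n X (madd Y Z) = madd (br n X Y) (br n X Z)"
   "br n (madd X Y) Z = madd (br n X Z) (br n Y Z)"
  by (auto simp: br_def mmul_def madd_def sum.distrib algebra_simps)

subsection \<open>The Killing form\<close>

definition trp :: "nat \<Rightarrow> mat \<Rightarrow> mat \<Rightarrow> complex" where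
  "trp n A B = (\<Sum>a<2*n. \<Sum>b<2*n. A a b * B b a)"

text \<open>Passes between sums over all pairs, natural for the matrices \<open>sb\<close>, and sums
  over j <= k, in which \<open>sp_trace\<close> and \<open>Dz\<close> are indexed.\<close>

lemma sum_square_triangle:
  "(\<Sum>j<n. \<Sum>k<n. g j k) = (\<Sum>j<n. \<Sum>k\<in>{j..<n}. if j = k then g j j else g j k + g k j)"
  for g :: "nat \<Rightarrow> nat \<Rightarrow> complex"
proof (induction n)
  case (Suc n)
  have *: "{n..<Suc n} = {n}" by auto
  have "(\<Sum>k\<in>{j..<Suc n}. if j = k then g j j else g j k + g k j)
     = (\<Sum>k\<in>{j..<n}. if j = k then g j j else g j k + g k j) + (g j n + g n j)" if "j < n" for j
    using that by simp
  then have "(\<Sum>j<Suc n. \<Sum>k\<in>{j..<Suc n}. if j = k then g j j else g j k + g k j)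
     = (\<Sum>j<n. \<Sum>k<n. g j k) + (\<Sum>j<n. g j n) + (\<Sum>j<n. g n j) + g n n"
    using Suc by (simp add: sum.distrib * del: sum.op_ivl_Suc)
  then show ?case by (simp add: sum.distrib)
qed simp

lemma EA_sb: "j < n \<Longrightarrow> k < n \<Longrightarrow> EA n j k = sb n j k"
  by (auto simp: EA_def sb_def eunit_def sg_def cj_def fun_eq_iff)

lemma EB_sb: "j < n \<Longrightarrow> k < n \<Longrightarrow> sb n j (n + k) = msc (if j = k then 2 else 1) (EB n j k)"
  by (auto simp: EB_def sb_def eunit_def sg_def cj_def fun_eq_iff msc_def)

lemma EC_sb: "j < n \<Longrightarrow> k < n \<Longrightarrow> sb n (n + j) k = msc (if j = k then 2 else 1) (EC n j k)"
  by (auto simp: EC_def sb_def eunit_def sg_def cj_def fun_eq_iff msc_def)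

lemma sb_cj: "a < 2*n \<Longrightarrow> b < 2*n \<Longrightarrow> sb n (cj n b) (cj n a) = msc (- (sg n a * sg n b)) (sb n a b)"
  by (auto simp: sb_def msc_def fun_eq_iff algebra_simps)

text \<open>The matrices \<open>sb n a b\<close> and \<open>sb n (cj n b) (cj n a)\<close> are
  proportional and contribute equally, so each basis direction off the long roots is met twice. A
  diagonal EB or EC is met once, but doubled inside \<open>sb\<close>. Homogeneity of T is enough
  because every \<open>sb\<close> is a multiple of one basis element.\<close>

lemma sp_trace_sb:
  assumes T: "\<And>E. E \<in> sp n \<Longrightarrow> T E \<in> sp n" and Tsc: "\<And>c E. T (msc c E) = msc c (T E)"
  shows "2 * sp_trace n T = (\<Sum>a<2*n. \<Sum>b<2*n. T (sb n a b) a b)"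
proof -
  have flip: "T (sb n (cj n b) (cj n a)) (cj n b) (cj n a) = T (sb n a b) a b" if "a < 2*n" "b < 2*n" for a b
  proof -
    have "T (sb n a b) \<in> sp n" using that by (simp add: T sb_in_sp)
    then show ?thesis using that unfolding sb_cj[OF that] Tsc
      by (simp add: msc_def sp_sym mult.assoc mult.left_commute[of "sg n b"])
  qed
  have A: "(\<Sum>j<n. \<Sum>k<n. T (sb n (n+j) (n+k)) (n+j) (n+k)) = (\<Sum>j<n. \<Sum>k<n. T (sb n j k) j k)"
  proof -
    have "T (sb n (n+j) (n+k)) (n+j) (n+k) = T (sb n k j) k j" if "j < n" "k < n" for j k
      using flip[of k j] that by (simp add: cj_def add.commute)
    then have "(\<Sum>j<n. \<Sum>k<n. T (sb n (n+j) (n+k)) (n+j) (n+k)) = (\<Sum>j<n. \<Sum>k<n. T (sb n k j) k j)"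
      by (intro sum.cong) auto
    then show ?thesis using sum.swap[of "\<lambda>j k. T (sb n k j) k j" "{..<n}" "{..<n}"] by simp
  qed
  have B: "(\<Sum>j<n. \<Sum>k<n. T (sb n j (n+k)) j (n+k)) = 2 * (\<Sum>j<n. \<Sum>k\<in>{j..<n}. T (EB n j k) j (n + k))"
  proof -
    have e: "T (sb n j (n+k)) j (n+k) = (if j = k then 2 else 1) * T (EB n j k) j (n+k)" if "j < n" "k < n" for j k
      unfolding EB_sb[OF that] Tsc unfolding msc_def ..
    have "T (sb n k (n+j)) k (n+j) = T (sb n j (n+k)) j (n+k)" if "j < n" "k < n" for j k
      using flip[of j "n+k"] that by (simp add: cj_def add.commute)
    then have "(if j = k then T (sb n j (n+j)) j (n+j) else T (sb n j (n+k)) j (n+k) + T (sb n k (n+j)) k (n+j))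
       = 2 * T (EB n j k) j (n+k)" if "j < n" "k < n" for j k
      using that e[OF that] by auto
    then show ?thesis unfolding sum_square_triangle sum_distrib_left by (intro sum.cong) auto
  qed
  have C: "(\<Sum>j<n. \<Sum>k<n. T (sb n (n+j) k) (n+j) k) = 2 * (\<Sum>j<n. \<Sum>k\<in>{j..<n}. T (EC n j k) (n + j) k)"
  proof -
    have e: "T (sb n (n+j) k) (n+j) k = (if j = k then 2 else 1) * T (EC n j k) (n+j) k" if "j < n" "k < n" for j k
      unfolding EC_sb[OF that] Tsc unfolding msc_def ..
    have "T (sb n (n+k) j) (n+k) j = T (sb n (n+j) k) (n+j) k" if "j < n" "k < n" for j k
      using flip[of "n+j" k] that by (simp add: cj_def add.commute)
    then have "(if j = k then T (sb n (n+j) j) (n+j) j else T (sb n (n+j) k) (n+j) k + T (sb n (n+k) j) (n+k) j)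
       = 2 * T (EC n j k) (n+j) k" if "j < n" "k < n" for j k
      using that e[OF that] by auto
    then show ?thesis unfolding sum_square_triangle sum_distrib_left by (intro sum.cong) auto
  qed
  have D: "(\<Sum>j<n. \<Sum>k<n. T (EA n j k) j k) = (\<Sum>j<n. \<Sum>k<n. T (sb n j k) j k)"
    by (simp add: EA_sb)
  show ?thesis
    unfolding sp_trace_def D sum_split_double sum.distrib A B C by (simp add: algebra_simps)
qed

text \<open>The classical proportionality of Killing form and trace form. In the doubled trace, the
  two products AB and BA give 2n each, the delta terms give 2, the two mixed terms give 1 each, and
  the products of diagonal entries cancel because elements of sp(n) are traceless: 4n+4 in
  total.\<close>

lemma kil_sp:
  assumes A: "A \<in> sp n" and B: "B \<in> sp n"
  shows "kil n A B = (2 * of_nat n + 2) * trp n A B"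
proof -
  have tr1: "(\<Sum>a<2*n. mmul n A B a a) = trp n A B"
    by (simp add: trp_def mmul_def)
  have tr2: "(\<Sum>a<2*n. mmul n B A a a) = trp n A B"
    unfolding trp_def mmul_def by (subst sum.swap) (simp add: mult.commute)
  have entry: "br n A (br n B (sb n a b)) a b =
     mmul n A B a a + mmul n B A b b + dl b (cj n a) * (mmul n A B a a + mmul n B A b b)
     - A a a * B b b - B a a * A b b + A a (cj n b) * B (cj n b) a + B a (cj n b) * A (cj n b) a"
    if ab: "a < 2*n" "b < 2*n" for a b
  proof -
    have s: "sg n a * sg n b * X (cj n a) b = X (cj n b) a" if "X \<in> sp n" for X
      using sp_sym[OF that, of "cj n a" b] ab by (simp add: mult.assoc)
    \<comment> \<open>On the support of the delta, b is the partner of a, so the two signs multiply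
      to -1.\<close>
    have c: "sg n a * sg n b * (dl b (cj n a) * z (cj n b)) = - (dl b (cj n a) * z a)" for z
      using ab by (simp add: dl_def)
    have c': "sg n a * sg n b * (dl a (cj n b) * z (cj n a)) = - (dl b (cj n a) * z b)" for z
      using ab by (auto simp: dl_def)
    have p0: "br n B (sb n a b) e b = B e a + dl b (cj n a) * B e a
       - dl e a * B b b + dl e (cj n b) * B (cj n b) a" for e
      using ab s[OF B] c[of "\<lambda>x. B e x"] by (simp add: br_def mmul_sb_left mmul_sb_right mult_ac)
    have p: "A a e * br n B (sb n a b) e b = A a e * B e a + dl b (cj n a) * (A a e * B e a)
       - dl e a * (A a e * B b b) + dl e (cj n b) * (A a e * B (cj n b) a)" for e
      unfolding p0 by (simp add: algebra_simps)
    have "br n B (sb n a b) a e * A e b = - (B b e * A e b) - dl b (cj n a) * (B b e * A e b)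
       + dl e b * (B a a * A e b) - dl e (cj n a) * (sg n a * sg n b * (B a (cj n b) * A e b))" for e
      using ab c'[of "\<lambda>x. B x e"] by (simp add: br_def mmul_sb_left mmul_sb_right algebra_simps)
    then have "mmul n (br n B (sb n a b)) A a b = - mmul n B A b b - dl b (cj n a) * mmul n B A b b
       + B a a * A b b - sg n a * sg n b * (B a (cj n b) * A (cj n a) b)"
      unfolding mmul_def using ab
      by (simp add: sum.distrib sum_subtractf sum_negf sum_distrib_left[symmetric] sum_dl)
    moreover have "sg n a * sg n b * (B a (cj n b) * A (cj n a) b) = B a (cj n b) * A (cj n b) a"
      using s[OF A] by (metis mult.left_commute)
    moreover have "mmul n A (br n B (sb n a b)) a b = mmul n A B a a + dl b (cj n a) * mmul n A B a a
       - A a a * B b b + A a (cj n b) * B (cj n b) a"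
      unfolding mmul_def[of n A] using ab
      by (simp add: p sum.distrib sum_subtractf sum_distrib_left[symmetric] sum_dl)
    ultimately show ?thesis
      by (subst br_def) (simp add: distrib_left)
  qed
  have tt: "(\<Sum>a<2*n. \<Sum>b<2*n. X a (cj n b) * Y (cj n b) a) = trp n X Y" for X Y
    unfolding trp_def by (rule sum.cong[OF refl]) (rule sum_cj)
  have cc: "(\<Sum>a<2*n. mmul n B A (cj n a) (cj n a)) = trp n A B"
    using sum_cj[of "\<lambda>a. mmul n B A a a" n] tr2 by simp
  have comm: "trp n B A = trp n A B"
    unfolding trp_def by (subst sum.swap) (simp add: mult.commute)
  have prod0: "(\<Sum>a<2*n. \<Sum>b<2*n. X a a * Y b b) = 0" if "X \<in> sp n" for X Y
    using trace_sp[OF that] by (simp flip: sum_distrib_left sum_distrib_right)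
  have dd: "(\<Sum>a<2*n. \<Sum>b<2*n. dl b (cj n a) * (mmul n A B a a + mmul n B A b b)) = 2 * trp n A B"
  proof -
    have "(\<Sum>b<2*n. dl b (cj n a) * (mmul n A B a a + mmul n B A b b))
        = mmul n A B a a + mmul n B A (cj n a) (cj n a)" if "a < 2*n" for a
      using that by (simp add: sum_dl)
    then have "(\<Sum>a<2*n. \<Sum>b<2*n. dl b (cj n a) * (mmul n A B a a + mmul n B A b b))
        = (\<Sum>a<2*n. mmul n A B a a + mmul n B A (cj n a) (cj n a))"
      by (intro sum.cong) auto
    then show ?thesis by (simp add: sum.distrib tr1 cc)
  qed
  have nn: "(\<Sum>a<2*n. \<Sum>b<2*n. mmul n A B a a) = 2 * of_nat n * trp n A B"
    "(\<Sum>a<2*n. \<Sum>b<2*n. mmul n B A b b) = 2 * of_nat n * trp n A B"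
    using tr1 tr2 by (simp_all add: sum_distrib_left[symmetric])
  have "2 * kil n A B = (\<Sum>a<2*n. \<Sum>b<2*n. br n A (br n B (sb n a b)) a b)"
    unfolding kil_def by (rule sp_trace_sb) (auto simp: br_msc intro: br_in_sp A B)
  also have "\<dots> = (\<Sum>a<2*n. \<Sum>b<2*n. mmul n A B a a + mmul n B A b b
     + dl b (cj n a) * (mmul n A B a a + mmul n B A b b)
     - A a a * B b b - B a a * A b b + A a (cj n b) * B (cj n b) a + B a (cj n b) * A (cj n b) a)"
    by (intro sum.cong refl) (simp add: entry)
  also have "\<dots> = 2 * ((2 * of_nat n + 2) * trp n A B)"
    unfolding sum.distrib sum_subtractf dd nn tt prod0[OF A] prod0[OF B] comm by (simp add: algebra_simps)
  finally show ?thesis by simp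
qed

subsection \<open>Grading and root spaces\<close>

lemma br_diag:
  assumes "\<And>a b. a \<noteq> b \<Longrightarrow> H a b = 0" "a < 2*n" "b < 2*n"
  shows "br n H X a b = (H a a - H b b) * X a b"
proof -
  have "H a e * X e b = dl e a * (H a e * X e b)" "X a e * H e b = dl e b * (X a e * H e b)" for e
    using assms(1)[of a e] assms(1)[of e b] by (auto simp: dl_def)
  then have "mmul n H X a b = (\<Sum>e<2*n. dl e a * (H a e * X e b))"
    "mmul n X H a b = (\<Sum>e<2*n. dl e b * (X a e * H e b))"
    unfolding mmul_def by (auto intro: sum.cong)
  then have "mmul n H X a b = H a a * X a b" "mmul n X H a b = X a b * H b b"
    using assms(2,3) by (simp_all add: sum_dl)
  then show ?thesis by (simp add: br_def algebra_simps)
qed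

text \<open>The eigenvalue of \<open>Hq\<close> on the a-th standard basis vector. A matrix entry at
  (a, b) has degree \<open>ht n i a - ht n i b\<close>, which turns the grading into a condition on
  supports.\<close>

definition ht :: "nat \<Rightarrow> nat \<Rightarrow> nat \<Rightarrow> int" where
  "ht n i a = (if a < i then 1 else if n \<le> a \<and> a < n + i then -1 else 0)"

lemma ht_cj: "i \<le> n \<Longrightarrow> a < 2*n \<Longrightarrow> ht n i (cj n a) = - ht n i a"
  by (auto simp: ht_def cj_def)

lemma br_Hq:
  assumes "i \<le> n" "a < 2*n" "b < 2*n"
  shows "br n (Hq n i) X a b = of_int (ht n i a - ht n i b) * X a b"
proof -
  have "Hq n i c c = of_int (ht n i c)" for c
    using assms(1) by (auto simp: Hq_def ht_def)
  then show ?thesis using assms by (subst br_diag) (auto simp: Hq_def)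
qed

lemma grd_iff:
  assumes "i \<le> n"
  shows "X \<in> grd n i k \<longleftrightarrow> X \<in> sp n \<and> (\<forall>a<2*n. \<forall>b<2*n. X a b \<noteq> 0 \<longrightarrow> ht n i a - ht n i b = k)"
proof -
  have e: "br n (Hq n i) X a b = msc (of_int k) X a b \<longleftrightarrow> (X a b \<noteq> 0 \<longrightarrow> ht n i a - ht n i b = k)"
    if "a < 2*n" "b < 2*n" for a b
  proof -
    have "br n (Hq n i) X a b = msc (of_int k) X a b
      \<longleftrightarrow> of_int (ht n i a - ht n i b) * X a b = of_int k * X a b"
      unfolding br_Hq[OF assms that] msc_def ..
    also have "\<dots> \<longleftrightarrow> X a b = 0 \<or> of_int (ht n i a - ht n i b) = (of_int k :: complex)"
      unfolding mult_cancel_right by blast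
    also have "\<dots> \<longleftrightarrow> X a b = 0 \<or> ht n i a - ht n i b = k"
      by (simp only: of_int_eq_iff)
    finally show ?thesis by blast
  qed
  have o: "br n (Hq n i) X a b = msc (of_int k) X a b" if "X \<in> sp n" "\<not> (a < 2*n \<and> b < 2*n)" for a b
  proof -
    have "X a b = 0" using that by (auto intro: sp_outside)
    moreover have "Hq n i a e * X e b = 0" "X a e * Hq n i e b = 0" if "e < 2*n" for e
      using that \<open>\<not> (a < 2*n \<and> b < 2*n)\<close> \<open>X \<in> sp n\<close> assms by (auto simp: Hq_def sp_outside)
    ultimately show ?thesis
      by (simp add: br_def mmul_def msc_def del: mult_eq_0_iff)
  qed
  show ?thesis
  proof
    assume "X \<in> grd n i k"
    then show "X \<in> sp n \<and> (\<forall>a<2*n. \<forall>b<2*n. X a b \<noteq> 0 \<longrightarrow> ht n i a - ht n i b = k)"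
      unfolding grd_def using e by (metis (mono_tags, lifting) mem_Collect_eq)
  next
    assume *: "X \<in> sp n \<and> (\<forall>a<2*n. \<forall>b<2*n. X a b \<noteq> 0 \<longrightarrow> ht n i a - ht n i b = k)"
    then have "br n (Hq n i) X a b = msc (of_int k) X a b" for a b
      using e o by (cases "a < 2*n \<and> b < 2*n") blast+
    then show "X \<in> grd n i k" using * unfolding grd_def by blast
  qed
qed

lemma grd_sp: "X \<in> grd n i k \<Longrightarrow> X \<in> sp n"
  by (simp add: grd_def)

lemma grd_zero: "i \<le> n \<Longrightarrow> X \<in> grd n i k \<Longrightarrow> ht n i a - ht n i b \<noteq> k \<Longrightarrow> X a b = 0"
  using grd_iff sp_outside not_less by metis

lemma br_grd:
  assumes i: "i \<le> n" and X: "X \<in> grd n i k" and Y: "Y \<in> grd n i l"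
  shows "br n X Y \<in> grd n i (k + l)"
proof -
  have "ht n i a - ht n i b = k + l" if "br n X Y a b \<noteq> 0" for a b
  proof -
    have "mmul n X Y a b \<noteq> 0 \<or> mmul n Y X a b \<noteq> 0"
      using that by (auto simp: br_def)
    then obtain e where "X a e * Y e b \<noteq> 0 \<or> Y a e * X e b \<noteq> 0"
      unfolding mmul_def by (meson sum.neutral)
    then have "(X a e \<noteq> 0 \<and> Y e b \<noteq> 0) \<or> (Y a e \<noteq> 0 \<and> X e b \<noteq> 0)" by auto
    then have "(ht n i a - ht n i e = k \<and> ht n i e - ht n i b = l) \<or>
        (ht n i a - ht n i e = l \<and> ht n i e - ht n i b = k)"
      using grd_zero[OF i X] grd_zero[OF i Y] by blast
    then show ?thesis by linarith
  qed
  then show ?thesis using br_in_sp grd_sp X Y grd_iff[OF i] by blast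
qed

lemma sb_nonzero_cases: "sb n a b x y \<noteq> 0 \<Longrightarrow> (x = a \<and> y = b) \<or> (x = cj n b \<and> y = cj n a)"
  by (auto simp: sb_dl dl_def split: if_splits)

lemma sb_grd:
  assumes "i \<le> n" "a < 2*n" "b < 2*n" "k = ht n i a - ht n i b"
  shows "sb n a b \<in> grd n i k"
  unfolding grd_iff[OF assms(1)]
  using assms sb_in_sp[of a n b] by (auto dest!: sb_nonzero_cases simp: ht_cj)

lemma msc_grd: "X \<in> grd n i k \<Longrightarrow> msc c X \<in> grd n i k"
  by (auto simp: grd_def msc_in_sp br_msc) (simp add: msc_def fun_eq_iff)

lemma madd_grd: "X \<in> grd n i k \<Longrightarrow> Y \<in> grd n i k \<Longrightarrow> madd X Y \<in> grd n i k"
  by (auto simp: grd_def madd_in_sp br_madd) (simp add: madd_def msc_def fun_eq_iff algebra_simps)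

text \<open>The k-th coordinate of the weight of the a-th standard basis vector: eps_a in the first
  half of the indices, the negative of the partner's weight in the second. It is also evaluated at k
  >= n, where \<open>xi_cj\<close> makes it odd.\<close>

definition xi :: "nat \<Rightarrow> nat \<Rightarrow> nat \<Rightarrow> int" where
  "xi n a k = (if k = a then 1 else 0) - (if k = cj n a then 1 else 0)"

lemma xi_cj: "a < 2*n \<Longrightarrow> k < 2*n \<Longrightarrow> xi n a (cj n k) = - xi n a k"
  "a < 2*n \<Longrightarrow> k < 2*n \<Longrightarrow> xi n (cj n a) k = - xi n a k"
  by (auto simp: xi_def cj_eq_iff cj_inj)

text \<open>This is why root spaces are lines: a nonzero weight fixes the position of an entry up to
  the symplectic symmetry. After extension to the dual half by oddness, the difference is at least 1
  at k = a, which forces a' = a or b' = \<open>cj n a\<close>; one more evaluation fixes the other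
  index.\<close>

lemma xi_diff_unique:
  assumes lt: "a < 2*n" "b < 2*n" "a' < 2*n" "b' < 2*n" and ne: "a \<noteq> b"
    and eq: "\<And>k. k < n \<Longrightarrow> xi n a' k - xi n b' k = xi n a k - xi n b k"
  shows "(a' = a \<and> b' = b) \<or> (a' = cj n b \<and> b' = cj n a)"
proof -
  have eq2: "xi n a' c - xi n b' c = xi n a c - xi n b c" if "c < 2*n" for c
  proof (cases "c < n")
    case False
    then have "cj n c < n" using that by (auto simp: cj_def)
    from eq[OF this] show ?thesis using lt that by (simp add: xi_cj)
  qed (simp add: eq)
  have one: "xi n c d = 1 \<longleftrightarrow> d = c" if "c < 2*n" for c d
    using that cj_neq[of c n] by (auto simp: xi_def)
  have "xi n a a - xi n b a \<ge> 1" using lt ne cj_neq[of a n] by (auto simp: xi_def)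
  then have "xi n a' a - xi n b' a \<ge> 1" using eq2 lt by auto
  then have "xi n a' a = 1 \<or> xi n b' a = -1" by (auto simp: xi_def split: if_splits)
  then have "xi n a' a = 1 \<or> xi n b' (cj n a) = 1" using xi_cj(1)[of b' n a] lt by auto
  then consider "a' = a" | "b' = cj n a" using one lt by metis
  then show ?thesis
  proof cases
    case 1
    then have "xi n b' b = 1" using eq2[of b] lt one[of b b] by auto
    then have "b = b'" using one lt by blast
    with 1 show ?thesis by simp
  next
    case 2
    have "xi n b (cj n b) = -1" using lt xi_cj(1)[of b n b] one[of b b] by auto
    moreover have "xi n b' (cj n b) = - xi n a (cj n b)" using 2 lt by (simp add: xi_cj)
    ultimately have "xi n a' (cj n b) = 1" using eq2[of "cj n b"] lt by auto
    then have "cj n b = a'" using one lt by blast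
    with 2 show ?thesis by simp
  qed
qed

lemma cartan_sb: "k < n \<Longrightarrow> sb n k k \<in> cartan n"
  using sb_in_sp[of k n k] sb_nonzero_cases[of n k k] unfolding cartan_def by auto

lemma sb_diag: "k < n \<Longrightarrow> a < 2*n \<Longrightarrow> sb n k k a a = of_int (xi n a k)"
  by (auto simp: sb_dl dl_def xi_def cj_eq_iff)

lemma wev_sb: "k < n \<Longrightarrow> wev n \<alpha> (sb n k k) = of_int (\<alpha> k)"
proof -
  assume "k < n"
  then have "of_int (\<alpha> j) * sb n k k j j = dl j k * of_int (\<alpha> j)" if "j < n" for j
    using that by (simp add: sb_diag) (auto simp: xi_def dl_def cj_def)
  then have "wev n \<alpha> (sb n k k) = (\<Sum>j<n. dl j k * of_int (\<alpha> j))"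
    unfolding wev_def by (intro sum.cong) auto
  then show ?thesis using \<open>k < n\<close> by (simp add: sum_dl)
qed

lemma cartan_entry: "H \<in> cartan n \<Longrightarrow> a < 2*n \<Longrightarrow> H a a = wev n (xi n a) H"
proof -
  assume H: "H \<in> cartan n" and a: "a < 2*n"
  have s: "H (cj n a) (cj n a) = - H a a" using H a sp_sym[of H n a a] by (auto simp: cartan_def)
  show ?thesis
  proof (cases "a < n")
    case True
    then have "of_int (xi n a j) * H j j = dl j a * H j j" if "j < n" for j
      using that by (auto simp: xi_def dl_def cj_def)
    then have "wev n (xi n a) H = (\<Sum>j<n. dl j a * H j j)"
      unfolding wev_def by (intro sum.cong) auto
    then show ?thesis using True by (simp add: sum_dl)
  next
    case False
    then have c: "cj n a < n" using a by (auto simp: cj_def)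
    have "of_int (xi n a j) * H j j = - (dl j (cj n a) * H j j)" if "j < n" for j
      using that False by (auto simp: xi_def dl_def)
    then have "wev n (xi n a) H = - (\<Sum>j<n. dl j (cj n a) * H j j)"
      unfolding wev_def sum_negf[symmetric] by (intro sum.cong) auto
    then show ?thesis using c s by (simp add: sum_dl)
  qed
qed

lemma rootsp_weight:
  assumes "X \<in> rootsp n \<alpha>" "a < 2*n" "b < 2*n" "X a b \<noteq> 0" "k < n"
  shows "xi n a k - xi n b k = \<alpha> k"
proof -
  have "br n (sb n k k) X a b = msc (wev n \<alpha> (sb n k k)) X a b"
    using assms cartan_sb by (auto simp: rootsp_def)
  moreover have "br n (sb n k k) X a b = (sb n k k a a - sb n k k b b) * X a b"
    using cartan_sb[OF assms(5)] assms by (intro br_diag) (auto simp: cartan_def)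
  ultimately have "of_int (xi n a k - xi n b k) = (of_int (\<alpha> k) :: complex)"
    using assms by (simp add: wev_sb msc_def sb_diag)
  then show ?thesis by (simp only: of_int_eq_iff)
qed

lemma rootspI:
  assumes "X \<in> sp n"
    "\<And>a b k. a < 2*n \<Longrightarrow> b < 2*n \<Longrightarrow> X a b \<noteq> 0 \<Longrightarrow> k < n \<Longrightarrow> xi n a k - xi n b k = \<alpha> k"
  shows "X \<in> rootsp n \<alpha>"
proof -
  have "br n H X a b = msc (wev n \<alpha> H) X a b" if H: "H \<in> cartan n" for H a b
  proof (cases "a < 2*n \<and> b < 2*n")
    case True
    have "(H a a - H b b) * X a b = wev n \<alpha> H * X a b"
    proof (cases "X a b = 0")
      case False
      have "H a a - H b b = (\<Sum>j<n. of_int (xi n a j - xi n b j) * H j j)"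
        using True H by (simp add: cartan_entry wev_def sum_subtractf algebra_simps)
      also have "\<dots> = wev n \<alpha> H"
        unfolding wev_def using assms(2) True False by (intro sum.cong) auto
      finally show ?thesis by simp
    qed simp
    moreover have "br n H X a b = (H a a - H b b) * X a b"
      using H True by (intro br_diag) (auto simp: cartan_def)
    ultimately show ?thesis by (simp add: msc_def)
  next
    case False
    then have "br n H X a b = 0" "X a b = 0"
      using br_in_sp[of H n X] assms(1) H by (auto simp: cartan_def intro: sp_outside)
    then show ?thesis by (simp add: msc_def)
  qed
  then show ?thesis using assms(1) unfolding rootsp_def by blast
qed

lemma rootsp_sb:
  assumes "a < 2*n" "b < 2*n" "\<And>k. k < n \<Longrightarrow> \<alpha> k = xi n a k - xi n b k"
  shows "sb n a b \<in> rootsp n \<alpha>"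
  using assms by (intro rootspI) (auto dest!: sb_nonzero_cases intro: sb_in_sp simp: xi_cj)

lemma sb_self_entry: "a < 2*n \<Longrightarrow> b < 2*n \<Longrightarrow> sb n a b a b = 1 + dl b (cj n a)"
  by (cases "b = cj n a") (auto simp: sb_dl dl_def)

lemma one_plus_dl[simp]: "1 + dl a b \<noteq> 0"
  by (simp add: dl_def)

text \<open>Outside the two positions occupied by \<open>sb n a b\<close> an entry would have
  another weight. The denominator is 2 exactly for long roots, where the two elementary matrices of
  \<open>sb\<close> coincide and add up.\<close>

lemma rootsp_line:
  assumes lt: "a < 2*n" "b < 2*n" and ne: "a \<noteq> b"
    and al: "\<And>k. k < n \<Longrightarrow> \<alpha> k = xi n a k - xi n b k" and X: "X \<in> rootsp n \<alpha>"
  shows "X = msc (X a b / (1 + dl b (cj n a))) (sb n a b)"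
proof -
  have sp: "X \<in> sp n" using X by (simp add: rootsp_def)
  let ?c = "X a b / (1 + dl b (cj n a))"
  have *: "X x y = ?c * sb n a b x y" for x y
  proof (cases "(x = a \<and> y = b) \<or> (x = cj n b \<and> y = cj n a)")
    case True
    have e: "X a b = ?c * sb n a b a b" using lt by (simp add: sb_self_entry)
    have f: "X (cj n b) (cj n a) = - (sg n a * sg n b * X a b)"
      "sb n a b (cj n b) (cj n a) = - (sg n a * sg n b * sb n a b a b)"
      using sp_sym[OF sp] sp_sym[OF sb_in_sp] lt by blast+
    have "X (cj n b) (cj n a) = - (sg n a * sg n b * (?c * sb n a b a b))"
      using f(1) e by (simp only:)
    also have "\<dots> = ?c * sb n a b (cj n b) (cj n a)"
      unfolding f(2) by (simp only: mult_minus_right mult_ac)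
    finally show ?thesis using True e by blast
  next
    case False
    then have "sb n a b x y = 0" using sb_nonzero_cases by blast
    moreover have "X x y = 0"
    proof (rule ccontr)
      assume nz: "X x y \<noteq> 0"
      then have xy: "x < 2*n" "y < 2*n" using sp_outside[OF sp] not_less by blast+
      have "xi n x k - xi n y k = xi n a k - xi n b k" if "k < n" for k
        using rootsp_weight[OF X xy nz that] al[OF that] by simp
      then show False using xi_diff_unique[OF lt xy ne] False by blast
    qed
    ultimately show ?thesis by simp
  qed
  show ?thesis by (intro ext) (subst *, simp add: msc_def)
qed

text \<open>Since \<open>rv\<close> is an arbitrary choice, the scalar t stays unknown. It is
  carried along until it cancels against its inverse in \<open>rvd\<close>.\<close>

lemma rv_line:
  assumes lt: "a < 2*n" "b < 2*n" and ne: "a \<noteq> b"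
    and al: "\<And>k. k < n \<Longrightarrow> \<alpha> k = xi n a k - xi n b k"
  shows "\<exists>t. t \<noteq> 0 \<and> rv n \<alpha> = msc t (sb n a b)"
proof -
  have "sb n a b \<in> rootsp n \<alpha> \<and> sb n a b \<noteq> mzero"
  proof
    have "sb n a b a b \<noteq> mzero a b" using lt by (simp add: sb_self_entry mzero_def)
    then show "sb n a b \<noteq> mzero" by metis
  qed (use lt al in \<open>rule rootsp_sb\<close>)
  then have rv: "rv n \<alpha> \<in> rootsp n \<alpha> \<and> rv n \<alpha> \<noteq> mzero"
    unfolding rv_def by (rule someI[where P = "\<lambda>X. X \<in> rootsp n \<alpha> \<and> X \<noteq> mzero"])
  let ?c = "rv n \<alpha> a b / (1 + dl b (cj n a))"
  have e: "rv n \<alpha> = msc ?c (sb n a b)"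
    using rootsp_line[OF lt ne al] rv by blast
  moreover have "?c \<noteq> 0"
  proof
    assume "?c = 0"
    then have "rv n \<alpha> = msc 0 (sb n a b)" using e by simp
    then show False using rv by (auto simp: msc_def mzero_def)
  qed
  ultimately show ?thesis by blast
qed

lemma trp_sb:
  assumes "M \<in> sp n" "a < 2*n" "b < 2*n"
  shows "trp n M (sb n a b) = 2 * M b a"
proof -
  have "trp n M (sb n a b) = (\<Sum>x<2*n. mmul n M (sb n a b) x x)"
    by (simp add: trp_def mmul_def)
  also have "\<dots> = M b a - sg n a * sg n b * M (cj n a) (cj n b)"
    using assms by (simp add: mmul_sb_right sum_subtractf sum_distrib_left[symmetric] sum_dl)
  also have "\<dots> = 2 * M b a"
    using assms sp_sym[of M n b a] by (simp add: mult_ac)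
  finally show ?thesis .
qed

text \<open>The factor 4n+4 is 2n+2 from \<open>kil_sp\<close> times 2 from \<open>trp_sb\<close>;
  the last factor again corrects for long roots.\<close>

lemma rvd_line:
  assumes lt: "a < 2*n" "b < 2*n" and ne: "a \<noteq> b"
    and al: "\<And>k. k < n \<Longrightarrow> \<alpha> k = xi n a k - xi n b k"
    and t: "t \<noteq> 0" "rv n \<alpha> = msc t (sb n a b)"
  shows "rvd n \<alpha> = msc (1 / (t * (4 * of_nat n + 4) * (1 + dl b (cj n a)))) (sb n b a)"
proof -
  have n0: "(4 * of_nat n + 4 :: complex) \<noteq> 0"
    by (metis of_nat_Suc of_nat_0_neq mult_eq_0_iff distrib_left mult.right_neutral add.commute zero_neq_numeral)
  have dc: "dl a (cj n b) = dl b (cj n a)" using lt by (metis dl_cj(1) dl_sym)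
  have tm: "trp n X (msc c Y) = c * trp n X Y" "trp n (msc c X) Y = c * trp n X Y" for X Y c
    by (simp_all add: trp_def msc_def sum_distrib_left mult_ac)
  have k: "kil n (msc c (sb n b a)) (rv n \<alpha>) = c * (t * (4 * of_nat n + 4) * (1 + dl b (cj n a)))" for c
    using lt unfolding t(2)
    by (subst kil_sp) (simp_all add: msc_in_sp sb_in_sp tm trp_sb sb_self_entry dc algebra_simps)
  have al': "- \<alpha> k = xi n b k - xi n a k" if "k < n" for k
    using al[OF that] by simp
  let ?c = "1 / (t * (4 * of_nat n + 4) * (1 + dl b (cj n a)))"
  show ?thesis unfolding rvd_def
  proof (rule the_equality)
    have "msc ?c (sb n b a) \<in> rootsp n (\<lambda>j. - \<alpha> j)"
      using rootsp_sb[OF lt(2,1) al'] unfolding rootsp_def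
      by (auto simp: msc_in_sp br_msc) (simp add: msc_def mult_ac)
    moreover have "kil n (msc ?c (sb n b a)) (rv n \<alpha>) = 1"
      unfolding k using t n0 by simp
    ultimately show "msc ?c (sb n b a) \<in> rootsp n (\<lambda>j. - \<alpha> j) \<and> kil n (msc ?c (sb n b a)) (rv n \<alpha>) = 1" ..
  next
    fix Y assume Y: "Y \<in> rootsp n (\<lambda>j. - \<alpha> j) \<and> kil n Y (rv n \<alpha>) = 1"
    then obtain c where c: "Y = msc c (sb n b a)"
      using rootsp_line[OF lt(2,1) ne[symmetric] al'] by blast
    then have "c * (t * (4 * of_nat n + 4) * (1 + dl b (cj n a))) = 1" using Y k by simp
    then have "c = ?c" using eq_divide_imp[of "t * (4 * of_nat n + 4) * (1 + dl b (cj n a))" c 1] t n0 by simp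
    then show "Y = msc ?c (sb n b a)" using c by simp
  qed
qed

subsection \<open>Root bases of the graded pieces\<close>

text \<open>The indices of degree 0. They span the symplectic space of dimension 2(n-i) on which the
  factor sp(n-i) of the Levi subalgebra acts.\<close>

definition Mid :: "nat \<Rightarrow> nat \<Rightarrow> nat set" where
  "Mid n i = {i..<n} \<union> {n+i..<2*n}"

text \<open>The weight of \<open>sb n p c\<close>. Letting c run through \<open>Mid n i\<close>
  treats the roots eps_p - eps_k and eps_p + eps_k of g(1) together.\<close>

definition wtof :: "nat \<Rightarrow> nat \<Rightarrow> nat \<Rightarrow> wt" where
  "wtof n p c = (if c < n then wminus (eps p) (eps c) else wplus (eps p) (eps (c - n)))"

lemma finite_Mid[simp]: "finite (Mid n i)"
  by (simp add: Mid_def)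

lemma Mid_less: "c \<in> Mid n i \<Longrightarrow> c < 2*n"
  by (auto simp: Mid_def)

lemma Mid_cj: "i \<le> n \<Longrightarrow> c \<in> Mid n i \<Longrightarrow> cj n c \<in> Mid n i"
  by (auto simp: Mid_def cj_def)

lemma Mid_ht: "i \<le> n \<Longrightarrow> c \<in> Mid n i \<longleftrightarrow> c < 2*n \<and> ht n i c = 0"
  by (auto simp: Mid_def ht_def)

lemma card_Mid: "i \<le> n \<Longrightarrow> card (Mid n i) = 2 * (n - i)"
  unfolding Mid_def by (subst card_Un_disjoint) auto

lemma wtof_xi: "p < n \<Longrightarrow> c < 2*n \<Longrightarrow> k < n \<Longrightarrow> wtof n p c k = xi n p k - xi n c k"
  by (auto simp: wtof_def wminus_def wplus_def eps_def xi_def cj_def)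

lemma inj_on_wtof:
  assumes "i \<le> n"
  shows "inj_on (\<lambda>(p,c). wtof n p c) ({..<i} \<times> Mid n i)"
proof (rule inj_onI; clarify)
  fix p c p' c' assume *: "p < i" "c \<in> Mid n i" "p' < i" "c' \<in> Mid n i" "wtof n p c = wtof n p' c'"
  have "xi n p k - xi n c k = xi n p' k - xi n c' k" if "k < n" for k
    using wtof_xi[of p n c k] wtof_xi[of p' n c' k] * assms that
      Mid_less[OF *(2)] Mid_less[OF *(4)] by auto
  then have "(p = p' \<and> c = c') \<or> (p = cj n c' \<and> c = cj n p')"
    using * assms by (intro xi_diff_unique) (auto simp: Mid_def)
  moreover have "cj n c' \<noteq> p" using * assms Mid_cj[of i n c'] by (auto simp: Mid_def)
  ultimately show "p = p' \<and> c = c'" by auto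
qed

lemma Dg1_wtof:
  assumes "i \<le> n"
  shows "Dg1 n i = (\<lambda>(p,c). wtof n p c) ` ({..<i} \<times> Mid n i)"
proof (intro equalityI subsetI)
  fix x assume "x \<in> Dg1 n i"
  then consider j k where "x = wplus (eps j) (eps k)" "j < i" "i \<le> k" "k < n"
    | j k where "x = wminus (eps j) (eps k)" "j < i" "i \<le> k" "k < n"
    unfolding Dg1_def by blast
  then show "x \<in> (\<lambda>(p,c). wtof n p c) ` ({..<i} \<times> Mid n i)"
  proof cases
    case 1
    then have "(j, n + k) \<in> {..<i} \<times> Mid n i" "x = wtof n j (n + k)" by (auto simp: Mid_def wtof_def)
    then show ?thesis by force
  next
    case 2
    then have "(j, k) \<in> {..<i} \<times> Mid n i" "x = wtof n j k" by (auto simp: Mid_def wtof_def)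
    then show ?thesis by force
  qed
next
  fix x assume "x \<in> (\<lambda>(p,c). wtof n p c) ` ({..<i} \<times> Mid n i)"
  then obtain p c where *: "p < i" "c \<in> Mid n i" "x = wtof n p c" by auto
  show "x \<in> Dg1 n i"
  proof (cases "c < n")
    case True
    then show ?thesis using * by (auto simp: Dg1_def Mid_def wtof_def)
  next
    case False
    then have "x = wplus (eps p) (eps (c - n))" "i \<le> c - n" "c - n < n" using * by (auto simp: Mid_def wtof_def)
    then show ?thesis using * unfolding Dg1_def by blast
  qed
qed

lemma Dz_image: "Dz i = (\<lambda>(j,k). wplus (eps j) (eps k)) ` (SIGMA j:{..<i}. {j..<i})"
proof (intro equalityI subsetI)
  fix x assume "x \<in> Dz i"
  then obtain j k where "x = wplus (eps j) (eps k)" "j \<le> k" "k < i"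
    unfolding Dz_def using order.strict_implies_order by blast
  then show "x \<in> (\<lambda>(j,k). wplus (eps j) (eps k)) ` (SIGMA j:{..<i}. {j..<i})" by force
next
  fix x assume "x \<in> (\<lambda>(j,k). wplus (eps j) (eps k)) ` (SIGMA j:{..<i}. {j..<i})"
  then obtain j k where "x = wplus (eps j) (eps k)" "j \<le> k" "k < i" by auto
  then show "x \<in> Dz i" unfolding Dz_def using order.order_iff_strict by blast
qed

lemma eps_xi: "j < n \<Longrightarrow> k < n \<Longrightarrow> l < n \<Longrightarrow> wplus (eps j) (eps k) l = xi n j l - xi n (n + k) l"
  by (auto simp: wplus_def eps_def xi_def cj_def)

lemma sum_Dz:
  "(\<Sum>\<gamma>\<in>Dz i. F \<gamma>) = (\<Sum>j<i. \<Sum>k\<in>{j..<i}. F (wplus (eps j) (eps k)))"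
proof -
  have "inj_on (\<lambda>(j,k). wplus (eps j) (eps k)) (SIGMA j:{..<i}. {j..<i})"
  proof (rule inj_onI; clarify)
    fix j k j' k' assume *: "j < i" "k \<in> {j..<i}" "j' < i" "k' \<in> {j'..<i}"
      "wplus (eps j) (eps k) = wplus (eps j') (eps k')"
    \<comment> \<open>The weights involve only the first i coordinates, so uniqueness is applied
      inside sp(i), with i in the place of n.\<close>
    have "xi i j l - xi i (i + k) l = xi i j' l - xi i (i + k') l" if "l < i" for l
      using eps_xi[of j i k l] eps_xi[of j' i k' l] * that by auto
    then have "(j = j' \<and> i + k = i + k') \<or> (j = cj i (i + k') \<and> i + k = cj i j')"
      using * by (intro xi_diff_unique) auto
    then show "j = j' \<and> k = k'" using * by (auto simp: cj_def)
  qed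
  then show ?thesis unfolding Dz_image
    by (simp add: sum.reindex sum.Sigma case_prod_unfold)
qed

text \<open>The element omega in coordinates, its second factor read at the entry (d, c). As a
  canonical element it does not depend on the chosen root vectors, so the scalars of
  \<open>rv\<close> cancel.\<close>

lemma sum_rvd_rv_Dz:
  assumes i: "i \<le> n"
  shows "(\<Sum>\<gamma>\<in>Dz i. rvd n \<gamma> x y * rv n \<gamma> d c)
    = (if d < i \<and> n \<le> c \<and> c < n + i then sb n c d x y / (4 * of_nat n + 4) else 0)"
proof -
  let ?N = "4 * of_nat n + 4 :: complex"
  define G where "G j k = sb n (n + k) j x y * (dl d j * dl c (n + k) + dl d k * dl c (n + j))" for j k
  have sbsym: "sb n (n + j) k = sb n (n + k) j" if "j < n" "k < n" for j k
    using sb_cj[of "n + k" n j] that by (simp add: cj_def sg_def msc_def add.commute)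
  have Gsym: "G j k = G k j" if "j < n" "k < n" for j k
    using sbsym[OF that] by (simp add: G_def add.commute)
  have tm: "rvd n \<gamma> x y * rv n \<gamma> d c = G j k / ((1 + dl j k) * ?N)"
    if jk: "j < i" "k < i" and g: "\<gamma> = wplus (eps j) (eps k)" for j k \<gamma>
  proof -
    have lt: "j < 2*n" "n + k < 2*n" "j \<noteq> n + k" using jk i by auto
    have al: "\<gamma> l = xi n j l - xi n (n + k) l" if "l < n" for l
      unfolding g using jk i that by (intro eps_xi) auto
    obtain t where t: "t \<noteq> 0" "rv n \<gamma> = msc t (sb n j (n + k))"
      using rv_line[OF lt al] by blast
    have d: "dl (n + k) (cj n j) = dl j k" using jk i by (auto simp: dl_def cj_def)
    have s: "sb n j (n + k) d c = dl d j * dl c (n + k) + dl d k * dl c (n + j)"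
      using jk i by (simp add: sb_dl cj_def sg_def add.commute)
    have r: "rvd n \<gamma> = msc (1 / (t * ?N * (1 + dl (n + k) (cj n j)))) (sb n (n + k) j)"
      by (rule rvd_line[OF lt _ t]) (rule al)
    show ?thesis using t(1) unfolding r t(2) unfolding msc_def d s G_def by simp
  qed
  have "(\<Sum>\<gamma>\<in>Dz i. rvd n \<gamma> x y * rv n \<gamma> d c) = (\<Sum>j<i. \<Sum>k\<in>{j..<i}. G j k / ((1 + dl j k) * ?N))"
    unfolding sum_Dz by (intro sum.cong refl) (auto simp: tm)
  \<comment> \<open>The weight \<open>1 + dl j k\<close> in the denominator, 2 for long roots and 1
    for short ones, is exactly what makes the sum over j <= k half of the sum over all
    pairs.\<close>
  also have "\<dots> = (\<Sum>j<i. \<Sum>k\<in>{j..<i}. (if j = k then G j j else G j k + G k j)) / (2 * ?N)"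
  proof -
    have "G j k / ((1 + dl j k) * ?N) = (if j = k then G j j else G j k + G k j) / (2 * ?N)"
      if "j < i" "k < i" for j k
    proof (cases "j = k")
      case False
      have half: "x / ((1 + 0) * N) = 2 * x / (2 * N)" for x N :: complex by simp
      have "G j k + G k j = 2 * G j k" using that i Gsym[of j k] by simp
      moreover have "dl j k = 0" using False by (simp add: dl_def)
      ultimately show ?thesis using False half by (simp only: if_False)
    qed simp
    then show ?thesis unfolding sum_divide_distrib by (intro sum.cong refl) auto
  qed
  also have "\<dots> = (\<Sum>j<i. \<Sum>k<i. G j k) / (2 * ?N)"
    unfolding sum_square_triangle ..
  also have "(\<Sum>j<i. \<Sum>k<i. G j k) = 2 * (\<Sum>j<i. \<Sum>k<i. dl d j * (dl c (n + k) * sb n (n + k) j x y))"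
  proof -
    have "(\<Sum>j<i. \<Sum>k<i. sb n (n + k) j x y * (dl d k * dl c (n + j)))
        = (\<Sum>k<i. \<Sum>j<i. sb n (n + k) j x y * (dl d k * dl c (n + j)))"
      by (rule sum.swap)
    also have "\<dots> = (\<Sum>k<i. \<Sum>j<i. sb n (n + j) k x y * (dl d k * dl c (n + j)))"
      using i by (intro sum.cong refl) (simp add: sbsym)
    finally show ?thesis
      by (simp add: G_def distrib_left sum.distrib mult_ac)
  qed
  also have "(\<Sum>j<i. \<Sum>k<i. dl d j * (dl c (n + k) * sb n (n + k) j x y))
     = (if d < i \<and> n \<le> c \<and> c < n + i then sb n c d x y else 0)"
  proof -
    have "(\<Sum>k<i. dl c (n + k) * sb n (n + k) j x y) = (if n \<le> c \<and> c < n + i then sb n c j x y else 0)" for j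
    proof (cases "n \<le> c")
      case True
      then have e: "dl c (n + k) = dl (c - n) k" for k
        by (auto simp: dl_def)
      have "c - n < i \<longleftrightarrow> c < n + i" using True by linarith
      then show ?thesis using True unfolding e by (simp add: sum_dl)
    next
      case False
      then have "dl c (n + k) = 0" for k by (auto simp: dl_def)
      then show ?thesis using False by simp
    qed
    then show ?thesis by (simp add: sum_distrib_left[symmetric] sum_dl)
  qed
  finally have "(\<Sum>\<gamma>\<in>Dz i. rvd n \<gamma> x y * rv n \<gamma> d c)
    = 2 * (if d < i \<and> n \<le> c \<and> c < n + i then sb n c d x y else 0) / (2 * ?N)" .
  moreover have "2 * z / (2 * N) = z / N" for z N :: complex by simp
  moreover have "(if P then z else 0) / N = (if P then z / N else 0)" for P and z N :: complex by simp
  ultimately show ?thesis by (simp only:)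
qed

subsection \<open>Tensors and the pairing\<close>

lemma br_sum:
  "br n (\<lambda>x y. \<Sum>s\<in>S. c s * A s x y) M a b = (\<Sum>s\<in>S. c s * br n (A s) M a b)"
  "br n M (\<lambda>x y. \<Sum>s\<in>S. c s * A s x y) a b = (\<Sum>s\<in>S. c s * br n M (A s) a b)"
proof -
  have "(\<Sum>e<2*n. (\<Sum>s\<in>S. c s * A s a e) * M e b) = (\<Sum>s\<in>S. c s * mmul n (A s) M a b)" for a b
    unfolding mmul_def sum_distrib_left sum_distrib_right
    by (subst sum.swap) (simp add: mult.assoc)
  moreover have "(\<Sum>e<2*n. M a e * (\<Sum>s\<in>S. c s * A s e b)) = (\<Sum>s\<in>S. c s * mmul n M (A s) a b)" for a b
    unfolding mmul_def sum_distrib_left sum_distrib_right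
    by (subst sum.swap) (simp add: mult_ac)
  ultimately show "br n (\<lambda>x y. \<Sum>s\<in>S. c s * A s x y) M a b = (\<Sum>s\<in>S. c s * br n (A s) M a b)"
    "br n M (\<lambda>x y. \<Sum>s\<in>S. c s * A s x y) a b = (\<Sum>s\<in>S. c s * br n M (A s) a b)"
    by (simp_all add: br_def mmul_def[of _ "\<lambda>x y. \<Sum>s\<in>S. c s * A s x y"]
        mmul_def[of _ _ "\<lambda>x y. \<Sum>s\<in>S. c s * A s x y"] sum_subtractf right_diff_distrib)
qed

lemma sp_trace_sum:
  "sp_trace n (\<lambda>E x y. \<Sum>s\<in>S. c s * T s E x y) = (\<Sum>s\<in>S. c s * sp_trace n (T s))"
proof -
  have sw: "(\<Sum>j\<in>J. \<Sum>k\<in>K j. \<Sum>s\<in>S. c s * F j k s) = (\<Sum>s\<in>S. c s * (\<Sum>j\<in>J. \<Sum>k\<in>K j. F j k s))"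
    for J :: "nat set" and K :: "nat \<Rightarrow> nat set" and F
  proof -
    have "(\<Sum>j\<in>J. \<Sum>k\<in>K j. \<Sum>s\<in>S. c s * F j k s) = (\<Sum>j\<in>J. \<Sum>s\<in>S. c s * (\<Sum>k\<in>K j. F j k s))"
      unfolding sum_distrib_left by (intro sum.cong refl) (rule sum.swap)
    also have "\<dots> = (\<Sum>s\<in>S. c s * (\<Sum>j\<in>J. \<Sum>k\<in>K j. F j k s))"
      unfolding sum_distrib_left[of "c _" _ J] by (rule sum.swap)
    finally show ?thesis .
  qed
  show ?thesis unfolding sp_trace_def sw by (simp add: distrib_left sum.distrib)
qed

lemma kil_sum:
  "kil n (\<lambda>x y. \<Sum>s\<in>S. c s * A s x y) B = (\<Sum>s\<in>S. c s * kil n (A s) B)"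
  "kil n B (\<lambda>x y. \<Sum>s\<in>S. c s * A s x y) = (\<Sum>s\<in>S. c s * kil n B (A s))"
proof -
  have 1: "br n (\<lambda>x y. \<Sum>s\<in>S. c s * A s x y) M = (\<lambda>x y. \<Sum>s\<in>S. c s * br n (A s) M x y)"
    "br n M (\<lambda>x y. \<Sum>s\<in>S. c s * A s x y) = (\<lambda>x y. \<Sum>s\<in>S. c s * br n M (A s) x y)" for M A
    by (intro ext br_sum)+
  show "kil n (\<lambda>x y. \<Sum>s\<in>S. c s * A s x y) B = (\<Sum>s\<in>S. c s * kil n (A s) B)"
    "kil n B (\<lambda>x y. \<Sum>s\<in>S. c s * A s x y) = (\<Sum>s\<in>S. c s * kil n B (A s))"
    unfolding kil_def 1 by (rule sp_trace_sum)+
qed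

text \<open>\<open>tpair\<close> evaluates \<open>kil\<close> on elementary matrices, which need not
  lie in sp(n), so \<open>kil_sp\<close> does not apply to the single terms. By bilinearity the
  whole sum is \<open>kil n U P\<close>, and there it does.\<close>

lemma kil_entries:
  assumes "U \<in> sp n" "P \<in> sp n"
  shows "(\<Sum>a<2*n. \<Sum>b<2*n. \<Sum>a'<2*n. \<Sum>b'<2*n. kil n (eunit a b) (eunit a' b') * U a b * P a' b')
    = (2 * of_nat n + 2) * trp n U P"
proof -
  let ?S = "{..<2*n} \<times> {..<2*n}"
  have ex: "X = (\<lambda>x y. \<Sum>s\<in>?S. X (fst s) (snd s) * eunit (fst s) (snd s) x y)" if "X \<in> sp n" for X
  proof (intro ext)
    fix x y
    have "(\<Sum>s\<in>?S. X (fst s) (snd s) * eunit (fst s) (snd s) x y)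
      = (\<Sum>a<2*n. \<Sum>b<2*n. dl x a * (dl y b * X a b))"
      unfolding sum.cartesian_product by (intro sum.cong) (auto simp: eunit_dl)
    also have "\<dots> = (if x < 2*n then if y < 2*n then X x y else 0 else 0)"
      by (simp add: sum_dl sum_distrib_left[symmetric])
    finally show "X x y = (\<Sum>s\<in>?S. X (fst s) (snd s) * eunit (fst s) (snd s) x y)"
      using sp_outside[OF that, of x y] by auto
  qed
  have "kil n U P = (\<Sum>s\<in>?S. U (fst s) (snd s) * (\<Sum>t\<in>?S. P (fst t) (snd t)
      * kil n (eunit (fst s) (snd s)) (eunit (fst t) (snd t))))"
    by (subst ex[OF assms(1)], subst ex[OF assms(2)]) (simp only: kil_sum)
  also have "\<dots> = (\<Sum>a<2*n. \<Sum>b<2*n. \<Sum>a'<2*n. \<Sum>b'<2*n. kil n (eunit a b) (eunit a' b') * U a b * P a' b')"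
    unfolding sum_distrib_left
    by (simp add: sum.cartesian_product[symmetric] case_prod_unfold[symmetric] sum.cartesian_product' mult_ac)
  finally show ?thesis using kil_sp[OF assms] by simp
qed

text \<open>The pairing built from the trace form in each factor. On tensors over sp(n) it is
  \<open>tpair\<close> up to the constant (2n+2)^2, and it is much easier to compute.\<close>

definition tc :: "nat \<Rightarrow> tensor \<Rightarrow> tensor \<Rightarrow> complex" where
  "tc n S T = (\<Sum>a<2*n. \<Sum>b<2*n. \<Sum>c<2*n. \<Sum>d<2*n. S a b c d * T b a d c)"

lemma tens_Nil: "tens [] = tzero"
  by (simp add: tens_def tzero_def)

lemma tens_Cons: "tens ((P,Q) # L) = tadd (tens [(P,Q)]) (tens L)"
  by (simp add: tens_def tadd_def)

lemma tpair_tadd: "tpair n (tadd S S') T = tpair n S T + tpair n S' T"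
  "tpair n S (tadd T T') = tpair n S T + tpair n S T'"
  by (simp_all add: tpair_def tadd_def sum.distrib algebra_simps)

lemma tc_tadd: "tc n (tadd S S') T = tc n S T + tc n S' T"
  "tc n S (tadd T T') = tc n S T + tc n S T'"
  by (simp_all add: tc_def tadd_def sum.distrib algebra_simps)

lemma tc_tsc: "tc n (tsc c S) T = c * tc n S T" "tc n S (tsc c T) = c * tc n S T"
  by (simp_all add: tc_def tsc_def sum_distrib_left mult_ac)

lemma tc_tzero: "tc n tzero T = 0" "tc n S tzero = 0"
  by (simp_all add: tc_def tzero_def)

lemma tpair_tzero: "tpair n tzero T = 0" "tpair n S tzero = 0"
  by (simp_all add: tpair_def tzero_def)

lemma tpair_pure:
  assumes "U \<in> sp n" "V \<in> sp n" "P \<in> sp n" "Q \<in> sp n"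
  shows "tpair n (tens [(U,V)]) (tens [(P,Q)]) = (2 * of_nat n + 2)\<^sup>2 * tc n (tens [(U,V)]) (tens [(P,Q)])"
proof -
  have "tpair n (tens [(U,V)]) (tens [(P,Q)]) =
    (\<Sum>a<2*n. \<Sum>b<2*n. \<Sum>c<2*n. \<Sum>d<2*n. \<Sum>a'<2*n. \<Sum>b'<2*n. \<Sum>c'<2*n. \<Sum>d'<2*n.
       (kil n (eunit a b) (eunit a' b') * U a b * P a' b') * (kil n (eunit c d) (eunit c' d') * V c d * Q c' d'))"
    unfolding tpair_def tens_def by (intro sum.cong refl) simp
  also have "\<dots> = (\<Sum>a<2*n. \<Sum>b<2*n. \<Sum>a'<2*n. \<Sum>b'<2*n. kil n (eunit a b) (eunit a' b') * U a b * P a' b')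
     * (\<Sum>c<2*n. \<Sum>d<2*n. \<Sum>c'<2*n. \<Sum>d'<2*n. kil n (eunit c d) (eunit c' d') * V c d * Q c' d')"
    by (simp only: sum_distrib_left[symmetric] sum_distrib_right[symmetric])
  also have "\<dots> = (2 * of_nat n + 2)\<^sup>2 * (trp n U P * trp n V Q)"
    unfolding kil_entries[OF assms(1,3)] kil_entries[OF assms(2,4)] by (simp add: power2_eq_square)
  also have "trp n U P * trp n V Q = tc n (tens [(U,V)]) (tens [(P,Q)])"
  proof -
    have "tc n (tens [(U,V)]) (tens [(P,Q)])
       = (\<Sum>a<2*n. \<Sum>b<2*n. \<Sum>c<2*n. \<Sum>d<2*n. (U a b * P b a) * (V c d * Q d c))"
      unfolding tc_def tens_def by (intro sum.cong refl) simp
    then show ?thesis unfolding trp_def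
      by (simp only: sum_distrib_left[symmetric] sum_distrib_right[symmetric])
  qed
  finally show ?thesis .
qed

lemma tpair_tspan:
  assumes "S \<in> tspan (sp n) (sp n)" "T \<in> tspan (sp n) (sp n)"
  shows "tpair n S T = (2 * of_nat n + 2)\<^sup>2 * tc n S T"
proof -
  have 1: "tpair n (tens [(U,V)]) (tens L) = (2 * of_nat n + 2)\<^sup>2 * tc n (tens [(U,V)]) (tens L)"
    if "U \<in> sp n" "V \<in> sp n" "\<forall>(P,Q)\<in>set L. P \<in> sp n \<and> Q \<in> sp n" for U V L
    using that(3)
  proof (induction L)
    case (Cons PQ L)
    obtain P Q where "PQ = (P,Q)" by fastforce
    with Cons that show ?case
      by (simp add: tens_Cons[of P Q L] tpair_tadd tc_tadd tpair_pure distrib_left)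
  qed (simp add: tens_Nil tpair_tzero tc_tzero)
  have 2: "tpair n (tens M) (tens L) = (2 * of_nat n + 2)\<^sup>2 * tc n (tens M) (tens L)"
    if "\<forall>(P,Q)\<in>set M. P \<in> sp n \<and> Q \<in> sp n" "\<forall>(P,Q)\<in>set L. P \<in> sp n \<and> Q \<in> sp n" for M L
    using that(1)
  proof (induction M)
    case (Cons PQ M)
    obtain P Q where "PQ = (P,Q)" by fastforce
    with Cons that show ?case
      by (simp add: tens_Cons[of P Q M] tpair_tadd tc_tadd 1 distrib_left)
  qed (simp add: tens_Nil tpair_tzero tc_tzero)
  show ?thesis using assms 2 unfolding tspan_def by blast
qed

lemma tspan_mono: "A \<subseteq> A' \<Longrightarrow> B \<subseteq> B' \<Longrightarrow> tspan A B \<subseteq> tspan A' B'"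
  unfolding tspan_def by blast

lemma mzero_grd: "mzero \<in> grd n i k"
  using mzero_in_sp by (auto simp: grd_def mzero_def br_def mmul_def msc_def)

text \<open>Fixing the indices of one factor leaves a linear combination of matrices from the other.
  All later use of membership in a tensor product goes through these slices.\<close>

lemma tens_slice:
  assumes "\<forall>(P,Q)\<in>set L. P \<in> grd n i k \<and> Q \<in> grd n i l"
  shows "(\<lambda>a b. tens L a b c d) \<in> grd n i k" "(\<lambda>c d. tens L a b c d) \<in> grd n i l"
proof -
  show "(\<lambda>a b. tens L a b c d) \<in> grd n i k" using assms
  proof (induction L)
    case Nil
    then show ?case using mzero_grd by (simp add: tens_def mzero_def)
  next
    case (Cons PQ L)
    obtain P Q where PQ: "PQ = (P,Q)" by fastforce
    have "(\<lambda>a b. tens (PQ # L) a b c d) = madd (msc (Q c d) P) (\<lambda>a b. tens L a b c d)"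
      by (simp add: PQ tens_def madd_def msc_def mult.commute)
    then show ?case using Cons PQ by (auto intro: madd_grd msc_grd)
  qed
  show "(\<lambda>c d. tens L a b c d) \<in> grd n i l" using assms
  proof (induction L)
    case Nil
    then show ?case using mzero_grd by (simp add: tens_def mzero_def)
  next
    case (Cons PQ L)
    obtain P Q where PQ: "PQ = (P,Q)" by fastforce
    have "(\<lambda>c d. tens (PQ # L) a b c d) = madd (msc (P a b) Q) (\<lambda>c d. tens L a b c d)"
      by (simp add: PQ tens_def madd_def msc_def)
    then show ?case using Cons PQ by (auto intro: madd_grd msc_grd)
  qed
qed

lemma tspan_slice:
  assumes "Y \<in> tspan (grd n i k) (grd n i l)"
  shows "(\<lambda>a b. Y a b c d) \<in> grd n i k" "(\<lambda>c d. Y a b c d) \<in> grd n i l"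
  using assms tens_slice unfolding tspan_def by blast+

lemma trp_commute: "trp n A B = trp n B A"
  unfolding trp_def by (subst sum.swap) (simp add: mult.commute)

lemma trp_mmul: "trp n (mmul n A B) C = trp n A (mmul n B C)"
proof -
  have "trp n (mmul n A B) C = (\<Sum>a<2*n. \<Sum>b<2*n. \<Sum>e<2*n. A a e * B e b * C b a)"
    by (simp add: trp_def mmul_def sum_distrib_right)
  also have "\<dots> = (\<Sum>a<2*n. \<Sum>e<2*n. \<Sum>b<2*n. A a e * B e b * C b a)"
    by (rule sum.cong[OF refl]) (rule sum.swap)
  also have "\<dots> = trp n A (mmul n B C)"
    by (simp add: trp_def mmul_def sum_distrib_left mult.assoc)
  finally show ?thesis .
qed

lemma trp_diff: "trp n (\<lambda>a b. A a b - B a b) C = trp n A C - trp n B C"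
  by (simp add: trp_def sum_subtractf left_diff_distrib)

lemma trp_br: "trp n (br n Z P) R = - trp n P (br n Z R)"
proof -
  have "trp n (mmul n Z P) R = trp n P (mmul n R Z)"
    by (metis trp_commute trp_mmul)
  moreover have "trp n (mmul n P Z) R = trp n P (mmul n Z R)" by (rule trp_mmul)
  moreover have "trp n P (br n Z R) = trp n (mmul n Z R) P - trp n (mmul n R Z) P"
    unfolding br_def by (subst trp_commute) (rule trp_diff)
  ultimately show ?thesis unfolding br_def trp_diff by (simp add: trp_commute[of n P])
qed

lemma lact_br: "lact n Z T a b c d = br n Z (\<lambda>x y. T x y c d) a b + br n Z (\<lambda>x y. T a b x y) c d"
  by (simp add: lact_def br_def mmul_def sum_subtractf)

lemma tc_trp1: "tc n S T = (\<Sum>c<2*n. \<Sum>d<2*n. trp n (\<lambda>a b. S a b c d) (\<lambda>a b. T a b d c))"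
proof -
  have "tc n S T = (\<Sum>a<2*n. \<Sum>c<2*n. \<Sum>b<2*n. \<Sum>d<2*n. S a b c d * T b a d c)"
    unfolding tc_def by (rule sum.cong[OF refl]) (rule sum.swap)
  also have "\<dots> = (\<Sum>c<2*n. \<Sum>a<2*n. \<Sum>b<2*n. \<Sum>d<2*n. S a b c d * T b a d c)"
    by (rule sum.swap)
  also have "\<dots> = (\<Sum>c<2*n. \<Sum>a<2*n. \<Sum>d<2*n. \<Sum>b<2*n. S a b c d * T b a d c)"
    by (rule sum.cong[OF refl], rule sum.cong[OF refl]) (rule sum.swap)
  also have "\<dots> = (\<Sum>c<2*n. \<Sum>d<2*n. \<Sum>a<2*n. \<Sum>b<2*n. S a b c d * T b a d c)"
    by (rule sum.cong[OF refl]) (rule sum.swap)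
  finally show ?thesis by (simp add: trp_def)
qed

lemma tc_trp2: "tc n S T = (\<Sum>a<2*n. \<Sum>b<2*n. trp n (\<lambda>c d. S a b c d) (\<lambda>c d. T b a c d))"
  by (simp add: tc_def trp_def)

text \<open>Invariance of the trace form under the adjoint action, applied in one factor at a
  time.\<close>

lemma tc_lact: "tc n (lact n Z S) T = - tc n S (lact n Z T)"
proof -
  have l: "lact n Z T = tadd (\<lambda>a b c d. br n Z (\<lambda>x y. T x y c d) a b) (\<lambda>a b c d. br n Z (\<lambda>x y. T a b x y) c d)" for T
    by (intro ext) (simp add: lact_br tadd_def)
  have "tc n (\<lambda>a b c d. br n Z (\<lambda>x y. S x y c d) a b) T = - tc n S (\<lambda>a b c d. br n Z (\<lambda>x y. T x y c d) a b)"
    unfolding tc_trp1 by (simp add: trp_br sum_negf)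
  moreover have "tc n (\<lambda>a b c d. br n Z (\<lambda>x y. S a b x y) c d) T = - tc n S (\<lambda>a b c d. br n Z (\<lambda>x y. T a b x y) c d)"
    unfolding tc_trp2 by (simp add: trp_br sum_negf)
  ultimately show ?thesis unfolding l tc_tadd by simp
qed

section \<open>Block sums and the quadratic form of a tensor on g(1)\<close>

lemma sum_blocks:
  fixes f :: "nat \<Rightarrow> complex"
  assumes "i \<le> n"
  shows "(\<Sum>a<2*n. f a) = (\<Sum>a<i. f a) + (\<Sum>a<i. f (n + a)) + (\<Sum>a\<in>Mid n i. f a)"
proof -
  have "{..<2*n} = ({..<i} \<union> {n..<n+i}) \<union> Mid n i"
    using assms by (auto simp: Mid_def)
  moreover have "({..<i} \<union> {n..<n+i}) \<inter> Mid n i = {}" "{..<i} \<inter> {n..<n+i} = {}"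
    using assms by (auto simp: Mid_def)
  moreover have "sum f {n..<n+i} = (\<Sum>a<i. f (n + a))"
    using sum.shift_bounds_nat_ivl[of f 0 n i] by (simp add: lessThan_atLeast0 add.commute)
  ultimately show ?thesis
    by (simp add: sum.union_disjoint)
qed

lemma ht_first: "a < i \<Longrightarrow> ht n i a = 1"
  and ht_last: "i \<le> n \<Longrightarrow> a < i \<Longrightarrow> ht n i (n + a) = -1"
  and ht_Mid: "i \<le> n \<Longrightarrow> a \<in> Mid n i \<Longrightarrow> ht n i a = 0"
  by (auto simp: ht_def Mid_def)

text \<open>A degree 0 matrix is block diagonal with blocks A, a middle block, and the negative
  transpose of A. The outer blocks contribute equally, hence the 2; the middle block contributes
  nothing by hypothesis.\<close>

lemma trp_levi:
  assumes i: "i \<le> n" and P: "P \<in> grd n i 0" and R: "R \<in> grd n i 0"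
    and mid: "\<And>a b. a \<in> Mid n i \<Longrightarrow> b \<in> Mid n i \<Longrightarrow> P a b * R b a = 0"
  shows "trp n P R = 2 * (\<Sum>a<i. \<Sum>b<i. P a b * R b a)"
proof -
  have z: "P a b = 0" if "ht n i a \<noteq> ht n i b" for a b
    using grd_zero[OF i P] that by simp
  have s: "P (n + a) (n + b) * R (n + b) (n + a) = P b a * R a b" if "a < i" "b < i" for a b
  proof -
    have "P (n + a) (n + b) = - P b a" "R (n + b) (n + a) = - R a b"
      using sp_sym[OF grd_sp[OF P], of b a] sp_sym[OF grd_sp[OF R], of a b] that i
      by (simp_all add: cj_def sg_def add.commute)
    then show ?thesis by simp
  qed
  have 1: "(\<Sum>b<2*n. P a b * R b a) = (\<Sum>b<i. P a b * R b a)" if "a < i" for a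
    using that i by (simp add: sum_blocks[OF i] z ht_first ht_last ht_Mid)
  have 2: "(\<Sum>b<2*n. P (n + a) b * R b (n + a)) = (\<Sum>b<i. P b a * R a b)" if "a < i" for a
    using that i by (simp add: sum_blocks[OF i] z ht_first ht_last ht_Mid s)
  have 3: "(\<Sum>b<2*n. P a b * R b a) = 0" if "a \<in> Mid n i" for a
  proof -
    have "(\<Sum>b\<in>Mid n i. P a b * R b a) = 0" using mid that by (intro sum.neutral) auto
    then show ?thesis using that i by (simp add: sum_blocks[OF i] z ht_first ht_last ht_Mid)
  qed
  have "(\<Sum>a<i. \<Sum>b<i. P b a * R a b) = (\<Sum>a<i. \<Sum>b<i. P a b * R b a)"
    by (rule sum.swap)
  then show ?thesis
    unfolding trp_def sum_blocks[OF i, of "\<lambda>a. \<Sum>b<2*n. P a b * R b a"] by (simp add: 1 2 3)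
qed

text \<open>Contraction of the first tensor factor with one slot of the second. The upper right
  block of the square of an element of sp(n) is skew, so only the skew part of \<open>Phi\<close> is
  felt by the quadratic form; a multiple of that part is the matrix M of the overview.\<close>

definition Phi :: "nat \<Rightarrow> nat \<Rightarrow> tensor \<Rightarrow> nat \<Rightarrow> nat \<Rightarrow> complex" where
  "Phi n i Y j k = (\<Sum>d<i. Y d j (n + k) d)"

lemma slice_sym:
  assumes "i \<le> n" "Y \<in> tspan (grd n i 0) (grd n i l)" "k < i" "d < i"
  shows "Y a b (n + k) d = Y a b (n + d) k"
  using sp_sym[OF grd_sp[OF tspan_slice(2)[OF assms(2)]], of "n + d" k a b] assms
  by (simp add: cj_def sg_def add.commute)

text \<open>A column of index a < i already has top degree, so X of degree 1 vanishes there. In the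
  expansion of ad(X)^2 every term with X on the right drops out, and X X S remains.\<close>

lemma ad_square_entry:
  assumes i: "i \<le> n" and X: "X \<in> grd n i 1" and lt: "k < i" "d < i" "a < i" "b < i"
  shows "br n X (br n X (sb n (n + k) d)) b a
    = dl a d * mmul n X X b (n + k) + dl a k * mmul n X X b (n + d)"
proof -
  let ?S = "sb n (n + k) d"
  have X0: "X e a = 0" for e
    using grd_zero[OF i X, of e a] lt by (auto simp: ht_def split: if_splits)
  have "br n X (br n X ?S) b a = (\<Sum>e<2*n. X b e * br n X ?S e a)"
    by (simp add: br_def[of n X "br n X ?S"] mmul_def[of n "br n X ?S"] X0) (simp add: mmul_def)
  also have "\<dots> = (\<Sum>e<2*n. X b e * mmul n X ?S e a)"
    by (simp add: br_def) (simp add: mmul_def[of n ?S] X0)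
  also have "\<dots> = (\<Sum>e<2*n. dl a d * (X b e * X e (n + k)) + dl a k * (X b e * X e (n + d)))"
    using lt i by (simp add: mmul_sb_right cj_def sg_def algebra_simps)
  finally show ?thesis
    by (simp add: sum.distrib mmul_def sum_distrib_left)
qed

lemma tau2_tspan:
  assumes "X \<in> sp n" "i \<le> n"
  shows "tau2 n i X \<in> tspan (sp n) (sp n)"
proof -
  have sp: "rv n \<gamma> \<in> sp n \<and> rvd n \<gamma> \<in> sp n" if g: "\<gamma> \<in> Dz i" for \<gamma>
  proof -
    obtain j k where jk: "j < i" "k < i" "\<gamma> = wplus (eps j) (eps k)"
    proof -
      obtain p where "p \<in> (SIGMA j:{..<i}. {j..<i})" "\<gamma> = (\<lambda>(j,k). wplus (eps j) (eps k)) p"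
        using g unfolding Dz_image by blast
      then show thesis by (intro that[of "fst p" "snd p"]) (auto simp: case_prod_unfold)
    qed
    have lt: "j < 2*n" "n + k < 2*n" "j \<noteq> n + k" using jk assms by auto
    have al: "\<gamma> l = xi n j l - xi n (n + k) l" if "l < n" for l
      unfolding jk using jk assms that by (intro eps_xi) auto
    obtain t where t: "t \<noteq> 0" "rv n \<gamma> = msc t (sb n j (n + k))"
      using rv_line[OF lt al] by blast
    have r: "rvd n \<gamma> = msc (1 / (t * (4 * of_nat n + 4) * (1 + dl (n + k) (cj n j)))) (sb n (n + k) j)"
      by (rule rvd_line[OF lt _ t]) (rule al)
    show ?thesis unfolding r t(2) by (intro conjI msc_in_sp sb_in_sp lt)
  qed
  have "finite (Dz i)" unfolding Dz_image by auto
  then obtain l where l: "set l = Dz i" "distinct l" using finite_distinct_list by blast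
  let ?L = "map (\<lambda>\<gamma>. (msc (1/2) (br n X (br n X (rvd n \<gamma>))), rv n \<gamma>)) l"
  have "tau2 n i X = tens ?L"
    unfolding tau2_def tens_def using l
    by (intro ext) (simp add: sum_distrib_left msc_def o_def sum.distinct_set_conv_list[symmetric] mult.assoc)
  moreover have "\<forall>(P,Q)\<in>set ?L. P \<in> sp n \<and> Q \<in> sp n"
    using l sp msc_in_sp[OF br_in_sp[OF assms(1) br_in_sp[OF assms(1)]]] by auto
  ultimately show ?thesis unfolding tspan_def by blast
qed

text \<open>By linearity ad(X)^2 is moved outside the sum over roots, which leaves the coordinates
  of omega. The 8n+8 is 4n+4 times the 2 from the factor 1/2 in \<open>tau2\<close>.\<close>

lemma tau2_entry:
  assumes "i \<le> n"
  shows "tau2 n i X b a d c = (if d < i \<and> n \<le> c \<and> c < n + i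
     then br n X (br n X (sb n c d)) b a / (8 * of_nat n + 8) else 0)"
proof -
  have "(\<Sum>\<gamma>\<in>Dz i. br n X (br n X (rvd n \<gamma>)) b a * rv n \<gamma> d c)
     = (\<Sum>\<gamma>\<in>Dz i. rv n \<gamma> d c * br n X (br n X (rvd n \<gamma>)) b a)"
    by (simp only: mult.commute)
  also have "\<dots> = br n X (\<lambda>x y. \<Sum>\<gamma>\<in>Dz i. rv n \<gamma> d c * br n X (rvd n \<gamma>) x y) b a"
    by (rule br_sum(2)[symmetric])
  also have "(\<lambda>x y. \<Sum>\<gamma>\<in>Dz i. rv n \<gamma> d c * br n X (rvd n \<gamma>) x y)
     = br n X (\<lambda>x y. \<Sum>\<gamma>\<in>Dz i. rv n \<gamma> d c * rvd n \<gamma> x y)"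
    by (intro ext br_sum(2)[symmetric])
  also have "(\<lambda>x y. \<Sum>\<gamma>\<in>Dz i. rv n \<gamma> d c * rvd n \<gamma> x y)
     = msc (if d < i \<and> n \<le> c \<and> c < n + i then 1 / (4 * of_nat n + 4) else 0) (sb n c d)"
  proof (intro ext)
    fix x y
    show "(\<Sum>\<gamma>\<in>Dz i. rv n \<gamma> d c * rvd n \<gamma> x y)
     = msc (if d < i \<and> n \<le> c \<and> c < n + i then 1 / (4 * of_nat n + 4) else 0) (sb n c d) x y"
      using sum_rvd_rv_Dz[OF assms, of x y d c] by (simp add: mult.commute msc_def)
  qed
  also have "br n X (br n X (msc z (sb n c d))) b a = z * br n X (br n X (sb n c d)) b a" for z
    by (simp add: br_msc) (simp add: msc_def)
  finally show ?thesis
    unfolding tau2_def by (cases "d < i \<and> n \<le> c \<and> c < n + i") (auto simp: field_simps)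
qed

text \<open>The two deltas of \<open>ad_square_entry\<close> contribute equally because the second
  factor of Y is symmetric. The hypothesis \<open>mid\<close> removes the sp(n-i) part of Y, which
  would otherwise add terms of another shape; \<open>Wd_Mid\<close> supplies it.\<close>

lemma ttau2_formula:
  assumes i: "i \<le> n" and Y: "Y \<in> tspan (grd n i 0) (grd n i (-2))"
    and mid: "\<And>a b c d. a \<in> Mid n i \<Longrightarrow> b \<in> Mid n i \<Longrightarrow> Y a b c d = 0"
    and X: "X \<in> grd n i 1"
  shows "ttau2 n i Y X = (2 * of_nat n + 2) * (\<Sum>j<i. \<Sum>k<i. Phi n i Y j k * mmul n X X j (n + k))"
proof -
  let ?N = "8 * of_nat n + 8 :: complex"
  let ?B = "\<lambda>k d. br n X (br n X (sb n (n + k) d))"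
  have Ysp: "Y \<in> tspan (sp n) (sp n)" using tspan_mono grd_sp Y by (metis subsetI subset_iff)
  have Bg: "?B k d \<in> grd n i 0" if "k < i" "d < i" for k d
  proof -
    have "sb n (n + k) d \<in> grd n i (-2)" using that i by (intro sb_grd) (auto simp: ht_def)
    then have "br n X (sb n (n + k) d) \<in> grd n i (-1)" using br_grd[OF i X] by fastforce
    then show ?thesis using br_grd[OF i X] by fastforce
  qed
  have t: "trp n (\<lambda>a b. Y a b (n + k) d) (\<lambda>a b. tau2 n i X a b d (n + k))
      = (2 / ?N) * (\<Sum>a<i. \<Sum>b<i. Y a b (n + k) d * ?B k d b a)" if "k < i" "d < i" for k d
  proof -
    have "trp n (\<lambda>a b. Y a b (n + k) d) (\<lambda>a b. tau2 n i X a b d (n + k))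
       = trp n (\<lambda>a b. Y a b (n + k) d) (?B k d) / ?N"
      using that by (simp add: tau2_entry[OF i] trp_def sum_divide_distrib)
    also have "trp n (\<lambda>a b. Y a b (n + k) d) (?B k d) = 2 * (\<Sum>a<i. \<Sum>b<i. Y a b (n + k) d * ?B k d b a)"
      using tspan_slice(1)[OF Y] Bg[OF that] mid by (intro trp_levi[OF i]) auto
    finally show ?thesis by simp
  qed
  have t0: "trp n (\<lambda>a b. Y a b c d) (\<lambda>a b. tau2 n i X a b d c) = 0"
    if "\<not> (d < i \<and> n \<le> c \<and> c < n + i)" for c d
  proof -
    have "tau2 n i X a b d c = 0" for a b
      unfolding tau2_entry[OF i] using that by (rule if_not_P)
    then show ?thesis by (simp add: trp_def)
  qed
  have "tc n Y (tau2 n i X) = (\<Sum>c<2*n. \<Sum>d<2*n. trp n (\<lambda>a b. Y a b c d) (\<lambda>a b. tau2 n i X a b d c))"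
    by (rule tc_trp1)
  also have "\<dots> = (\<Sum>k<i. \<Sum>d<i. trp n (\<lambda>a b. Y a b (n + k) d) (\<lambda>a b. tau2 n i X a b d (n + k)))"
  proof -
    have 1: "(\<Sum>d<2*n. trp n (\<lambda>a b. Y a b c d) (\<lambda>a b. tau2 n i X a b d c)) = 0"
      if "c < i \<or> c \<in> Mid n i" for c
      using that i by (intro sum.neutral ballI t0) (auto simp: Mid_def)
    have 2: "(\<Sum>d<2*n. trp n (\<lambda>a b. Y a b c d) (\<lambda>a b. tau2 n i X a b d c))
      = (\<Sum>d<i. trp n (\<lambda>a b. Y a b c d) (\<lambda>a b. tau2 n i X a b d c))" for c
      using i by (intro sum.mono_neutral_right) (auto intro: t0)
    show ?thesis unfolding sum_blocks[OF i, of "\<lambda>c. \<Sum>d<2*n. trp n (\<lambda>a b. Y a b c d) (\<lambda>a b. tau2 n i X a b d c)"]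
      by (simp add: 1) (simp add: 2)
  qed
  also have "\<dots> = (\<Sum>k<i. \<Sum>d<i. (2 / ?N) * (\<Sum>a<i. \<Sum>b<i. Y a b (n + k) d * ?B k d b a))"
    by (intro sum.cong refl) (simp add: t)
  also have "\<dots> = (2 / ?N) * (\<Sum>k<i. \<Sum>d<i. \<Sum>a<i. \<Sum>b<i. Y a b (n + k) d * ?B k d b a)"
    by (simp only: sum_distrib_left)
  also have "(\<Sum>k<i. \<Sum>d<i. \<Sum>a<i. \<Sum>b<i. Y a b (n + k) d * ?B k d b a)
     = 2 * (\<Sum>j<i. \<Sum>k<i. Phi n i Y j k * mmul n X X j (n + k))"
  proof -
    have A: "(\<Sum>k<i. \<Sum>d<i. \<Sum>b<i. Y d b (n + k) d * mmul n X X b (n + k))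
       = (\<Sum>j<i. \<Sum>k<i. Phi n i Y j k * mmul n X X j (n + k))"
    proof -
      have "(\<Sum>k<i. \<Sum>d<i. \<Sum>b<i. Y d b (n + k) d * mmul n X X b (n + k))
         = (\<Sum>k<i. \<Sum>b<i. \<Sum>d<i. Y d b (n + k) d * mmul n X X b (n + k))"
        by (rule sum.cong[OF refl]) (rule sum.swap)
      also have "\<dots> = (\<Sum>b<i. \<Sum>k<i. \<Sum>d<i. Y d b (n + k) d * mmul n X X b (n + k))"
        by (rule sum.swap)
      finally show ?thesis by (simp add: Phi_def sum_distrib_right)
    qed
    have in1: "(\<Sum>a<i. \<Sum>b<i. Y a b (n + k) d * ?B k d b a)
       = (\<Sum>b<i. Y d b (n + k) d * mmul n X X b (n + k)) + (\<Sum>b<i. Y k b (n + k) d * mmul n X X b (n + d))"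
      if "k < i" "d < i" for k d
    proof -
      have "(\<Sum>a<i. \<Sum>b<i. Y a b (n + k) d * ?B k d b a)
         = (\<Sum>a<i. dl a d * (\<Sum>b<i. Y a b (n + k) d * mmul n X X b (n + k))
             + dl a k * (\<Sum>b<i. Y a b (n + k) d * mmul n X X b (n + d)))"
      proof -
        have "Y a b (n + k) d * ?B k d b a = dl a d * (Y a b (n + k) d * mmul n X X b (n + k))
            + dl a k * (Y a b (n + k) d * mmul n X X b (n + d))" if "a < i" "b < i" for a b
          unfolding ad_square_entry[OF i X \<open>k < i\<close> \<open>d < i\<close> that] by (simp add: algebra_simps)
        then show ?thesis unfolding sum_distrib_left sum.distrib[symmetric] by (intro sum.cong refl) auto
      qed
      then show ?thesis using that by (simp add: sum.distrib sum_dl)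
    qed
    \<comment> \<open>Symmetry of the second factor exchanges k and d there; renaming the summation
      indices then gives the first sum again.\<close>
    have "(\<Sum>k<i. \<Sum>d<i. \<Sum>b<i. Y k b (n + k) d * mmul n X X b (n + d))
       = (\<Sum>k<i. \<Sum>d<i. \<Sum>b<i. Y k b (n + d) k * mmul n X X b (n + d))"
      using slice_sym[OF i Y] by (intro sum.cong refl) auto
    also have "\<dots> = (\<Sum>k<i. \<Sum>d<i. \<Sum>b<i. Y d b (n + k) d * mmul n X X b (n + k))"
      by (rule sum.swap)
    finally have B: "(\<Sum>k<i. \<Sum>d<i. \<Sum>b<i. Y k b (n + k) d * mmul n X X b (n + d))
       = (\<Sum>j<i. \<Sum>k<i. Phi n i Y j k * mmul n X X j (n + k))" using A by simp
    have "(\<Sum>k<i. \<Sum>d<i. \<Sum>a<i. \<Sum>b<i. Y a b (n + k) d * ?B k d b a)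
       = (\<Sum>k<i. \<Sum>d<i. (\<Sum>b<i. Y d b (n + k) d * mmul n X X b (n + k))
            + (\<Sum>b<i. Y k b (n + k) d * mmul n X X b (n + d)))"
      by (intro sum.cong refl) (simp add: in1)
    then show ?thesis by (simp add: sum.distrib A B)
  qed
  finally have tcf: "tc n Y (tau2 n i X) = (2 / ?N) * (2 * (\<Sum>j<i. \<Sum>k<i. Phi n i Y j k * mmul n X X j (n + k)))" .
  have N: "?N = 4 * (2 * of_nat n + 2)" by simp
  have nz: "(2 * of_nat n + 2 :: complex) \<noteq> 0"
    by (metis of_nat_Suc of_nat_0_neq mult_eq_0_iff distrib_left mult.right_neutral add.commute zero_neq_numeral)
  have "ttau2 n i Y X = (2 * of_nat n + 2)\<^sup>2 * tc n Y (tau2 n i X)"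
    unfolding ttau2_def using Ysp tau2_tspan[OF grd_sp[OF X] i] by (rule tpair_tspan)
  \<comment> \<open>The square (2n+2)^2 from \<open>tpair_tspan\<close> meets 4/(8n+8), which is the
    inverse of 2n+2.\<close>
  also have "\<dots> = (2 * of_nat n + 2) * (\<Sum>j<i. \<Sum>k<i. Phi n i Y j k * mmul n X X j (n + k))"
  proof -
    have "z\<^sup>2 * (2 / (4 * z) * (2 * S)) = z * S" if "z \<noteq> 0" for z S :: complex
      using that by (simp add: power2_eq_square)
    from this[OF nz] show ?thesis unfolding tcf N .
  qed
  finally show ?thesis .
qed

subsection \<open>The modules W and W*\<close>

lemma lgam_levi:
  assumes "i \<le> n"
  shows "lgam n i \<subseteq> grd n i 0"
proof
  fix X assume X: "X \<in> lgam n i"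
  have "ht n i a - ht n i b = 0" if "X a b \<noteq> 0" for a b
  proof -
    have "(a < i \<and> b < i) \<or> (n \<le> a \<and> a < n + i \<and> n \<le> b \<and> b < n + i)"
      using X that unfolding lgam_def by blast
    then show ?thesis using assms by (auto simp: ht_def)
  qed
  then show "X \<in> grd n i 0" using X unfolding grd_iff[OF assms] lgam_def by blast
qed

lemma lgam_Mid: 
  assumes "i \<le> n" "X \<in> lgam n i" "a \<in> Mid n i \<or> b \<in> Mid n i"
  shows "X a b = 0"
  using assms unfolding lgam_def Mid_def by force

lemma tens_lgam_Mid:
  assumes "i \<le> n" "w \<in> tspan (lgam n i) B" "a \<in> Mid n i \<or> b \<in> Mid n i"
  shows "w a b c d = 0"
proof -
  obtain L where L: "w = tens L" "\<forall>(P,Q)\<in>set L. P \<in> lgam n i"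
    using assms(2) unfolding tspan_def by blast
  have z: "P a b = 0" if "P \<in> lgam n i" for P
    using lgam_Mid[OF assms(1) that assms(3)] .
  show ?thesis unfolding L(1) using L(2) by (induction L) (auto simp: tens_def z)
qed

context
  fixes n i :: nat and W Wd :: "tensor set"
  assumes i: "i \<le> n" "2 \<le> i" and W: "is_Vmu n i W" and Wd: "is_dual n i W Wd"
begin

lemma W_tspan: "w \<in> W \<Longrightarrow> w \<in> tspan (lgam n i) (grd n i 2)"
  using W by (auto simp: is_Vmu_def)

lemma W_tspan': "w \<in> W \<Longrightarrow> w \<in> tspan (grd n i 0) (grd n i 2)"
  using W_tspan tspan_mono[OF lgam_levi[OF i(1)] order_refl] by blast

lemma Wd_tspan: "y \<in> Wd \<Longrightarrow> y \<in> tspan (grd n i 0) (grd n i (-2))"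
  using Wd by (auto simp: is_dual_def levi_def)

lemma tpair_W:
  assumes "y \<in> Wd" "w \<in> W"
  shows "tpair n y w = (2 * of_nat n + 2)\<^sup>2 * tc n y w"
proof (rule tpair_tspan)
  have "tspan (grd n i k) (grd n i l) \<subseteq> tspan (sp n) (sp n)" for k l
    by (rule tspan_mono) (auto simp: grd_sp)
  then show "y \<in> tspan (sp n) (sp n)" "w \<in> tspan (sp n) (sp n)"
    using assms Wd_tspan W_tspan' by blast+
qed

lemma tc_W_nonzero: "\<exists>w\<in>W. \<exists>y\<in>Wd. tc n y w \<noteq> 0"
  using Wd tpair_W unfolding is_dual_def by (metis mult_zero_right)

text \<open>The radical of the pairing is an l-stable subspace of an irreducible module, and it is
  proper because \<open>is_dual\<close> provides one nonzero value.\<close>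

lemma Wd_nondeg:
  assumes "y \<in> Wd" "\<And>w. w \<in> W \<Longrightarrow> tc n y w = 0"
  shows "y = tzero"
proof -
  let ?N = "{y \<in> Wd. \<forall>w\<in>W. tc n y w = 0}"
  have "tsubspace ?N" using Wd unfolding is_dual_def tsubspace_def
    by (auto simp: tc_tzero tc_tadd tc_tsc)
  moreover have "lstable n i ?N" using Wd W unfolding is_dual_def is_Vmu_def lstable_def
    by (auto simp: tc_lact)
  moreover have "?N \<noteq> Wd" using tc_W_nonzero by blast
  ultimately have "?N = {tzero}" using Wd unfolding is_dual_def lirred_def by blast
  then show ?thesis using assms by blast
qed

lemma W_nondeg:
  assumes "w \<in> W" "\<And>y. y \<in> Wd \<Longrightarrow> tc n y w = 0"
  shows "w = tzero"
proof -
  let ?N = "{w \<in> W. \<forall>y\<in>Wd. tc n y w = 0}"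
  have inv: "tc n y (lact n Z w) = - tc n (lact n Z y) w" for y w Z
    by (simp add: tc_lact)
  have "tsubspace ?N" using W unfolding is_Vmu_def tsubspace_def
    by (auto simp: tc_tzero tc_tadd tc_tsc)
  moreover have "lstable n i ?N" using Wd W unfolding is_dual_def is_Vmu_def lstable_def
    by (auto simp: inv)
  moreover have "?N \<noteq> W" using tc_W_nonzero by blast
  ultimately have "?N = {tzero}" using W unfolding is_Vmu_def lirred_def by blast
  then show ?thesis using assms by blast
qed

text \<open>Elements of W have no index in \<open>Mid n i\<close>: their first factor is in sl(i),
  their second in g(2). So sp(n-i) kills W. By invariance of \<open>tc\<close> the tensor
  \<open>lact n Z y\<close> is orthogonal to W, hence zero.\<close>

lemma Mid_kills_Wd:
  assumes Z: "Z \<in> grd n i 0" and supp: "\<And>a b. Z a b \<noteq> 0 \<Longrightarrow> a \<in> Mid n i \<and> b \<in> Mid n i" and y: "y \<in> Wd"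
  shows "lact n Z y = tzero"
proof (rule Wd_nondeg)
  show "lact n Z y \<in> Wd" using Wd Z y by (auto simp: is_dual_def lstable_def levi_def)
  fix w assume w: "w \<in> W"
  have "lact n Z w = tzero"
  proof (intro ext)
    fix a b c d
    have m: "w x y' c d = 0" if "x \<in> Mid n i \<or> y' \<in> Mid n i" for x y'
      using tens_lgam_Mid[OF i(1) W_tspan[OF w] that] .
    have m2: "w a b x y' = 0" if "x \<in> Mid n i \<or> y' \<in> Mid n i" for x y'
    proof -
      have "ht n i x = 0 \<or> ht n i y' = 0" using that ht_Mid[OF i(1)] by blast
      moreover have "ht n i x \<le> 1" "ht n i y' \<ge> -1" by (simp_all add: ht_def)
      ultimately have "ht n i x - ht n i y' \<noteq> 2" by linarith
      then show ?thesis using grd_zero[OF i(1) tspan_slice(2)[OF W_tspan'[OF w], of a b]] by auto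
    qed
    have "Z a e * w e b c d = 0" "w a e c d * Z e b = 0" "Z c e * w a b e d = 0" "w a b c e * Z e d = 0" for e
      using supp m m2 by (metis mult_eq_0_iff)+
    then show "lact n Z w a b c d = tzero a b c d" by (simp add: lact_def tzero_def del: mult_eq_0_iff)
  qed
  then show "tc n (lact n Z y) w = 0" by (simp add: tc_lact tc_tzero)
qed

text \<open>\<open>is_dual\<close> only places W^* in the tensor product with all of l, so a
  component in sp(n-i) must be excluded. It commutes with sp(n-i), whose centre is zero; the proof
  tests this with a few matrices \<open>sb n a b'\<close>.\<close>

lemma Wd_Mid:
  assumes y: "y \<in> Wd" and ab: "a \<in> Mid n i" "b \<in> Mid n i"
  shows "y a b c d = 0"
proof (cases "ht n i c - ht n i d = -2")
  case False
  then show ?thesis using grd_zero[OF i(1) tspan_slice(2)[OF Wd_tspan[OF y], of a b]] by auto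
next
  case True
  let ?P = "\<lambda>a b. y a b c d"
  have P: "?P \<in> sp n" using tspan_slice(1)[OF Wd_tspan[OF y]] grd_sp by blast
  have lt: "a < 2*n" "b < 2*n" using ab Mid_less by blast+
  have cd: "c \<notin> Mid n i" "d \<notin> Mid n i" using True by (auto simp: Mid_ht[OF i(1)] ht_def split: if_splits)
  have *: "br n (sb n a b') ?P x z = 0" if b': "b' \<in> Mid n i" for b' x z
  proof -
    have "sb n a b' \<in> grd n i 0"
      using ab b' i Mid_less by (intro sb_grd) (auto simp: ht_Mid)
    moreover have s: "u \<in> Mid n i \<and> v \<in> Mid n i" if "sb n a b' u v \<noteq> 0" for u v
      using sb_nonzero_cases[OF that] ab b' Mid_cj[OF i(1)] by auto
    ultimately have "lact n (sb n a b') y = tzero" using y by (intro Mid_kills_Wd) auto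
    then have "lact n (sb n a b') y x z c d = 0" by (simp add: tzero_def)
    moreover have "br n (sb n a b') (\<lambda>u v. y x z u v) c d = 0"
    proof -
      have "sb n a b' c e = 0" "sb n a b' e d = 0" for e using s cd by blast+
      then show ?thesis by (simp add: br_def mmul_def)
    qed
    ultimately show ?thesis by (simp add: lact_br)
  qed
  show ?thesis
  proof (cases "b = a")
    case True
    \<comment> \<open>A diagonal entry is tested with the long root vector
      \<open>sb n a (cj n a)\<close>. The equality obtained contradicts the opposite signs
      prescribed by sp(n) unless the entry is 0.\<close>
    have "?P (cj n a) (cj n a) = ?P a a"
      using *[OF Mid_cj[OF i(1) ab(1)], of a "cj n a"] lt
      by (simp add: br_def mmul_sb_left mmul_sb_right)
    then show ?thesis using sp_sym[OF P lt(1) lt(1)] True by simp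
  next
    case False
    \<comment> \<open>An off-diagonal entry is tested with the Cartan element
      \<open>sb n a a\<close>, under which it has nonzero weight.\<close>
    have "(1 + dl b (cj n a)) * ?P a b = 0"
      using *[OF ab(1), of a b] lt False
      by (cases "b = cj n a") (auto simp: br_def mmul_sb_left mmul_sb_right dl_def)
    then show ?thesis by simp
  qed
qed

end

text \<open>Uniqueness up to scale of the highest weight vector of weight eps_1 + eps_2 in gl(i) (x)
  Sym^2. The weight condition leaves only the coordinates u 0 q 1 q, u 1 q 0 q and u q q 0 1, up to
  swapping the last two indices; the raising relations express all of them by u 0 0 0 1.\<close>

lemma highest_weight_form:
  fixes u :: "nat \<Rightarrow> nat \<Rightarrow> nat \<Rightarrow> nat \<Rightarrow> complex"
  assumes i: "2 \<le> i"
    and sym: "\<And>j k l m. j < i \<Longrightarrow> k < i \<Longrightarrow> l < i \<Longrightarrow> m < i \<Longrightarrow> u j k l m = u j k m l"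
    and wt: "\<And>t j k l m. t < i \<Longrightarrow> j < i \<Longrightarrow> k < i \<Longrightarrow> l < i \<Longrightarrow> m < i \<Longrightarrow> u j k l m \<noteq> 0 \<Longrightarrow>
        of_bool (t = j) + of_bool (t = l) + of_bool (t = m) = (of_bool (t = k) + of_bool (t = 0) + of_bool (t = 1) :: int)"
    and raise: "\<And>p q j k l m. p < q \<Longrightarrow> q < i \<Longrightarrow> j < i \<Longrightarrow> k < i \<Longrightarrow> l < i \<Longrightarrow> m < i \<Longrightarrow>
        dl j p * u q k l m - dl k q * u j p l m + dl l p * u j k q m + dl m p * u j k l q = 0"
    and lt: "j < i" "k < i" "l < i" "m < i"
  shows "u j k l m = u 0 0 0 1 * (dl j 0 * (dl l 1 * dl m k + dl l k * dl m 1)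
      - dl j 1 * (dl l 0 * dl m k + dl l k * dl m 0))"
proof -
  let ?A = "u 0 0 0 1"
  have I: "0 < i" "1 < i" using i by auto
  have f1: "u 1 0 0 0 = - 2 * ?A"
    using raise[of 0 1 0 0 0 0] sym[of 0 0 1 0] I by (simp add: dl_def) (simp add: eq_neg_iff_add_eq_0 add.commute)
  have f2: "u 1 1 0 1 = - ?A"
  proof -
    have a: "2 * u 1 1 0 1 = u 1 0 0 0"
      using raise[of 0 1 1 1 0 0] sym[of 1 1 1 0] I by (simp add: dl_def)
    have "2 * u 1 1 0 1 = 2 * (- ?A)" unfolding a f1 by simp
    then show ?thesis using mult_left_cancel[of "2::complex" "u 1 1 0 1" "- ?A"] zero_neq_numeral by metis
  qed
  have f3: "u 0 1 1 1 = 2 * ?A"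
    using raise[of 0 1 0 1 0 1] I f2 by (simp add: dl_def)
  have f4: "u 0 q 1 q = ?A" if "2 \<le> q" "q < i" for q
    using raise[of 1 q 0 q 1 1] sym[of 0 q q 1] I that f3 by (simp add: dl_def)
  have f5: "u 1 q 0 q = - ?A" if "2 \<le> q" "q < i" for q
  proof -
    have a: "2 * u 1 q 0 q = u 1 0 0 0"
      using raise[of 0 q 1 q 0 0] sym[of 1 q q 0] I that by (simp add: dl_def)
    have "2 * u 1 q 0 q = 2 * (- ?A)" unfolding a f1 by simp
    then show ?thesis using mult_left_cancel[of "2::complex" "u 1 q 0 q" "- ?A"] zero_neq_numeral by metis
  qed
  \<comment> \<open>Raising from q to 0 compares this coordinate with u 0 0 0 1 and u 0 q q 1, which
    are equal by \<open>f4\<close>.\<close>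
  have f6: "u q q 0 1 = 0" if "2 \<le> q" "q < i" for q
    using raise[of 0 q 0 q 0 1] sym[of 0 q q 1] I that f4[OF that] by (simp add: dl_def)
  have g1: "u 0 q 1 q = ?A * (1 + dl q 1)" if "q < i" for q
  proof -
    consider "q = 0" | "q = 1" | "2 \<le> q" by linarith
    then show ?thesis using f3 f4[OF _ that] sym[of 0 0 1 0] I by cases (simp_all add: dl_def)
  qed
  have g2: "u 1 q 0 q = - ?A * (1 + dl q 0)" if "q < i" for q
  proof -
    consider "q = 0" | "q = 1" | "2 \<le> q" by linarith
    then show ?thesis using f1 f2 f5[OF _ that] I by cases (simp_all add: dl_def)
  qed
  let ?R1 = "dl j 0 * (dl l 1 * dl m k + dl l k * dl m 1)"
  let ?R2 = "dl j 1 * (dl l 0 * dl m k + dl l k * dl m 0)"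
  let ?S1 = "j = 0 \<and> ((l = k \<and> m = 1) \<or> (l = 1 \<and> m = k))"
  let ?S2 = "j = 1 \<and> ((l = k \<and> m = 0) \<or> (l = 0 \<and> m = k))"
  have z1: "?R1 \<noteq> 0 \<Longrightarrow> ?S1" by (auto simp: dl_def split: if_splits)
  have z2: "?R2 \<noteq> 0 \<Longrightarrow> ?S2" by (auto simp: dl_def split: if_splits)
  consider ?S1 | ?S2 | "\<not> ?S1" "\<not> ?S2" by blast
  then show ?thesis
  proof cases
    case 1
    then have "u j k l m = u 0 k 1 k" using sym[OF lt] by auto
    moreover have "?R1 = 1 + dl k 1" "?R2 = 0"
      using 1 by (auto simp: dl_def)
    ultimately show ?thesis using g1[OF lt(2)]
      by (simp only: diff_0 diff_0_right mult_minus_right mult_minus_left)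
  next
    case 2
    then have "u j k l m = u 1 k 0 k" using sym[OF lt] by auto
    moreover have "?R2 = 1 + dl k 0" "?R1 = 0"
      using 2 by (auto simp: dl_def)
    ultimately show ?thesis using g2[OF lt(2)]
      by (simp only: diff_0 diff_0_right mult_minus_right mult_minus_left)
  next
    case 3
    have "u j k l m = 0"
    proof (rule ccontr)
      assume nz: "u j k l m \<noteq> 0"
      note w = wt[OF _ lt nz]
      \<comment> \<open>The weight equation at t = j: its left side is at least 1, so one of the
        three indices on the right equals j.\<close>
      have "j = 0 \<or> j = 1 \<or> j = k" using w[OF lt(1)] by (auto split: if_splits simp: of_bool_def)
      moreover have ?S1 if "j = 0"
        using w[OF lt(2)] w[OF I(2)] w[OF lt(3)] w[OF lt(4)] that by (auto split: if_splits simp: of_bool_def)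
      moreover have ?S2 if "j = 1"
        using w[OF lt(2)] w[OF I(1)] w[OF lt(3)] w[OF lt(4)] that by (auto split: if_splits simp: of_bool_def)
      ultimately have j: "j = k" "j \<noteq> 0" "j \<noteq> 1" using 3 by blast+
      then have "(l = 0 \<and> m = 1) \<or> (l = 1 \<and> m = 0)"
        using w[OF I(1)] w[OF I(2)] w[OF lt(3)] w[OF lt(4)] by (auto split: if_splits simp: of_bool_def)
      then have "u j k l m = u j j 0 1" using j(1) sym[OF lt] by auto
      also have "\<dots> = 0" using f6[of j] j lt by linarith
      finally show False using nz by simp
    qed
    moreover have "?R1 = 0" "?R2 = 0" using z1 z2 3 by blast+
    ultimately show ?thesis by (simp only: diff_self mult_zero_right)
  qed
qed

lemma sum_last_first:
  fixes F :: "nat \<Rightarrow> nat \<Rightarrow> complex"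
  assumes i: "i \<le> n" and z: "\<And>c d. c < i \<or> c \<in> Mid n i \<or> i \<le> d \<Longrightarrow> F c d = 0"
  shows "(\<Sum>c<2*n. \<Sum>d<2*n. F c d) = (\<Sum>k<i. \<Sum>d<i. F (n + k) d)"
proof -
  have 1: "(\<Sum>d<2*n. F c d) = 0" if "c < i \<or> c \<in> Mid n i" for c
    using that z by (intro sum.neutral) blast
  have 2: "(\<Sum>d<2*n. F c d) = (\<Sum>d<i. F c d)" for c
    using i z by (intro sum.mono_neutral_right) auto
  show ?thesis unfolding sum_blocks[OF i, of "\<lambda>c. \<Sum>d<2*n. F c d"]
    by (simp add: 1) (simp add: 2)
qed

text \<open>The abstract conditions are tested on \<open>sb n t t\<close> for the weight and on
  \<open>sb n p q\<close> with p < q < i for the raising relations. The block of entries described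
  here is what the pairing with W^* sees.\<close>

lemma highest_weight_entries:
  assumes i: "i \<le> n" "2 \<le> i" and v: "v \<in> tspan (grd n i 0) (grd n i 2)"
    and wt: "\<And>H. H \<in> cartan n \<Longrightarrow> lact n H v = tsc (H 0 0 + H 1 1) v"
    and raise: "\<And>\<alpha> X. \<alpha> \<in> lpos n i \<Longrightarrow> X \<in> rootsp n \<alpha> \<Longrightarrow> lact n X v = tzero"
    and lt: "j < i" "k < i" "l < i" "m < i"
  shows "v j k l (n + m) = v 0 0 0 (n + 1) * (dl j 0 * (dl l 1 * dl m k + dl l k * dl m 1)
      - dl j 1 * (dl l 0 * dl m k + dl l k * dl m 0))"
proof (rule highest_weight_form[where u = "\<lambda>j k l m. v j k l (n + m)", OF i(2) _ _ _ lt])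
  fix j k l m assume lt: "j < i" "k < i" "l < i" "m < i"
  show "v j k l (n + m) = v j k m (n + l)"
    using sp_sym[OF grd_sp[OF tspan_slice(2)[OF v]], of m "n + l" j k] lt i
    by (simp add: cj_def sg_def add.commute)
next
  fix t j k l m assume t: "t < i" and lt: "j < i" "k < i" "l < i" "m < i" and nz: "v j k l (n + m) \<noteq> 0"
  let ?H = "sb n t t"
  have tn: "t < n" using t i by simp
  have H: "?H \<in> cartan n" using tn by (rule cartan_sb)
  have dg: "\<And>a b. a \<noteq> b \<Longrightarrow> ?H a b = 0" using H by (auto simp: cartan_def)
  have "lact n ?H v j k l (n + m) = (?H 0 0 + ?H 1 1) * v j k l (n + m)"
    unfolding wt[OF H] by (simp add: tsc_def)
  moreover have "lact n ?H v j k l (n + m)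
     = (?H j j - ?H k k + (?H l l - ?H (n + m) (n + m))) * v j k l (n + m)"
    unfolding lact_br using lt i by (subst (1 2) br_diag) (auto intro: dg simp: algebra_simps)
  ultimately have "?H j j - ?H k k + (?H l l - ?H (n + m) (n + m)) = ?H 0 0 + ?H 1 1"
    using nz by simp
  then have "of_int (xi n j t - xi n k t + (xi n l t - xi n (n + m) t)) = (of_int (xi n 0 t + xi n 1 t) :: complex)"
    using lt i by (simp add: sb_diag[OF tn])
  then have "xi n j t - xi n k t + (xi n l t - xi n (n + m) t) = xi n 0 t + xi n 1 t"
    by (simp only: of_int_eq_iff)
  moreover have x: "xi n a t = of_bool (t = a)" if "a < i" for a
    using that tn i by (auto simp: xi_def cj_def)
  moreover have "xi n (n + m) t = - of_bool (t = m)"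
    using tn by (auto simp: xi_def cj_def)
  ultimately show "of_bool (t = j) + of_bool (t = l) + of_bool (t = m)
      = (of_bool (t = k) + of_bool (t = 0) + of_bool (t = 1) :: int)"
    using lt i by simp
next
  fix p q j k l m assume pq: "p < q" "q < i" and lt: "j < i" "k < i" "l < i" "m < i"
  let ?a = "wminus (eps p) (eps q)"
  have lts: "p < 2*n" "q < 2*n" using pq i by auto
  have "grade i ?a = 0" using pq by (simp add: grade_def wminus_def eps_def sum_subtractf)
  moreover have "?a \<in> posroots n" using pq order.strict_trans2[OF pq(2) i(1)] unfolding posroots_def by blast
  ultimately have "?a \<in> lpos n i" by (simp add: lpos_def)
  moreover have "sb n p q \<in> rootsp n ?a"
    using pq i by (intro rootsp_sb) (auto simp: wminus_def eps_def xi_def cj_def)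
  ultimately have "lact n (sb n p q) v j k l (n + m) = 0"
    using raise by (simp add: tzero_def)
  moreover have "cj n q = n + q" "cj n p = n + p" "sg n p = 1" "sg n q = 1"
    using pq i by (auto simp: cj_def sg_def)
  moreover have "dl j (n + q) = 0" "dl k (n + p) = 0" "dl l (n + q) = 0" "dl (n + m) q = 0" "dl (n + m) (n + p) = dl m p"
    using lt pq i by (auto simp: dl_def)
  ultimately show "dl j p * v q k l (n + m) - dl k q * v j p l (n + m) + dl l p * v j k q (n + m)
      + dl m p * v j k l (n + q) = 0"
    unfolding lact_br using lts by (simp add: br_def mmul_sb_left mmul_sb_right add.assoc)
qed

context
  fixes n i :: nat and W Wd :: "tensor set"
  assumes i: "i \<le> n" "2 \<le> i" and W: "is_Vmu n i W" and Wd: "is_dual n i W Wd"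
begin

text \<open>Pairing y with the highest weight vector v gives 4A times the difference of the two
  values of \<open>Phi\<close>, where A is the leading coordinate of v. Nondegeneracy yields a y for
  which this is nonzero.\<close>

lemma exists_skew_Phi: "\<exists>y\<in>Wd. Phi n i y 0 1 \<noteq> Phi n i y 1 0"
proof -
  obtain v where v: "v \<in> W" "v \<noteq> tzero"
    and wt: "\<And>H. H \<in> cartan n \<Longrightarrow> lact n H v = tsc (H 0 0 + H 1 1) v"
    and raise: "\<And>\<alpha> X. \<alpha> \<in> lpos n i \<Longrightarrow> X \<in> rootsp n \<alpha> \<Longrightarrow> lact n X v = tzero"
    using W unfolding is_Vmu_def by blast
  obtain y where y: "y \<in> Wd" "tc n y v \<noteq> 0"
    using W_nondeg[OF i W Wd v(1)] v(2) by blast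
  note vt = W_tspan'[OF i W Wd v(1)] and yt = Wd_tspan[OF i W Wd y(1)]
  let ?u = "\<lambda>j k l m. v j k l (n + m)"
  define A where "A = v 0 0 0 (n + 1)"
  have "tc n y v = (\<Sum>c<2*n. \<Sum>d<2*n. trp n (\<lambda>a b. y a b c d) (\<lambda>a b. v a b d c))"
    by (rule tc_trp1)
  also have "\<dots> = (\<Sum>m<i. \<Sum>d<i. trp n (\<lambda>a b. y a b (n + m) d) (\<lambda>a b. v a b d (n + m)))"
  proof (rule sum_last_first[OF i(1)])
    fix c d assume cd: "c < i \<or> c \<in> Mid n i \<or> i \<le> d"
    have "v a b d c = 0" for a b
    proof -
      have "ht n i d - ht n i c \<noteq> 2" using cd i by (auto simp: ht_def Mid_def)
      then show ?thesis using grd_zero[OF i(1) tspan_slice(2)[OF vt, of a b]] by auto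
    qed
    then show "trp n (\<lambda>a b. y a b c d) (\<lambda>a b. v a b d c) = 0" by (simp add: trp_def)
  qed
  also have "\<dots> = (\<Sum>m<i. \<Sum>d<i. 2 * (\<Sum>a<i. \<Sum>b<i. y a b (n + m) d * ?u b a d m))"
    using tspan_slice(1)[OF yt] tspan_slice(1)[OF vt] Wd_Mid[OF i W Wd y(1)]
    by (intro sum.cong refl trp_levi[OF i(1)]) auto
  also have "\<dots> = 2 * (\<Sum>m<i. \<Sum>d<i. \<Sum>a<i. \<Sum>b<i. y a b (n + m) d * ?u b a d m)"
    by (simp only: sum_distrib_left)
  also have "(\<Sum>m<i. \<Sum>d<i. \<Sum>a<i. \<Sum>b<i. y a b (n + m) d * ?u b a d m)
     = A * (2 * Phi n i y 0 1 - 2 * Phi n i y 1 0)"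
  proof -
    \<comment> \<open>The two products of deltas are the two orders of a symmetric tensor in the
      second factor. By \<open>slice_sym\<close> each of them gives one copy of
      \<open>Phi\<close>.\<close>
    have T: "(\<Sum>m<i. \<Sum>d<i. \<Sum>a<i. \<Sum>b<i. y a b (n + m) d * (dl b \<beta> * (dl d \<delta> * dl m a + dl d a * dl m \<delta>)))
       = 2 * Phi n i y \<beta> \<delta>" if bd: "\<beta> < i" "\<delta> < i" for \<beta> \<delta>
    proof -
      have "(\<Sum>b<i. y a b (n + m) d * (dl b \<beta> * (dl d \<delta> * dl m a + dl d a * dl m \<delta>)))
         = dl d \<delta> * (dl m a * y a \<beta> (n + m) d) + dl m \<delta> * (dl d a * y a \<beta> (n + m) d)" for a d m
      proof -
        have "(\<Sum>b<i. y a b (n + m) d * (dl b \<beta> * (dl d \<delta> * dl m a + dl d a * dl m \<delta>)))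
          = (\<Sum>b<i. dl b \<beta> * (y a b (n + m) d * (dl d \<delta> * dl m a + dl d a * dl m \<delta>)))"
          by (simp add: mult_ac)
        also have "\<dots> = y a \<beta> (n + m) d * (dl d \<delta> * dl m a + dl d a * dl m \<delta>)"
          using bd by (simp add: sum_dl)
        finally show ?thesis by (simp add: algebra_simps)
      qed
      then have "(\<Sum>m<i. \<Sum>d<i. \<Sum>a<i. \<Sum>b<i. y a b (n + m) d * (dl b \<beta> * (dl d \<delta> * dl m a + dl d a * dl m \<delta>)))
         = (\<Sum>m<i. \<Sum>d<i. dl d \<delta> * (\<Sum>a<i. dl m a * y a \<beta> (n + m) d))
         + (\<Sum>m<i. dl m \<delta> * (\<Sum>d<i. \<Sum>a<i. dl d a * y a \<beta> (n + m) d))"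
        by (simp only: sum.distrib sum_distrib_left)
      also have "\<dots> = (\<Sum>m<i. y m \<beta> (n + m) \<delta>) + (\<Sum>d<i. y d \<beta> (n + \<delta>) d)"
        using bd by (simp add: sum_dl)
      also have "(\<Sum>m<i. y m \<beta> (n + m) \<delta>) = Phi n i y \<beta> \<delta>"
        unfolding Phi_def using slice_sym[OF i(1) yt] bd by (intro sum.cong refl) auto
      finally show ?thesis by (simp add: Phi_def)
    qed
    have "(\<Sum>m<i. \<Sum>d<i. \<Sum>a<i. \<Sum>b<i. y a b (n + m) d * ?u b a d m)
       = (\<Sum>m<i. \<Sum>d<i. \<Sum>a<i. \<Sum>b<i.
            A * (y a b (n + m) d * (dl b 0 * (dl d 1 * dl m a + dl d a * dl m 1)))
          - A * (y a b (n + m) d * (dl b 1 * (dl d 0 * dl m a + dl d a * dl m 0))))"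
    proof -
      have vv: "?u b a d m = A * (dl b 0 * (dl d 1 * dl m a + dl d a * dl m 1)
          - dl b 1 * (dl d 0 * dl m a + dl d a * dl m 0))" if "b < i" "a < i" "d < i" "m < i" for a b d m
        unfolding A_def by (rule highest_weight_entries[OF i vt _ _ that]) (fact wt, fact raise)
      have "y a b (n + m) d * ?u b a d m
         = A * (y a b (n + m) d * (dl b 0 * (dl d 1 * dl m a + dl d a * dl m 1)))
          - A * (y a b (n + m) d * (dl b 1 * (dl d 0 * dl m a + dl d a * dl m 0)))"
        if "b < i" "a < i" "d < i" "m < i" for a b d m
        unfolding vv[OF that] by (simp only: right_diff_distrib mult.left_commute[of _ A])
      then show ?thesis by (intro sum.cong refl) auto
    qed
    also have "\<dots> = A * (2 * Phi n i y 0 1) - A * (2 * Phi n i y 1 0)"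
      using T[of 0 1] T[of 1 0] i by (simp only: sum_subtractf sum_distrib_left[symmetric])
    finally show ?thesis by (simp add: right_diff_distrib)
  qed
  finally have "tc n y v = 2 * (A * (2 * Phi n i y 0 1 - 2 * Phi n i y 1 0))" .
  then have "Phi n i y 0 1 \<noteq> Phi n i y 1 0" using y(2) by auto
  with y(1) show ?thesis by blast
qed

end

subsection \<open>Computing in the generalized Verma module\<close>

definition sgl :: "mat list \<Rightarrow> fa" where
  "sgl u = (\<lambda>w. if w = u then 1 else 0)"

lemma fa_gen_sgl: "fa_gen X = sgl [X]"
  by (simp add: fa_gen_def sgl_def)

lemma fa_one_sgl: "fa_one = sgl []"
  by (simp add: fa_one_def sgl_def)

lemma fa_mul_sgl: "fa_mul (sgl u) (sgl v) = sgl (u @ v)"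
proof
  fix w
  have "sgl u (take k w) * sgl v (drop k w) = (if k = length u \<and> w = u @ v then 1 else 0)"
    if "k \<le> length w" for k
    using that by (auto simp: sgl_def)
  then have "fa_mul (sgl u) (sgl v) w = (\<Sum>k\<le>length w. if k = length u \<and> w = u @ v then 1 else 0)"
    unfolding fa_mul_def by (intro sum.cong) auto
  also have "\<dots> = sgl (u @ v) w"
    by (cases "w = u @ v") (auto simp: sgl_def)
  finally show "fa_mul (sgl u) (sgl v) w = sgl (u @ v) w" .
qed

lemma fa_mul_add: "fa_mul p (fa_add q r) = fa_add (fa_mul p q) (fa_mul p r)"
  "fa_mul (fa_add p q) r = fa_add (fa_mul p r) (fa_mul q r)"
  by (auto simp: fa_mul_def fa_add_def algebra_simps sum.distrib)

lemma fa_mul_sc: "fa_mul p (fa_sc c q) = fa_sc c (fa_mul p q)"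
  "fa_mul (fa_sc c p) q = fa_sc c (fa_mul p q)"
  by (auto simp: fa_mul_def fa_sc_def sum_distrib_left mult_ac)

lemma fa_mul_sum: "fa_mul p (\<lambda>w. \<Sum>x\<in>S. q x w) = (\<lambda>w. \<Sum>x\<in>S. fa_mul p (q x) w)"
  by (rule ext) (simp add: fa_mul_def sum_distrib_left, rule sum.swap)

lemma fa_ok_sgl: "set u \<subseteq> sp n \<Longrightarrow> fa_ok n (sgl u)"
  by (auto simp: fa_ok_def sgl_def split: if_splits)

lemma fa_ok_sc: "fa_ok n p \<Longrightarrow> fa_ok n (fa_sc c p)"
  unfolding fa_ok_def fa_sc_def by (auto elim: rev_finite_subset)

text \<open>The generating rules contain no scalar multiples; in each generator the scalar is
  absorbed into the left factor a.\<close>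

lemma vid_sc: "p \<in> vid n i s \<Longrightarrow> fa_sc c p \<in> vid n i s"
proof (induction rule: vid.induct)
  case zero
  then show ?case using vid.zero by (simp add: fa_sc_def fa_zero_def)
next
  case (add p q)
  have "fa_sc c (fa_add p q) = fa_add (fa_sc c p) (fa_sc c q)"
    by (simp add: fa_sc_def fa_add_def algebra_simps)
  then show ?case using add vid.add by metis
next
  case (lin a b X Y c' d)
  then show ?case using vid.lin[OF fa_ok_sc[OF lin(1)], where c = c'] by (simp add: fa_mul_sc)
next
  case (comm a b X Y)
  then show ?case using vid.comm[OF fa_ok_sc[OF comm(1)]] by (simp add: fa_mul_sc)
next
  case (parab a Y)
  then show ?case using vid.parab[OF fa_ok_sc[OF parab(1)]] by (simp add: fa_mul_sc)
qed

text \<open>Equality of the images in the generalized Verma module.\<close>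

definition eqv :: "nat \<Rightarrow> nat \<Rightarrow> complex \<Rightarrow> fa \<Rightarrow> fa \<Rightarrow> bool" where
  "eqv n i s p q \<longleftrightarrow> (\<lambda>w. p w - q w) \<in> vid n i s"

lemma vid_lin: "p \<in> vid n i s \<Longrightarrow> q \<in> vid n i s \<Longrightarrow> (\<lambda>w. c * p w + d * q w) \<in> vid n i s"
  using vid.add[OF vid_sc[of p n i s c] vid_sc[of q n i s d]] by (simp add: fa_add_def fa_sc_def)

lemma eqv_refl: "eqv n i s p p"
  using vid.zero by (simp add: eqv_def fa_zero_def)

lemma eqv_lin:
  assumes "eqv n i s p p'" "eqv n i s q q'"
  shows "eqv n i s (\<lambda>w. c * p w + d * q w) (\<lambda>w. c * p' w + d * q' w)"
  using vid_lin[of "\<lambda>w. p w - p' w" n i s "\<lambda>w. q w - q' w" c d] assms unfolding eqv_def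
  by (simp add: algebra_simps)

lemma eqv_add:
  assumes "eqv n i s p p'" "eqv n i s q q'"
  shows "eqv n i s (\<lambda>w. p w + q w) (\<lambda>w. p' w + q' w)"
  using eqv_lin[OF assms, of 1 1] by simp

lemma eqv_trans: "eqv n i s p q \<Longrightarrow> eqv n i s q r \<Longrightarrow> eqv n i s p r"
  using vid_lin[of "\<lambda>w. p w - q w" n i s "\<lambda>w. q w - r w" 1 1] by (simp add: eqv_def)

lemma eqv_sym: "eqv n i s p q \<Longrightarrow> eqv n i s q p"
  using vid_sc[of "\<lambda>w. p w - q w" n i s "-1"] by (simp add: eqv_def fa_sc_def)

lemma eqv_vid: "eqv n i s p q \<Longrightarrow> p \<in> vid n i s \<longleftrightarrow> q \<in> vid n i s"
proof
  assume e: "eqv n i s p q"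
  show "q \<in> vid n i s" if "p \<in> vid n i s"
    using vid_lin[OF that, of "\<lambda>w. p w - q w" 1 "-1"] e by (simp add: eqv_def)
  show "p \<in> vid n i s" if "q \<in> vid n i s"
    using vid_lin[OF that, of "\<lambda>w. p w - q w" 1 1] e by (simp add: eqv_def)
qed

lemma eqv_sum:
  assumes "\<And>x. x \<in> S \<Longrightarrow> eqv n i s (p x) (q x)"
  shows "eqv n i s (\<lambda>w. \<Sum>x\<in>S. c x * p x w) (\<lambda>w. \<Sum>x\<in>S. c x * q x w)"
  using assms
proof (induction S rule: infinite_finite_induct)
  case (insert x F)
  then show ?case using eqv_lin[of n i s "p x" "q x" "\<lambda>w. \<Sum>x\<in>F. c x * p x w" "\<lambda>w. \<Sum>x\<in>F. c x * q x w" "c x" 1]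
    by simp
qed (simp_all add: eqv_refl)

lemma eqv_comm:
  assumes "set u \<subseteq> sp n" "set v \<subseteq> sp n" "X \<in> sp n" "Y \<in> sp n"
  shows "eqv n i s (sgl (u @ X # Y # v)) (\<lambda>w. sgl (u @ Y # X # v) w + sgl (u @ br n X Y # v) w)"
proof -
  have "fa_mul (sgl u) (fa_mul (comm_rel n X Y) (sgl v)) \<in> vid n i s"
    using assms by (intro vid.comm fa_ok_sgl)
  moreover have "fa_mul (sgl u) (fa_mul (comm_rel n X Y) (sgl v))
    = (\<lambda>w. sgl (u @ X # Y # v) w - (sgl (u @ Y # X # v) w + sgl (u @ br n X Y # v) w))"
    unfolding comm_rel_def fa_gen_sgl fa_mul_add fa_mul_sc fa_mul_sgl by (simp add: fa_add_def fa_sc_def fun_eq_iff)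
  ultimately show ?thesis by (simp add: eqv_def)
qed

lemma eqv_linear_word:
  assumes "X \<in> sp n" "Y \<in> sp n" "set v \<subseteq> sp n"
  shows "eqv n i s (sgl (madd (msc c X) (msc d Y) # v)) (\<lambda>w. c * sgl (X # v) w + d * sgl (Y # v) w)"
proof -
  have "fa_mul (sgl []) (fa_mul (lin_rel c d X Y) (sgl v)) \<in> vid n i s"
    using assms by (intro vid.lin fa_ok_sgl) auto
  moreover have "fa_mul (sgl []) (fa_mul (lin_rel c d X Y) (sgl v))
    = (\<lambda>w. sgl (madd (msc c X) (msc d Y) # v) w - (c * sgl (X # v) w + d * sgl (Y # v) w))"
    unfolding lin_rel_def fa_gen_sgl fa_mul_add fa_mul_sc fa_mul_sgl by (simp add: fa_add_def fa_sc_def fun_eq_iff)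
  ultimately show ?thesis by (simp add: eqv_def)
qed

lemma eqv_linear:
  assumes "X \<in> sp n" "Y \<in> sp n"
  shows "eqv n i s (sgl [madd (msc c X) (msc d Y)]) (\<lambda>w. c * sgl [X] w + d * sgl [Y] w)"
  using eqv_linear_word[OF assms, of "[]"] by simp

lemma eqv_parab:
  assumes "set u \<subseteq> sp n" "Y \<in> par n i"
  shows "eqv n i s (sgl (u @ [Y])) (\<lambda>w. chi i s Y * sgl u w)"
proof -
  have "fa_mul (sgl u) (fa_add (fa_gen Y) (fa_sc (- chi i s Y) fa_one)) \<in> vid n i s"
    using assms by (intro vid.parab fa_ok_sgl)
  moreover have "fa_mul (sgl u) (fa_add (fa_gen Y) (fa_sc (- chi i s Y) fa_one))
    = (\<lambda>w. sgl (u @ [Y]) w - chi i s Y * sgl u w)"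
    unfolding fa_gen_sgl fa_one_sgl fa_mul_add fa_mul_sc fa_mul_sgl by (simp add: fa_add_def fa_sc_def fun_eq_iff)
  ultimately show ?thesis by (simp add: eqv_def)
qed

text \<open>Collects a linear combination of one-letter words into the single letter that is the
  corresponding matrix. The empty case says that the letter 0 is zero in the module.\<close>

lemma eqv_sgl_sum:
  assumes "finite S" "\<And>x. x \<in> S \<Longrightarrow> Z x \<in> sp n"
  shows "(\<lambda>a b. \<Sum>x\<in>S. c x * Z x a b) \<in> sp n
    \<and> eqv n i s (sgl [\<lambda>a b. \<Sum>x\<in>S. c x * Z x a b]) (\<lambda>w. \<Sum>x\<in>S. c x * sgl [Z x] w)"
  using assms
proof (induction S rule: finite_induct)
  case empty
  have "madd (msc 0 mzero) (msc 0 mzero) = (\<lambda>a b. 0)" by (simp add: madd_def msc_def)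
  then show ?case using mzero_in_sp eqv_linear[of mzero n mzero i s 0 0] by (simp add: mzero_def)
next
  case (insert x F)
  let ?R = "\<lambda>a b. \<Sum>x\<in>F. c x * Z x a b"
  have e: "(\<lambda>a b. \<Sum>x\<in>insert x F. c x * Z x a b) = madd (msc (c x) (Z x)) (msc 1 ?R)"
    using insert by (simp add: madd_def msc_def)
  have IH: "?R \<in> sp n" "eqv n i s (sgl [?R]) (\<lambda>w. \<Sum>x\<in>F. c x * sgl [Z x] w)" using insert by auto
  have "madd (msc (c x) (Z x)) (msc 1 ?R) \<in> sp n"
    by (intro madd_in_sp msc_in_sp IH insert.prems) simp
  moreover have "eqv n i s (sgl [madd (msc (c x) (Z x)) (msc 1 ?R)]) (\<lambda>w. \<Sum>x\<in>insert x F. c x * sgl [Z x] w)"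
  proof (rule eqv_trans[OF eqv_linear])
    show "eqv n i s (\<lambda>w. c x * sgl [Z x] w + 1 * sgl [?R] w) (\<lambda>w. \<Sum>x\<in>insert x F. c x * sgl [Z x] w)"
      using eqv_lin[OF eqv_refl[of n i s "sgl [Z x]"] IH(2), of "c x" 1] insert by simp
  qed (use IH insert in auto)
  ultimately show ?case unfolding e ..
qed

lemma mzero_nilr: "mzero \<in> nilr n i"
  using mzero_grd unfolding nilr_def by (auto intro!: exI[of _ mzero] simp: madd_def mzero_def)

lemma grd0_par: "L \<in> grd n i 0 \<Longrightarrow> L \<in> par n i"
proof -
  assume L: "L \<in> grd n i 0"
  have "L = madd L mzero" by (simp add: madd_def mzero_def)
  then show ?thesis using L mzero_nilr unfolding par_def levi_def by blast
qed

lemma grd12_nilr: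
  assumes "X \<in> grd n i 1 \<or> X \<in> grd n i 2"
  shows "X \<in> nilr n i"
proof -
  have "X = madd X mzero" "X = madd mzero X" by (simp_all add: madd_def mzero_def)
  then show ?thesis using assms mzero_grd unfolding nilr_def by blast
qed

lemma nilr_par: "X \<in> nilr n i \<Longrightarrow> X \<in> par n i"
proof -
  assume X: "X \<in> nilr n i"
  have "X = madd mzero X" by (simp add: madd_def mzero_def)
  then show ?thesis using X mzero_grd unfolding par_def levi_def by blast
qed

lemma chi_grd:
  assumes "i \<le> n" "X \<in> grd n i k" "k \<noteq> 0"
  shows "chi i s X = 0"
  using grd_zero[OF assms(1,2)] assms(3) by (simp add: chi_def)

text \<open>X is moved to the right end, where it kills the generator. The brackets [X,A] and [X,B]
  lie in l and act on the generator by the character; moving [X,A] past B leaves the double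
  bracket.\<close>

lemma reduce_g1:
  assumes i: "i \<le> n" and X: "X \<in> grd n i 1" and A: "A \<in> grd n i (-1)" and B: "B \<in> grd n i (-1)"
  shows "eqv n i s (sgl [X, A, B]) (\<lambda>w. sgl [br n (br n X A) B] w
     + chi i s (br n X A) * sgl [B] w + chi i s (br n X B) * sgl [A] w)"
proof -
  note sp = grd_sp[OF X] grd_sp[OF A] grd_sp[OF B]
  have XA: "br n X A \<in> grd n i 0" and XB: "br n X B \<in> grd n i 0"
    using br_grd[OF i X A] br_grd[OF i X B] by simp_all
  have c0: "chi i s X = 0" using chi_grd[OF i X] by simp
  have 1: "eqv n i s (sgl [X, A, B]) (\<lambda>w. sgl [A, X, B] w + sgl [br n X A, B] w)"
    using eqv_comm[of "[]" n "[B]" X A] sp by simp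
  have 2: "eqv n i s (sgl [A, X, B]) (\<lambda>w. sgl [A, B, X] w + sgl [A, br n X B] w)"
    using eqv_comm[of "[A]" n "[]" X B] sp by simp
  have 3: "eqv n i s (sgl [A, B, X]) (\<lambda>w. 0)"
    using eqv_parab[of "[A, B]" n X i s] sp nilr_par[OF grd12_nilr] X c0 by simp
  have 4: "eqv n i s (sgl [A, br n X B]) (\<lambda>w. chi i s (br n X B) * sgl [A] w)"
    using eqv_parab[of "[A]" n "br n X B" i s] sp grd0_par[OF XB] by simp
  have 5: "eqv n i s (sgl [br n X A, B]) (\<lambda>w. sgl [B, br n X A] w + sgl [br n (br n X A) B] w)"
    using eqv_comm[of "[]" n "[]" "br n X A" B] sp grd_sp[OF XA] by simp
  have 6: "eqv n i s (sgl [B, br n X A]) (\<lambda>w. chi i s (br n X A) * sgl [B] w)"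
    using eqv_parab[of "[B]" n "br n X A" i s] sp grd0_par[OF XA] by simp
  have 7: "eqv n i s (sgl [A, X, B]) (\<lambda>w. chi i s (br n X B) * sgl [A] w)"
    using eqv_trans[OF 2 eqv_add[OF 3 4]] by simp
  have 8: "eqv n i s (sgl [br n X A, B]) (\<lambda>w. chi i s (br n X A) * sgl [B] w + sgl [br n (br n X A) B] w)"
    using eqv_trans[OF 5 eqv_add[OF 6 eqv_refl]] .
  show ?thesis using eqv_trans[OF 1 eqv_add[OF 7 8]] by (simp add: add_ac)
qed

text \<open>Here [X,A] and [X,B] still have degree 1 and kill the generator, so only the double
  bracket of degree 0 survives, through its character.\<close>

lemma reduce_g2:
  assumes i: "i \<le> n" and X: "X \<in> grd n i 2" and A: "A \<in> grd n i (-1)" and B: "B \<in> grd n i (-1)"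
  shows "eqv n i s (sgl [X, A, B]) (\<lambda>w. chi i s (br n (br n X A) B) * sgl [] w)"
proof -
  note sp = grd_sp[OF X] grd_sp[OF A] grd_sp[OF B]
  have XA: "br n X A \<in> grd n i 1" and XB: "br n X B \<in> grd n i 1"
    using br_grd[OF i X A] br_grd[OF i X B] by simp_all
  have XAB: "br n (br n X A) B \<in> grd n i 0" using br_grd[OF i XA B] by simp
  have z: "eqv n i s (sgl (u @ [Z])) (\<lambda>w. 0)" if "Z \<in> grd n i 1 \<or> Z \<in> grd n i 2" "set u \<subseteq> sp n" for u Z
    using eqv_parab[OF that(2) nilr_par[OF grd12_nilr[OF that(1)]], of s] that(1) chi_grd[OF i, of Z]
    by (auto simp: eqv_def)
  have 1: "eqv n i s (sgl [X, A, B]) (\<lambda>w. sgl [A, X, B] w + sgl [br n X A, B] w)"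
    using eqv_comm[of "[]" n "[B]" X A] sp by simp
  have 2: "eqv n i s (sgl [A, X, B]) (\<lambda>w. sgl [A, B, X] w + sgl [A, br n X B] w)"
    using eqv_comm[of "[A]" n "[]" X B] sp by simp
  have 3: "eqv n i s (sgl [A, X, B]) (\<lambda>w. 0 + 0)"
    using eqv_trans[OF 2 eqv_add[OF z[of X "[A,B]", simplified] z[of "br n X B" "[A]", simplified]]] X XB sp by simp
  have 5: "eqv n i s (sgl [br n X A, B]) (\<lambda>w. sgl [B, br n X A] w + sgl [br n (br n X A) B] w)"
    using eqv_comm[of "[]" n "[]" "br n X A" B] sp grd_sp[OF XA] by simp
  have 6: "eqv n i s (sgl [br n (br n X A) B]) (\<lambda>w. chi i s (br n (br n X A) B) * sgl [] w)"
    using eqv_parab[of "[]" n "br n (br n X A) B" i s] grd0_par[OF XAB] by simp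
  have 8: "eqv n i s (sgl [br n X A, B]) (\<lambda>w. 0 + chi i s (br n (br n X A) B) * sgl [] w)"
    using eqv_trans[OF 5 eqv_add[OF z[of "br n X A" "[B]", simplified] 6]] XA sp by simp
  show ?thesis using eqv_trans[OF 1 eqv_add[OF 3 8]] by simp
qed

subsection \<open>Linear functionals on the generalized Verma module\<close>

text \<open>Linear extension of a function on words. On infinite support the sum would default to 0,
  so finiteness of supports is carried along in the lemmas.\<close>

definition fev :: "(mat list \<Rightarrow> complex) \<Rightarrow> fa \<Rightarrow> complex" where
  "fev \<phi> p = (\<Sum>w | p w \<noteq> 0. p w * \<phi> w)"

abbreviation fsupp :: "fa \<Rightarrow> bool" where
  "fsupp p \<equiv> finite {w. p w \<noteq> 0}"

lemma fev_superset: "finite S \<Longrightarrow> {w. p w \<noteq> 0} \<subseteq> S \<Longrightarrow> fev \<phi> p = (\<Sum>w\<in>S. p w * \<phi> w)"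
  unfolding fev_def by (rule sum.mono_neutral_left) auto

lemma fev_add:
  assumes "fsupp p" "fsupp q"
  shows "fsupp (fa_add p q)" "fev \<phi> (fa_add p q) = fev \<phi> p + fev \<phi> q"
proof -
  let ?S = "{w. p w \<noteq> 0} \<union> {w. q w \<noteq> 0}"
  have S: "finite ?S" "{w. fa_add p q w \<noteq> 0} \<subseteq> ?S" using assms by (auto simp: fa_add_def)
  then show "fsupp (fa_add p q)" by (metis finite_subset)
  show "fev \<phi> (fa_add p q) = fev \<phi> p + fev \<phi> q"
    using fev_superset[OF S, of \<phi>] fev_superset[OF S(1), of p \<phi>] fev_superset[OF S(1), of q \<phi>]
    by (simp add: fa_add_def sum.distrib distrib_right)
qed

lemma fev_sc:
  assumes "fsupp p"
  shows "fsupp (fa_sc c p)" "fev \<phi> (fa_sc c p) = c * fev \<phi> p"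
proof -
  have S: "{w. fa_sc c p w \<noteq> 0} \<subseteq> {w. p w \<noteq> 0}" by (auto simp: fa_sc_def)
  then show "fsupp (fa_sc c p)" using assms by (metis finite_subset)
  show "fev \<phi> (fa_sc c p) = c * fev \<phi> p"
    using fev_superset[OF assms S, of \<phi>] by (simp add: fev_def fa_sc_def sum_distrib_left mult.assoc)
qed

lemma fev_sgl: "fsupp (sgl u)" "fev \<phi> (sgl u) = \<phi> u"
proof -
  have "{w. sgl u w \<noteq> 0} = {u}" by (auto simp: sgl_def)
  then show "fsupp (sgl u)" "fev \<phi> (sgl u) = \<phi> u" by (simp_all add: fev_def sgl_def)
qed

lemma fa_mul_expand:
  assumes "fsupp p"
  shows "fa_mul p q = (\<lambda>w. \<Sum>u | p u \<noteq> 0. p u * fa_mul (sgl u) q w)"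
proof
  fix w
  have "p (take k w) = (\<Sum>u | p u \<noteq> 0. p u * sgl u (take k w))" for k
  proof -
    have "(\<Sum>u | p u \<noteq> 0. p u * sgl u (take k w)) = (\<Sum>u | p u \<noteq> 0. if u = take k w then p u else 0)"
      by (intro sum.cong) (auto simp: sgl_def)
    then show ?thesis using assms by (simp add: sum.delta)
  qed
  then have "fa_mul p q w = (\<Sum>k\<le>length w. (\<Sum>u | p u \<noteq> 0. p u * sgl u (take k w)) * q (drop k w))"
    unfolding fa_mul_def by simp
  also have "\<dots> = (\<Sum>u | p u \<noteq> 0. p u * fa_mul (sgl u) q w)"
    unfolding fa_mul_def sum_distrib_left sum_distrib_right
    by (subst sum.swap) (simp add: mult.assoc)
  finally show "fa_mul p q w = (\<Sum>u | p u \<noteq> 0. p u * fa_mul (sgl u) q w)" .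
qed

lemma fa_mul_expand_right:
  assumes "fsupp q"
  shows "fa_mul p q = (\<lambda>w. \<Sum>v | q v \<noteq> 0. q v * fa_mul p (sgl v) w)"
proof
  fix w
  have "q (drop k w) = (\<Sum>v | q v \<noteq> 0. q v * sgl v (drop k w))" for k
  proof -
    have "(\<Sum>v | q v \<noteq> 0. q v * sgl v (drop k w)) = (\<Sum>v | q v \<noteq> 0. if v = drop k w then q v else 0)"
      by (intro sum.cong) (auto simp: sgl_def)
    then show ?thesis using assms by (simp add: sum.delta)
  qed
  then have "fa_mul p q w = (\<Sum>k\<le>length w. p (take k w) * (\<Sum>v | q v \<noteq> 0. q v * sgl v (drop k w)))"
    unfolding fa_mul_def by simp
  also have "\<dots> = (\<Sum>v | q v \<noteq> 0. q v * fa_mul p (sgl v) w)"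
    unfolding fa_mul_def sum_distrib_left sum_distrib_right
    by (subst sum.swap) (simp add: mult_ac)
  finally show "fa_mul p q w = (\<Sum>v | q v \<noteq> 0. q v * fa_mul p (sgl v) w)" .
qed

lemma fev_sum:
  assumes "finite S" "\<And>x. x \<in> S \<Longrightarrow> fsupp (p x)"
  shows "fsupp (\<lambda>w. \<Sum>x\<in>S. c x * p x w) \<and> fev \<phi> (\<lambda>w. \<Sum>x\<in>S. c x * p x w) = (\<Sum>x\<in>S. c x * fev \<phi> (p x))"
  using assms
proof (induction S rule: finite_induct)
  case (insert x F)
  have e: "(\<lambda>w. \<Sum>x\<in>insert x F. c x * p x w) = fa_add (fa_sc (c x) (p x)) (\<lambda>w. \<Sum>x\<in>F. c x * p x w)"
    using insert by (simp add: fa_add_def fa_sc_def)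
  have f: "fsupp (\<lambda>w. \<Sum>x\<in>F. c x * p x w)" "fsupp (fa_sc (c x) (p x))"
    using insert fev_sc(1)[of "p x" "c x"] by auto
  have "fsupp (\<lambda>w. \<Sum>x\<in>insert x F. c x * p x w)"
    using fev_add(1)[OF f(2,1)] unfolding e[symmetric] .
  moreover have "fev \<phi> (\<lambda>w. \<Sum>x\<in>insert x F. c x * p x w) = (\<Sum>x\<in>insert x F. c x * fev \<phi> (p x))"
    unfolding e fev_add(2)[OF f(2,1)] using insert fev_sc(2)[of "p x" \<phi> "c x"] by simp
  ultimately show ?case ..
qed (simp add: fev_def)

lemma fev_mul_sgl:
  assumes "fsupp q"
  shows "fsupp (fa_mul (sgl u) q) \<and> fev \<phi> (fa_mul (sgl u) q) = fev (\<lambda>v. \<phi> (u @ v)) q"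
proof -
  have "fa_mul (sgl u) q = (\<lambda>w. \<Sum>v | q v \<noteq> 0. q v * sgl (u @ v) w)"
    unfolding fa_mul_expand_right[OF assms] fa_mul_sgl ..
  then show ?thesis
    using fev_sum[OF assms, of "\<lambda>v. sgl (u @ v)" q \<phi>] by (simp add: fev_sgl) (simp add: fev_def)
qed

text \<open>By linearity it suffices to multiply by single words. A left factor u then becomes a
  shift of the functional, and the relation can be tested alone.\<close>

lemma fev_mul_left_zero:
  assumes "fsupp a" "fsupp q" "\<And>u. fev (\<lambda>v. \<phi> (u @ v)) q = 0"
  shows "fsupp (fa_mul a q) \<and> fev \<phi> (fa_mul a q) = 0"
  unfolding fa_mul_expand[OF assms(1)]
  using fev_sum[OF assms(1), of "\<lambda>u. fa_mul (sgl u) q" a \<phi>] fev_mul_sgl[OF assms(2)] assms(3) by simp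

lemma fev_mul_right_zero:
  assumes "fsupp r" "fsupp b" "\<And>v. fev (\<lambda>u. \<phi> (u @ v)) r = 0"
  shows "fsupp (fa_mul r b) \<and> fev \<phi> (fa_mul r b) = 0"
proof -
  have s: "fsupp (fa_mul r (sgl v)) \<and> fev \<phi> (fa_mul r (sgl v)) = fev (\<lambda>u. \<phi> (u @ v)) r" for v
  proof -
    have "fa_mul r (sgl v) = (\<lambda>w. \<Sum>u | r u \<noteq> 0. r u * sgl (u @ v) w)"
      unfolding fa_mul_expand[OF assms(1)] fa_mul_sgl ..
    then show ?thesis
      using fev_sum[OF assms(1), of "\<lambda>u. sgl (u @ v)" r \<phi>] by (simp add: fev_sgl) (simp add: fev_def)
  qed
  show ?thesis unfolding fa_mul_expand_right[OF assms(2)]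
    using fev_sum[OF assms(2), of "\<lambda>v. fa_mul r (sgl v)" b \<phi>] s assms(3) by simp
qed

lemma fev_lin_rel: "fsupp (lin_rel c d X Y)"
  "fev \<psi> (lin_rel c d X Y) = \<psi> [madd (msc c X) (msc d Y)] - c * \<psi> [X] - d * \<psi> [Y]"
  unfolding lin_rel_def fa_gen_sgl by (simp_all add: fev_add fev_sc fev_sgl)

lemma fev_comm_rel: "fsupp (comm_rel n X Y)"
  "fev \<psi> (comm_rel n X Y) = \<psi> [X, Y] - \<psi> [Y, X] - \<psi> [br n X Y]"
  unfolding comm_rel_def fa_gen_sgl fa_mul_sgl by (simp_all add: fev_add fev_sc fev_sgl)

text \<open>Any function on words compatible with the three kinds of relations descends to the
  module. This is the criterion for showing that something is not in \<open>vid\<close>.\<close>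

lemma vid_functional:
  assumes lin: "\<And>u v c d X Y. \<phi> (u @ [madd (msc c X) (msc d Y)] @ v) = c * \<phi> (u @ [X] @ v) + d * \<phi> (u @ [Y] @ v)"
    and comm: "\<And>u v X Y. \<phi> (u @ [X, Y] @ v) = \<phi> (u @ [Y, X] @ v) + \<phi> (u @ [br n X Y] @ v)"
    and parab: "\<And>u Y. Y \<in> par n i \<Longrightarrow> \<phi> (u @ [Y]) = chi i s Y * \<phi> u"
    and p: "p \<in> vid n i s"
  shows "fsupp p \<and> fev \<phi> p = 0"
  using p
proof (induction rule: vid.induct)
  case zero
  then show ?case by (simp add: fa_zero_def fev_def)
next
  case (add p q)
  then show ?case by (simp add: fev_add)
next
  case (lin a b X Y c d)
  have ab: "fsupp a" "fsupp b" using lin by (auto simp: fa_ok_def)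
  have "fsupp (fa_mul (lin_rel c d X Y) b) \<and> fev (\<lambda>v. \<phi> (u @ v)) (fa_mul (lin_rel c d X Y) b) = 0" for u
    by (rule fev_mul_right_zero[OF fev_lin_rel(1) ab(2)])
      (use assms(1)[of u] in \<open>simp add: fev_lin_rel(2)\<close>)
  then show ?case by (intro fev_mul_left_zero ab) auto
next
  case (comm a b X Y)
  have ab: "fsupp a" "fsupp b" using comm by (auto simp: fa_ok_def)
  have "fsupp (fa_mul (comm_rel n X Y) b) \<and> fev (\<lambda>v. \<phi> (u @ v)) (fa_mul (comm_rel n X Y) b) = 0" for u
    by (rule fev_mul_right_zero[OF fev_comm_rel(1) ab(2)])
      (use assms(2)[of u X Y] in \<open>simp add: fev_comm_rel(2)\<close>)
  then show ?case by (intro fev_mul_left_zero ab) auto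
next
  case (parab a Y)
  have a: "fsupp a" using parab by (auto simp: fa_ok_def)
  show ?case
    by (intro fev_mul_left_zero a) (use assms(3)[OF parab(2)] in
      \<open>simp_all add: fa_gen_sgl fa_one_sgl fev_add fev_sc fev_sgl\<close>)
qed

subsection \<open>Polynomial functions and vector fields on a chart of the flag variety\<close>

inductive_set PF :: "(mat \<Rightarrow> complex) set" where
  const: "(\<lambda>E. c) \<in> PF"
| coord: "(\<lambda>E. E a q) \<in> PF"
| add: "f \<in> PF \<Longrightarrow> g \<in> PF \<Longrightarrow> (\<lambda>E. f E + g E) \<in> PF"
| mult: "f \<in> PF \<Longrightarrow> g \<in> PF \<Longrightarrow> (\<lambda>E. f E * g E) \<in> PF"

lemma PF_sum: "(\<And>x. x \<in> S \<Longrightarrow> f x \<in> PF) \<Longrightarrow> (\<lambda>E. \<Sum>x\<in>S. f x E) \<in> PF"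
  by (induction S rule: infinite_finite_induct) (auto intro: PF.intros)

lemma PF_diff: "f \<in> PF \<Longrightarrow> g \<in> PF \<Longrightarrow> (\<lambda>E. f E - g E) \<in> PF"
  using PF.add[OF _ PF.mult[OF PF.const[of "-1"]], of f g] by simp

text \<open>Directional derivative along U at E, defined by a complex derivative in one variable.
  The polynomial class \<open>PF\<close> guarantees that it exists.\<close>

definition dd :: "(mat \<Rightarrow> complex) \<Rightarrow> mat \<Rightarrow> mat \<Rightarrow> complex" where
  "dd f U E = (THE D. ((\<lambda>t. f (madd E (msc t U))) has_field_derivative D) (at 0))"

lemma ddI: "((\<lambda>t. f (madd E (msc t U))) has_field_derivative D) (at 0) \<Longrightarrow> dd f U E = D"
  unfolding dd_def by (rule the_equality) (auto intro: DERIV_unique)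

lemma PF_DERIV: "f \<in> PF \<Longrightarrow> ((\<lambda>t. f (madd E (msc t U))) has_field_derivative dd f U E) (at 0)"
proof -
  assume "f \<in> PF"
  then have "\<exists>D. ((\<lambda>t. f (madd E (msc t U))) has_field_derivative D) (at 0)"
  proof induction
    case (coord a q)
    have "((\<lambda>t. E a q + t * U a q) has_field_derivative U a q) (at 0)"
      by (auto intro!: derivative_eq_intros)
    then show ?case by (auto simp: madd_def msc_def)
  next
    case (const c)
    show ?case using DERIV_const by blast
  next
    case (add f g)
    then obtain D1 D2 where "((\<lambda>t. f (madd E (msc t U))) has_field_derivative D1) (at 0)"
      "((\<lambda>t. g (madd E (msc t U))) has_field_derivative D2) (at 0)" by blast
    from DERIV_add[OF this] show ?case by blast
  next
    case (mult f g)
    then obtain D1 D2 where "((\<lambda>t. f (madd E (msc t U))) has_field_derivative D1) (at 0)"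
      "((\<lambda>t. g (madd E (msc t U))) has_field_derivative D2) (at 0)" by blast
    from DERIV_mult[OF this] show ?case by blast
  qed
  then show ?thesis using ddI by metis
qed

lemma dd_const: "dd (\<lambda>E. c) U E = 0"
  by (rule ddI) simp

lemma dd_coord: "dd (\<lambda>E. E a q) U E = U a q"
  by (rule ddI) (auto simp: madd_def msc_def intro!: derivative_eq_intros)

lemma dd_add: "f \<in> PF \<Longrightarrow> g \<in> PF \<Longrightarrow> dd (\<lambda>E. f E + g E) U E = dd f U E + dd g U E"
  by (rule ddI) (intro DERIV_add PF_DERIV)

lemma dd_mult: "f \<in> PF \<Longrightarrow> g \<in> PF \<Longrightarrow> dd (\<lambda>E. f E * g E) U E = dd f U E * g E + f E * dd g U E"
  using DERIV_mult[OF PF_DERIV[of f E U] PF_DERIV[of g E U]]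
  by (intro ddI) (simp add: madd_def msc_def mult.commute)

lemma dd_sum: "(\<And>x. x \<in> S \<Longrightarrow> f x \<in> PF) \<Longrightarrow> dd (\<lambda>E. \<Sum>x\<in>S. f x E) U E = (\<Sum>x\<in>S. dd (f x) U E)"
  by (induction S rule: infinite_finite_induct) (auto simp: dd_const dd_add PF_sum)

lemma dd_linear: "f \<in> PF \<Longrightarrow> dd f (\<lambda>a q. c * U a q + d * V a q) E = c * dd f U E + d * dd f V E"
  by (induction rule: PF.induct) (auto simp: dd_const dd_coord dd_add dd_mult algebra_simps)

lemma dd_minus: "f \<in> PF \<Longrightarrow> g \<in> PF \<Longrightarrow> dd (\<lambda>E. f E - g E) U E = dd f U E - dd g U E"
proof -
  assume fg: "f \<in> PF" "g \<in> PF"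
  show ?thesis
    using dd_add[OF fg(1) PF.mult[OF PF.const[of "-1"] fg(2)], of U E]
      dd_mult[OF PF.const[of "-1"] fg(2), of U E] by (simp add: dd_const)
qed

text \<open>Polynomial fields preserve polynomial functions, so the operators can be iterated along
  a word.\<close>

lemma PF_dd:
  assumes "\<And>a q. (\<lambda>E. V E a q) \<in> PF"
  shows "f \<in> PF \<Longrightarrow> (\<lambda>E. dd f (V E) E) \<in> PF"
  by (induction rule: PF.induct) (auto simp: dd_const dd_coord dd_add dd_mult assms intro: PF.intros)

text \<open>Both sides are derivations, so it suffices to compare them on coordinates.\<close>
lemma dd_commutator:
  assumes V1: "\<And>a q. (\<lambda>E. V1 E a q) \<in> PF" and V2: "\<And>a q. (\<lambda>E. V2 E a q) \<in> PF"
    and V3: "\<And>a q E. dd (\<lambda>E. V2 E a q) (V1 E) E - dd (\<lambda>E. V1 E a q) (V2 E) E = V3 E a q"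
    and f: "f \<in> PF"
  shows "dd (\<lambda>E. dd f (V2 E) E) (V1 E) E - dd (\<lambda>E. dd f (V1 E) E) (V2 E) E = dd f (V3 E) E"
  using f
proof (induction arbitrary: E rule: PF.induct)
  case (const c)
  then show ?case by (simp add: dd_const)
next
  case (coord a q)
  then show ?case by (simp add: dd_coord V3)
next
  case (add f g)
  note p = PF_dd[OF V1 add(1)] PF_dd[OF V2 add(1)] PF_dd[OF V1 add(2)] PF_dd[OF V2 add(2)]
  show ?case using add.IH[of E] by (simp add: dd_add[OF add(1,2)] dd_add p) (simp add: algebra_simps)
next
  case (mult f g)
  note p = PF_dd[OF V1 mult(1)] PF_dd[OF V2 mult(1)] PF_dd[OF V1 mult(2)] PF_dd[OF V2 mult(2)]
  have "dd (\<lambda>E. dd f (V2 E) E) (V1 E) E = dd f (V3 E) E + dd (\<lambda>E. dd f (V1 E) E) (V2 E) E"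
    "dd (\<lambda>E. dd g (V2 E) E) (V1 E) E = dd g (V3 E) E + dd (\<lambda>E. dd g (V1 E) E) (V2 E) E"
    using mult.IH[of E] by (simp_all add: algebra_simps)
  then show ?case
    by (simp add: dd_mult[OF mult(1,2)] dd_add dd_mult p mult(1,2) PF.mult) (simp add: algebra_simps)
qed

text \<open>The vector field of $X$ on $2n \times i$ matrices is the projection to the chart
  of the Grassmannian of the linear field $E \mapsto XE$; the multiplier is the logarithmic
  derivative of the $i \times i$ minor of the first rows.\<close>

definition xe :: "nat \<Rightarrow> mat \<Rightarrow> mat \<Rightarrow> mat" where
  "xe n X E = (\<lambda>a q. \<Sum>b<2*n. X a b * E b q)"

definition vf :: "nat \<Rightarrow> nat \<Rightarrow> mat \<Rightarrow> mat \<Rightarrow> mat" where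
  "vf n i X E = (\<lambda>a q. xe n X E a q - (\<Sum>r<i. E a r * xe n X E r q))"

definition vop :: "nat \<Rightarrow> nat \<Rightarrow> complex \<Rightarrow> mat \<Rightarrow> (mat \<Rightarrow> complex) \<Rightarrow> mat \<Rightarrow> complex" where
  "vop n i t X f = (\<lambda>E. dd f (vf n i X E) E + (t * (\<Sum>r<i. xe n X E r r)) * f E)"

lemma PF_xe: "(\<lambda>E. xe n X E a q) \<in> PF"
  unfolding xe_def by (intro PF_sum PF.intros)

lemma PF_vf: "(\<lambda>E. vf n i X E a q) \<in> PF"
  unfolding vf_def by (intro PF_diff PF_sum PF.intros PF_xe)

lemma PF_vop: "f \<in> PF \<Longrightarrow> vop n i t X f \<in> PF"
  unfolding vop_def by (intro PF.intros PF_sum PF_xe PF_dd PF_vf)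

lemma dd_xe: "dd (\<lambda>E. xe n X E a q) U E = xe n X U a q"
  unfolding xe_def by (simp add: dd_sum dd_mult dd_const dd_coord PF.intros)

lemma xe_vf: "xe n X (vf n i Y E) a q = xe n (mmul n X Y) E a q - (\<Sum>r<i. xe n X E a r * xe n Y E r q)"
proof -
  have "(\<Sum>b<2*n. X a b * (\<Sum>e<2*n. Y b e * E e q)) = (\<Sum>e<2*n. (\<Sum>b<2*n. X a b * Y b e) * E e q)"
    unfolding sum_distrib_left sum_distrib_right by (subst sum.swap) (simp add: mult.assoc)
  moreover have "(\<Sum>b<2*n. X a b * (\<Sum>r<i. E b r * z r)) = (\<Sum>r<i. (\<Sum>b<2*n. X a b * E b r) * z r)" for z
    unfolding sum_distrib_left sum_distrib_right by (subst sum.swap) (simp add: mult.assoc)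
  ultimately show ?thesis
    unfolding vf_def by (simp add: xe_def[of n X] xe_def[of n "mmul n X Y"] right_diff_distrib sum_subtractf)
      (simp add: mmul_def xe_def)
qed

lemma xe_br: "xe n (br n X Y) E a q = xe n (mmul n X Y) E a q - xe n (mmul n Y X) E a q"
  by (simp add: xe_def br_def left_diff_distrib sum_subtractf)

text \<open>The terms quadratic and cubic in E occur symmetrically in X and Y and cancel. The sign
  shows an anti-representation: the field of Y is applied to the coordinates of the field of X, and
  the difference is the field of [X,Y].\<close>

lemma vf_commutator:
  "dd (\<lambda>E. vf n i X E a q) (vf n i Y E) E - dd (\<lambda>E. vf n i Y E a q) (vf n i X E) E = vf n i (br n X Y) E a q"
proof -
  define Q where "Q X Y = (\<Sum>r<i. \<Sum>s<i. E a r * xe n X E r s * xe n Y E s q)" for X Y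
  define P where "P X Y = (\<Sum>r<i. xe n X E a r * xe n Y E r q)" for X Y
  have *: "dd (\<lambda>E. vf n i X E a q) (vf n i Y E) E
     = xe n (mmul n X Y) E a q - (\<Sum>r<i. E a r * xe n (mmul n X Y) E r q) - P X Y - P Y X + Q Y X + Q X Y" for X Y
  proof -
    have "dd (\<lambda>E. vf n i X E a q) (vf n i Y E) E = xe n X (vf n i Y E) a q
       - (\<Sum>r<i. vf n i Y E a r * xe n X E r q + E a r * xe n X (vf n i Y E) r q)"
      unfolding vf_def[of n i X]
      by (simp add: dd_minus dd_sum dd_mult dd_coord dd_xe PF_xe PF_sum PF.intros)
    also have "(\<Sum>r<i. vf n i Y E a r * xe n X E r q + E a r * xe n X (vf n i Y E) r q)
       = P Y X - Q Y X + (\<Sum>r<i. E a r * xe n (mmul n X Y) E r q) - Q X Y"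
    proof -
      have "(\<Sum>r<i. (\<Sum>s<i. E a s * xe n Y E s r) * xe n X E r q) = Q Y X"
        unfolding Q_def sum_distrib_right by (rule sum.swap)
      moreover have "(\<Sum>r<i. E a r * (\<Sum>s<i. xe n X E r s * xe n Y E s q)) = Q X Y"
        unfolding Q_def by (simp add: sum_distrib_left mult.assoc)
      ultimately show ?thesis
        unfolding xe_vf unfolding vf_def[of n i Y] P_def
        by (simp add: sum.distrib sum_subtractf left_diff_distrib right_diff_distrib)
    qed
    finally show ?thesis unfolding xe_vf P_def by (simp add: algebra_simps)
  qed
  show ?thesis unfolding * vf_def[of n i "br n X Y"] xe_br
    by (simp add: right_diff_distrib sum_subtractf algebra_simps)
qed

text \<open>The cocycle identity that allows the fields to be twisted by any multiple t of this
  function.\<close>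

lemma mult_commutator:
  "dd (\<lambda>E. \<Sum>r<i. xe n X E r r) (vf n i Y E) E - dd (\<lambda>E. \<Sum>r<i. xe n Y E r r) (vf n i X E) E
    = (\<Sum>r<i. xe n (br n X Y) E r r)"
proof -
  have "(\<Sum>r<i. \<Sum>s<i. xe n X E r s * xe n Y E s r) = (\<Sum>r<i. \<Sum>s<i. xe n Y E r s * xe n X E s r)"
    by (subst sum.swap) (simp add: mult.commute)
  then show ?thesis
    by (simp add: dd_sum PF_xe dd_xe xe_vf sum_subtractf xe_br)
qed

lemma vop_commutator:
  assumes f: "f \<in> PF"
  shows "vop n i t Y (vop n i t X f) E = vop n i t X (vop n i t Y f) E + vop n i t (br n X Y) f E"
proof -
  let ?m = "\<lambda>X E. \<Sum>r<i. xe n X E r r"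
  have m: "?m X \<in> PF" for X by (intro PF_sum PF_xe)
  have tm: "(\<lambda>E. t * ?m X E) \<in> PF" for X by (intro PF.intros m)
  have e: "vop n i t Y (vop n i t X f) E = dd (\<lambda>E. dd f (vf n i X E) E) (vf n i Y E) E
     + t * dd (?m X) (vf n i Y E) E * f E + t * ?m X E * dd f (vf n i Y E) E
     + t * ?m Y E * dd f (vf n i X E) E + t * t * ?m Y E * ?m X E * f E" for X Y
    unfolding vop_def
    by (simp only: dd_add[OF PF_dd[OF PF_vf f] PF.mult[OF tm f]] dd_mult[OF tm f]
        dd_mult[OF PF.const m] dd_const) (simp add: algebra_simps)
  have c: "dd (\<lambda>E. dd f (vf n i X E) E) (vf n i Y E) E
     = dd (\<lambda>E. dd f (vf n i Y E) E) (vf n i X E) E + dd f (vf n i (br n X Y) E) E"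
  proof -
    have "dd (\<lambda>E. dd f (vf n i X E) E) (vf n i Y E) E - dd (\<lambda>E. dd f (vf n i Y E) E) (vf n i X E) E
       = dd f (vf n i (br n X Y) E) E"
      by (rule dd_commutator[OF PF_vf PF_vf vf_commutator f])
    then show ?thesis by (simp only: diff_eq_eq add.commute)
  qed
  have d: "dd (?m X) (vf n i Y E) E = dd (?m Y) (vf n i X E) E + ?m (br n X Y) E"
    using mult_commutator[of n X i Y E] by (simp only: diff_eq_eq add.commute)
  show ?thesis unfolding e c d by (simp add: vop_def algebra_simps)
qed

lemma vop_linear_field:
  assumes f: "f \<in> PF"
  shows "vop n i t (madd (msc c X) (msc d Y)) f E = c * vop n i t X f E + d * vop n i t Y f E"
proof -
  have x: "xe n (madd (msc c X) (msc d Y)) E a q = c * xe n X E a q + d * xe n Y E a q" for a q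
    by (simp add: xe_def madd_def msc_def sum.distrib sum_distrib_left algebra_simps)
  have "vf n i (madd (msc c X) (msc d Y)) E = (\<lambda>a q. c * vf n i X E a q + d * vf n i Y E a q)"
    unfolding vf_def x by (intro ext) (simp add: sum.distrib sum_distrib_left algebra_simps)
  then show ?thesis
    by (simp add: vop_def x dd_linear[OF f] sum.distrib sum_distrib_left[symmetric] algebra_simps)
qed

lemma vop_linear:
  assumes "f \<in> PF" "g \<in> PF"
  shows "vop n i t X (\<lambda>E. c * f E + d * g E) = (\<lambda>E. c * vop n i t X f E + d * vop n i t X g E)"
proof
  fix E
  have "dd (\<lambda>E. c * f E + d * g E) U E = c * dd f U E + d * dd g U E" for U
    using assms by (subst dd_add) (auto intro: PF.intros simp: dd_mult[OF PF.const] dd_const)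
  then show "vop n i t X (\<lambda>E. c * f E + d * g E) E = c * vop n i t X f E + d * vop n i t X g E"
    by (simp add: vop_def algebra_simps)
qed

text \<open>The first letter is applied first, as an anti-representation demands. Hence the last
  letter is the outermost operator, evaluated directly at the chosen point.\<close>

fun opw :: "nat \<Rightarrow> nat \<Rightarrow> complex \<Rightarrow> mat list \<Rightarrow> (mat \<Rightarrow> complex) \<Rightarrow> mat \<Rightarrow> complex" where
  "opw n i t [] f = f"
| "opw n i t (X # w) f = opw n i t w (vop n i t X f)"

lemma opw_append: "opw n i t (u @ v) f = opw n i t v (opw n i t u f)"
  by (induction u arbitrary: f) auto

lemma PF_opw: "f \<in> PF \<Longrightarrow> opw n i t w f \<in> PF"
  by (induction w arbitrary: f) (auto simp: PF_vop)

lemma opw_linear: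
  "f \<in> PF \<Longrightarrow> g \<in> PF \<Longrightarrow> opw n i t w (\<lambda>E. c * f E + d * g E) = (\<lambda>E. c * opw n i t w f E + d * opw n i t w g E)"
  by (induction w arbitrary: f g) (auto simp: vop_linear PF_vop)

lemma par_zero:
  assumes "i \<le> n" "Y \<in> par n i" "i \<le> a" "q < i"
  shows "Y a q = 0"
proof -
  obtain L A B where Y: "Y = madd L (madd A B)" "L \<in> grd n i 0" "A \<in> grd n i 1" "B \<in> grd n i 2"
    using assms(2) unfolding par_def nilr_def levi_def by blast
  have "ht n i a - ht n i q < 0" using assms by (simp add: ht_def)
  then show ?thesis
    using grd_zero[OF assms(1) Y(2), of a q] grd_zero[OF assms(1) Y(3), of a q] grd_zero[OF assms(1) Y(4), of a q]
    by (simp add: Y(1) madd_def)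
qed

text \<open>Evaluation at the base point of the operators with t = -s satisfies the relations of the
  module for every s. Applied to the coordinate function (p0, q0), the word [Z] gives the entry of Z
  there.\<close>

lemma vid_detects_entries:
  assumes i: "i \<le> n" and pq: "i \<le> p0" "q0 < i" and Z: "sgl [Z] \<in> vid n i s"
  shows "Z p0 q0 = 0"
proof -
  \<comment> \<open>The frame of the first i basis vectors, whose span is stable under
    \<open>par n i\<close>. The fields of the parabolic vanish here, and the multiplier becomes
    \<open>chi\<close>.\<close>
  define E0 :: mat where "E0 = (\<lambda>b q. if q < i then dl b q else 0)"
  define F :: "mat \<Rightarrow> complex" where "F = (\<lambda>E. E p0 q0)"
  define \<phi> where "\<phi> w = opw n i (- s) w F E0" for w
  have F: "F \<in> PF" unfolding F_def by (rule PF.coord)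
  have x0: "xe n X E0 a q = (if q < i then X a q else 0)" for X a q
    using i by (simp add: xe_def E0_def mult.commute[of _ "dl _ _"] sum_dl)
  have v0: "vf n i X E0 a q = (if q < i \<and> i \<le> a then X a q else 0)" for X a q
    unfolding vf_def x0 by (simp add: E0_def sum_dl)
  have "fsupp (sgl [Z]) \<and> fev \<phi> (sgl [Z]) = 0"
  proof (rule vid_functional[OF _ _ _ Z])
    show "\<phi> (u @ [madd (msc c X) (msc d Y)] @ v) = c * \<phi> (u @ [X] @ v) + d * \<phi> (u @ [Y] @ v)" for u v c d X Y
    proof -
      let ?g = "opw n i (- s) u F"
      have g: "?g \<in> PF" using F by (rule PF_opw)
      have "vop n i (- s) (madd (msc c X) (msc d Y)) ?g = (\<lambda>E. c * vop n i (- s) X ?g E + d * vop n i (- s) Y ?g E)"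
        by (rule ext) (rule vop_linear_field[OF g])
      then show ?thesis by (simp add: \<phi>_def opw_append opw_linear PF_vop g)
    qed
    show "\<phi> (u @ [X, Y] @ v) = \<phi> (u @ [Y, X] @ v) + \<phi> (u @ [br n X Y] @ v)" for u v X Y
    proof -
      let ?g = "opw n i (- s) u F" and ?o = "vop n i (- s)"
      have g: "?g \<in> PF" using F by (rule PF_opw)
      have e: "?o Y (?o X ?g) = (\<lambda>E. 1 * ?o X (?o Y ?g) E + 1 * ?o (br n X Y) ?g E)"
        by (rule ext) (simp add: vop_commutator[OF g, of n i "- s" Y X])
      show ?thesis unfolding \<phi>_def opw_append by (simp add: e opw_linear[of _ _ _ _ _ _ 1 1, simplified] PF_vop g)
    qed
    show "\<phi> (u @ [Y]) = chi i s Y * \<phi> u" if Y: "Y \<in> par n i" for u Y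
    proof -
      let ?g = "opw n i (- s) u F"
      have g: "?g \<in> PF" using F by (rule PF_opw)
      \<comment> \<open>The zero direction is written as a linear combination with zero coefficients
        so that \<open>dd_linear\<close> applies.\<close>
      have "vf n i Y E0 = (\<lambda>a q. 0 * E0 a q + 0 * E0 a q)"
        using par_zero[OF i Y] by (intro ext) (simp add: v0)
      then have "dd ?g (vf n i Y E0) E0 = 0" by (simp only: dd_linear[OF g]) simp
      then show ?thesis by (simp add: \<phi>_def opw_append vop_def x0 chi_def)
    qed
  qed
  then have "\<phi> [Z] = 0" by (simp add: fev_sgl)
  then show ?thesis using pq by (simp add: \<phi>_def vop_def F_def dd_coord v0) (simp add: E0_def dl_def)
qed

subsection \<open>Brackets of root vectors\<close>

lemma dl_ht: "ht n i a \<noteq> ht n i b \<Longrightarrow> dl a b = 0"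
  by (auto simp: dl_def)

context
  fixes n i :: nat
  assumes i: "i \<le> n"
begin

lemma first_facts: "p < i \<Longrightarrow> p < 2*n" "p < i \<Longrightarrow> sg n p = 1" "p < i \<Longrightarrow> ht n i p = 1" "p < i \<Longrightarrow> ht n i (cj n p) = -1"
  using i by (auto simp: sg_def ht_first ht_cj)

lemma Mid_facts: "c \<in> Mid n i \<Longrightarrow> c < 2*n" "c \<in> Mid n i \<Longrightarrow> ht n i c = 0" "c \<in> Mid n i \<Longrightarrow> ht n i (cj n c) = 0"
  using i Mid_cj[of i n c] by (auto simp: Mid_less ht_Mid ht_cj)

text \<open>For these indices the matrices \<open>sb\<close> multiply like elementary ones, since
  deltas between indices of different degree vanish. The bracket splits into a gl(i) part and an
  sp(n-i) part.\<close>

lemma br_g1_gm1: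
  assumes "r < i" "p < i" "e \<in> Mid n i" "c \<in> Mid n i"
  shows "br n (sb n r e) (sb n c p) x y = dl e c * sb n r p x y - dl p r * sb n c e x y"
proof -
  note f = first_facts[OF assms(1)] first_facts[OF assms(2)] Mid_facts[OF assms(3)] Mid_facts[OF assms(4)]
  have z: "dl e (cj n p) = 0" "dl (cj n r) c = 0" "dl p (cj n e) = 0" "dl (cj n c) r = 0"
    by (rule dl_ht[of n i]; simp add: f)+
  have d: "dl (cj n r) (cj n p) = dl r p" "dl (cj n c) (cj n e) = dl c e" using f by (simp_all add: dl_cj)
  show ?thesis
    unfolding br_def mmul_sb_left[OF f(1) f(9)] mmul_sb_left[OF f(12) f(5)] sb_dl z d f(2) f(6)
    by (cases "e = c"; cases "p = r") (simp_all add: dl_def[of e c] dl_def[of c e] dl_def[of p r] dl_def[of r p] mult_ac)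
qed

lemma br_l_gm1:
  assumes "r < i" "p < i" "q < i" "c \<in> Mid n i"
  shows "br n (sb n r p) (sb n c q) x y = - (dl q r * sb n c p x y)"
proof -
  note f = first_facts[OF assms(1)] first_facts[OF assms(2)] first_facts[OF assms(3)] Mid_facts[OF assms(4)]
  have z: "dl p c = 0" "dl p (cj n q) = 0" "dl (cj n r) c = 0" "dl (cj n c) r = 0" "dl q (cj n p) = 0" "dl (cj n c) (cj n p) = 0"
    by (rule dl_ht[of n i]; simp add: f)+
  have d: "dl (cj n r) (cj n q) = dl r q" using f by (simp_all add: dl_cj)
  show ?thesis
    unfolding br_def mmul_sb_left[OF f(1) f(5)] mmul_sb_left[OF f(13) f(9)] sb_dl z d f(2) f(6) f(10)
    by (cases "q = r") (simp_all add: dl_def[of q r] dl_def[of r q])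
qed

text \<open>The term with the signs comes from the second elementary matrix of
  \<open>sb n c e\<close>, which always meets the partner of c. Being present for every c, it
  produces the 2(n-i) of the final constant.\<close>

lemma br_mid_gm1:
  assumes "q < i" "c \<in> Mid n i" "e \<in> Mid n i"
  shows "br n (sb n c e) (sb n (cj n c) q) x y = (dl c (cj n e) - sg n c * sg n e) * sb n (cj n e) q x y"
proof -
  note f = first_facts[OF assms(1)] Mid_facts[OF assms(2)] Mid_facts[OF assms(3)]
  have z: "dl e (cj n q) = 0" "dl (cj n c) (cj n q) = 0" "dl q c = 0" "dl q (cj n e) = 0"
    by (rule dl_ht[of n i]; simp add: f)+
  have d: "dl e (cj n c) = dl c (cj n e)" using f by (metis dl_cj(1) dl_sym)
  have cc: "cj n (cj n c) = c" "cj n (cj n e) = e" "sg n (cj n c) = - sg n c" "sg n (cj n e) = - sg n e"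
    using f by simp_all
  have cl: "cj n c < 2*n" using f by simp
  show ?thesis
  proof (cases "c = cj n e")
    case True
    then have t: "cj n c = e" "cj n e = c" "sg n c = - sg n e" using cc by simp_all
    show ?thesis
      unfolding br_def mmul_sb_left[OF f(5) f(8)] mmul_sb_left[OF cl f(1)] sb_dl cc z d f(2)
      unfolding t by (simp add: algebra_simps)
  next
    case False
    then have "dl c (cj n e) = 0" by (simp add: dl_def)
    then show ?thesis
      unfolding br_def mmul_sb_left[OF f(5) f(8)] mmul_sb_left[OF cl f(1)] sb_dl cc z d f(2)
      by (simp add: algebra_simps)
  qed
qed

subsection \<open>The contraction over the root basis\<close>

text \<open>The matrix of the single letter to which X A B reduces in
  \<open>reduce_g1\<close>.\<close>

definition zm :: "complex \<Rightarrow> mat \<Rightarrow> mat \<Rightarrow> mat \<Rightarrow> mat" where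
  "zm s X A B = (\<lambda>a b. br n (br n X A) B a b + chi i s (br n X A) * B a b + chi i s (br n X B) * A a b)"

lemma chi_br_g1:
  assumes "r < i" "p < i" "e \<in> Mid n i" "c \<in> Mid n i"
  shows "chi i s (br n (sb n r e) (sb n c p)) = - (s * (dl e c * dl p r))"
proof -
  note f = first_facts[OF assms(1)] first_facts[OF assms(2)] Mid_facts[OF assms(3)] Mid_facts[OF assms(4)]
  have "br n (sb n r e) (sb n c p) j j = dl j r * (dl e c * dl j p)" if "j < i" for j
  proof -
    note g = first_facts[OF that]
    have z: "dl j (cj n p) = 0" "dl j c = 0" "dl j (cj n e) = 0"
      by (rule dl_ht[of n i]; simp add: f g)+
    show ?thesis unfolding br_g1_gm1[OF assms] sb_dl z by simp
  qed
  then have "(\<Sum>j<i. br n (sb n r e) (sb n c p) j j) = (\<Sum>j<i. dl j r * (dl e c * dl j p))"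
    by (intro sum.cong) auto
  also have "\<dots> = dl e c * dl p r" using assms(1) by (simp add: sum_dl dl_sym[of r p])
  finally show ?thesis by (simp add: chi_def)
qed

text \<open>The decisive computation: here the critical value of s appears.\<close>

lemma contraction_g1_basis:
  assumes r: "r < i" and e: "e \<in> Mid n i" and M: "\<And>p q. M q p = - M p q"
  shows "(\<Sum>p<i. \<Sum>q<i. \<Sum>c\<in>Mid n i. sg n c * M p q * zm s (sb n r e) (sb n c p) (sb n (cj n c) q) x y)
    = 2 * (of_nat (n - i) + 1 - s) * sg n e * (\<Sum>q<i. M r q * sb n (cj n e) q x y)"
proof -
  let ?S = "\<lambda>p. sb n (cj n e) p x y"
  have ce: "cj n e \<in> Mid n i" using Mid_cj[OF i e] .
  have e2: "cj n (cj n e) = e" "sg n (cj n e) = - sg n e" using Mid_facts[OF e] by simp_all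
  have t: "sg n c * M p q * zm s (sb n r e) (sb n c p) (sb n (cj n c) q) x y
     = dl c e * (sg n c * (M p q * (- (dl q r * sb n (cj n c) p x y) - s * (dl p r * sb n (cj n c) q x y))))
     + dl c (cj n e) * (sg n c * (M p q * (- (dl p r * ?S q) - s * (dl q r * sb n c p x y))))
     + sg n e * M p q * dl p r * ?S q" if pq: "p < i" "q < i" and c: "c \<in> Mid n i" for p q c
  proof -
    have cc: "cj n c \<in> Mid n i" using Mid_cj[OF i c] .
    have d: "dl e c = dl c e" "dl e (cj n c) = dl c (cj n e)"
      using Mid_facts[OF c] Mid_facts[OF e] by (metis dl_cj(1) dl_sym)+
    have "br n (br n (sb n r e) (sb n c p)) (sb n (cj n c) q) x y
       = - (dl e c * (dl q r * sb n (cj n c) p x y)) - dl p r * ((dl c (cj n e) - sg n c * sg n e) * ?S q)"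
    proof -
      have b: "br n (sb n r e) (sb n c p) = (\<lambda>x y. dl e c * sb n r p x y - dl p r * sb n c e x y)"
        by (intro ext) (rule br_g1_gm1[OF r pq(1) e c])
      have l: "br n (\<lambda>x y. a * P x y - b * Q x y) R x y = a * br n P R x y - b * br n Q R x y" for a b P Q R
        by (simp add: br_def mmul_def sum_subtractf sum_distrib_left algebra_simps)
      show ?thesis unfolding b l br_l_gm1[OF r pq(1) pq(2) cc] br_mid_gm1[OF pq(2) c e] by simp
    qed
    then have zv: "zm s (sb n r e) (sb n c p) (sb n (cj n c) q) x y
       = - (dl c e * (dl q r * sb n (cj n c) p x y)) - dl p r * ((dl c (cj n e) - sg n c * sg n e) * ?S q)
       - s * (dl c e * dl p r) * sb n (cj n c) q x y - s * (dl c (cj n e) * dl q r) * sb n c p x y"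
      unfolding zm_def chi_br_g1[OF r pq(1) e c] chi_br_g1[OF r pq(2) e cc] d by simp
    show ?thesis unfolding zv by (simp add: algebra_simps)
  qed
  have s1: "(\<Sum>c\<in>Mid n i. sg n c * M p q * zm s (sb n r e) (sb n c p) (sb n (cj n c) q) x y)
     = dl p r * (sg n e * (2 * of_nat (n - i) + 1 - s) * (M p q * ?S q))
     + dl q r * (sg n e * (s - 1) * (M p q * ?S p))" if pq: "p < i" "q < i" for p q
  proof -
    have "(\<Sum>c\<in>Mid n i. sg n c * M p q * zm s (sb n r e) (sb n c p) (sb n (cj n c) q) x y)
      = (\<Sum>c\<in>Mid n i. dl c e * (sg n c * (M p q * (- (dl q r * sb n (cj n c) p x y) - s * (dl p r * sb n (cj n c) q x y)))))
      + (\<Sum>c\<in>Mid n i. dl c (cj n e) * (sg n c * (M p q * (- (dl p r * ?S q) - s * (dl q r * sb n c p x y)))))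
      + (\<Sum>c\<in>Mid n i. sg n e * M p q * dl p r * ?S q)"
      unfolding sum.distrib[symmetric] using t[OF pq] by (intro sum.cong) auto
    also have "\<dots> = sg n e * (M p q * (- (dl q r * ?S p) - s * (dl p r * ?S q)))
       + - sg n e * (M p q * (- (dl p r * ?S q) - s * (dl q r * ?S p)))
       + 2 * of_nat (n - i) * (sg n e * M p q * dl p r * ?S q)"
      using e ce by (simp add: sum_dl e2 card_Mid[OF i])
    also have "\<dots> = dl p r * (sg n e * (2 * of_nat (n - i) + 1 - s) * (M p q * ?S q))
     + dl q r * (sg n e * (s - 1) * (M p q * ?S p))"
      by (simp add: algebra_simps)
    finally show ?thesis .
  qed
  have "(\<Sum>p<i. \<Sum>q<i. \<Sum>c\<in>Mid n i. sg n c * M p q * zm s (sb n r e) (sb n c p) (sb n (cj n c) q) x y)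
     = (\<Sum>p<i. dl p r * (\<Sum>q<i. sg n e * (2 * of_nat (n - i) + 1 - s) * (M p q * ?S q)))
     + (\<Sum>p<i. \<Sum>q<i. dl q r * (sg n e * (s - 1) * (M p q * ?S p)))"
    unfolding sum_distrib_left sum.distrib[symmetric] by (intro sum.cong refl) (simp add: s1)
  also have "\<dots> = sg n e * (2 * of_nat (n - i) + 1 - s) * (\<Sum>q<i. M r q * ?S q)
     + sg n e * (s - 1) * (\<Sum>p<i. M p r * ?S p)"
    using r by (simp only: sum_dl finite_lessThan lessThan_iff if_True) (simp only: sum_distrib_left)
  \<comment> \<open>Skewness turns the contribution of the second index, with factor s-1, into
    another 1-s for the first.\<close>
  also have "(\<Sum>p<i. M p r * ?S p) = - (\<Sum>q<i. M r q * ?S q)"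
    using M[of _ r] by (simp add: sum_negf)
  finally show ?thesis by (simp add: algebra_simps)
qed

text \<open>The entries in the first i rows determine X. Those in the last i columns of the dual
  block come from the second elementary matrix of each \<open>sb\<close>.\<close>

lemma g1_decomposition:
  assumes X: "X \<in> grd n i 1"
  shows "X = (\<lambda>x y. \<Sum>z\<in>{..<i} \<times> Mid n i. X (fst z) (snd z) * sb n (fst z) (snd z) x y)"
proof (intro ext)
  fix x y
  have sp: "X \<in> sp n" using X by (rule grd_sp)
  show "X x y = (\<Sum>z\<in>{..<i} \<times> Mid n i. X (fst z) (snd z) * sb n (fst z) (snd z) x y)"
  proof (cases "x < 2*n \<and> y < 2*n")
    case True
    have "(\<Sum>z\<in>{..<i} \<times> Mid n i. X (fst z) (snd z) * sb n (fst z) (snd z) x y)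
       = (\<Sum>r<i. \<Sum>e\<in>Mid n i. X r e * sb n r e x y)"
      unfolding sum.cartesian_product by (intro sum.cong) auto
    also have "\<dots> = (\<Sum>r<i. \<Sum>e\<in>Mid n i. dl x r * (dl y e * X r e) - dl (cj n y) r * (dl (cj n x) e * (sg n e * X r e)))"
    proof (intro sum.cong refl)
      fix r e assume re: "r \<in> {..<i}" "e \<in> Mid n i"
      have "dl x (cj n e) = dl (cj n x) e" "dl y (cj n r) = dl (cj n y) r" "sg n r = 1"
        using True re i Mid_facts first_facts by (auto simp: dl_cj)
      then show "X r e * sb n r e x y = dl x r * (dl y e * X r e) - dl (cj n y) r * (dl (cj n x) e * (sg n e * X r e))"
        by (simp add: sb_dl algebra_simps)
    qed
    also have "\<dots> = (if x < i \<and> y \<in> Mid n i then X x y else 0)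
       - (if cj n y < i \<and> cj n x \<in> Mid n i then sg n (cj n x) * X (cj n y) (cj n x) else 0)"
      by (simp only: sum_subtractf sum_distrib_left[symmetric]) (simp add: sum_dl)
    also have "(if cj n y < i \<and> cj n x \<in> Mid n i then sg n (cj n x) * X (cj n y) (cj n x) else 0)
       = - (if cj n y < i \<and> x \<in> Mid n i then X x y else 0)"
    proof -
      have "cj n x \<in> Mid n i \<longleftrightarrow> x \<in> Mid n i" using Mid_cj[OF i] True by (metis cj_cj)
      moreover have "sg n (cj n x) * X (cj n y) (cj n x) = - X x y" if "cj n y < i"
      proof -
        have "sg n y = -1" using that True i by (auto simp: cj_def sg_def split: if_splits)
        then show ?thesis using True sp_sym[OF sp, of x y] by simp
      qed
      ultimately show ?thesis by simp
    qed
    also have "(if x < i \<and> y \<in> Mid n i then X x y else 0) - - (if cj n y < i \<and> x \<in> Mid n i then X x y else 0) = X x y"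
    proof (cases "ht n i x - ht n i y = 1")
      case False
      then have "X x y = 0" using grd_zero[OF i X] by blast
      then show ?thesis by simp
    next
      case d: True
      show ?thesis
      proof (cases "x < i")
        case True
        then have "y \<in> Mid n i" "x \<notin> Mid n i"
          using d \<open>x < 2*n \<and> y < 2*n\<close> i by (auto simp: Mid_ht[OF i] ht_first)
        then show ?thesis using True by simp
      next
        case False
        then have "ht n i x \<le> 0" "ht n i y \<ge> -1" by (auto simp: ht_def)
        then have h: "ht n i x = 0" "ht n i y = -1" using d by auto
        then have "x \<in> Mid n i" using \<open>x < 2*n \<and> y < 2*n\<close> by (simp add: Mid_ht[OF i])
        moreover have "cj n y < i" using h(2) \<open>x < 2*n \<and> y < 2*n\<close> by (auto simp: ht_def cj_def split: if_splits)
        ultimately show ?thesis using False by simp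
      qed
    qed
    finally show ?thesis by simp
  next
    case False
    have "sb n r e x y = 0" if "r < i" "e \<in> Mid n i" for r e
      using sp_outside[OF sb_in_sp] False that first_facts(1) Mid_facts(1) not_less by meson
    moreover have "X x y = 0" using sp_outside[OF sp] False not_less by blast
    moreover from calculation have "(\<Sum>z\<in>{..<i} \<times> Mid n i. X (fst z) (snd z) * sb n (fst z) (snd z) x y) = 0"
      by (intro sum.neutral) auto
    ultimately show ?thesis by simp
  qed
qed

lemma zm_sum:
  "zm s (\<lambda>x y. \<Sum>z\<in>S. c z * Z z x y) A B x y = (\<Sum>z\<in>S. c z * zm s (Z z) A B x y)"
proof -
  have b: "br n (\<lambda>x y. \<Sum>z\<in>S. c z * Z z x y) A = (\<lambda>x y. \<Sum>z\<in>S. c z * br n (Z z) A x y)" for A Z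
    by (intro ext br_sum)
  have "chi i s (\<lambda>x y. \<Sum>z\<in>S. c z * Z z x y) = (\<Sum>z\<in>S. c z * chi i s (Z z))" for Z
    unfolding chi_def sum_distrib_left by (subst sum.swap) (simp add: mult_ac)
  then show ?thesis unfolding zm_def b
    by (simp add: sum_distrib_left sum_distrib_right sum.distrib algebra_simps)
qed

lemma contraction_g1_zero:
  assumes X: "X \<in> grd n i 1" and M: "\<And>p q. M q p = - M p q" and s: "s = of_nat (n - i + 1)"
  shows "(\<Sum>p<i. \<Sum>q<i. \<Sum>c\<in>Mid n i. sg n c * M p q * zm s X (sb n c p) (sb n (cj n c) q) x y) = 0"
proof -
  let ?Z = "{..<i} \<times> Mid n i"
  let ?T = "\<lambda>X. \<Sum>p<i. \<Sum>q<i. \<Sum>c\<in>Mid n i. sg n c * M p q * zm s X (sb n c p) (sb n (cj n c) q) x y"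
  have "?T X = ?T (\<lambda>x y. \<Sum>z\<in>?Z. X (fst z) (snd z) * sb n (fst z) (snd z) x y)"
    using g1_decomposition[OF X] by simp
  also have "\<dots> = (\<Sum>p<i. \<Sum>q<i. \<Sum>c\<in>Mid n i. \<Sum>z\<in>?Z. X (fst z) (snd z) *
      (sg n c * M p q * zm s (sb n (fst z) (snd z)) (sb n c p) (sb n (cj n c) q) x y))"
    unfolding zm_sum sum_distrib_left by (simp only: mult_ac)
  also have "\<dots> = (\<Sum>p<i. \<Sum>q<i. \<Sum>z\<in>?Z. \<Sum>c\<in>Mid n i. X (fst z) (snd z) *
      (sg n c * M p q * zm s (sb n (fst z) (snd z)) (sb n c p) (sb n (cj n c) q) x y))"
    by (rule sum.cong[OF refl], rule sum.cong[OF refl]) (rule sum.swap)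
  also have "\<dots> = (\<Sum>p<i. \<Sum>z\<in>?Z. \<Sum>q<i. \<Sum>c\<in>Mid n i. X (fst z) (snd z) *
      (sg n c * M p q * zm s (sb n (fst z) (snd z)) (sb n c p) (sb n (cj n c) q) x y))"
    by (rule sum.cong[OF refl]) (rule sum.swap)
  also have "\<dots> = (\<Sum>z\<in>?Z. \<Sum>p<i. \<Sum>q<i. \<Sum>c\<in>Mid n i. X (fst z) (snd z) *
      (sg n c * M p q * zm s (sb n (fst z) (snd z)) (sb n c p) (sb n (cj n c) q) x y))"
    by (rule sum.swap)
  also have "\<dots> = (\<Sum>z\<in>?Z. X (fst z) (snd z) * ?T (sb n (fst z) (snd z)))"
    by (simp only: sum_distrib_left)
  also have "\<dots> = 0"
  proof (rule sum.neutral, rule ballI)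
    fix z assume "z \<in> ?Z"
    then have z: "fst z < i" "snd z \<in> Mid n i" by auto
    show "X (fst z) (snd z) * ?T (sb n (fst z) (snd z)) = 0"
      unfolding contraction_g1_basis[where M = M, OF z M] s by simp
  qed
  finally show ?thesis .
qed

text \<open>The sign of c occurs twice, so every c gives the same term s M_pq X_(q,n+p). The upper
  right block of X is symmetric and M is skew, so the sum is zero for every s.\<close>

lemma contraction_g2_zero:
  assumes X: "X \<in> grd n i 2" and M: "\<And>p q. M q p = - M p q"
  shows "(\<Sum>p<i. \<Sum>q<i. \<Sum>c\<in>Mid n i. sg n c * M p q * chi i s (br n (br n X (sb n c p)) (sb n (cj n c) q))) = 0"
proof -
  have t: "sg n c * M p q * chi i s (br n (br n X (sb n c p)) (sb n (cj n c) q)) = s * (M p q * X q (n + p))"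
    if pq: "p < i" "q < i" and c: "c \<in> Mid n i" for p q c
  proof -
    note f = first_facts[OF pq(1)] first_facts[OF pq(2)] Mid_facts[OF c]
    have cl: "cj n c < 2*n" and cc: "cj n (cj n c) = c" using f by simp_all
    have "br n (br n X (sb n c p)) (sb n (cj n c) q) j j = dl j q * - (sg n c * X j (n + p))" if j: "j < i" for j
    proof -
      note g = first_facts[OF j]
      have z: "dl j (cj n c) = 0" "dl j (cj n q) = 0" "dl j c = 0" "dl j (cj n p) = 0" "dl (cj n c) p = 0"
        by (rule dl_ht[of n i]; simp add: f g)+
      have "cj n p = n + p" using pq i by (simp add: cj_def)
      then have "br n X (sb n c p) j (cj n c) = - (sg n c * X j (n + p))"
        unfolding br_def mmul_sb_left[OF f(9) f(1)] mmul_sb_right[OF f(9) f(1)] z f(2) by simp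
      then show ?thesis
        unfolding br_def[of n "br n X (sb n c p)"] mmul_sb_left[OF cl f(5)] mmul_sb_right[OF cl f(5)] cc z by simp
    qed
    then have "(\<Sum>j<i. br n (br n X (sb n c p)) (sb n (cj n c) q) j j) = (\<Sum>j<i. dl j q * - (sg n c * X j (n + p)))"
      by (intro sum.cong) auto
    also have "\<dots> = - (sg n c * X q (n + p))" using pq by (simp only: sum_dl finite_lessThan) simp
    finally have "chi i s (br n (br n X (sb n c p)) (sb n (cj n c) q)) = s * (sg n c * X q (n + p))"
      by (simp add: chi_def)
    then show ?thesis by (simp add: mult_ac)
  qed
  have "(\<Sum>p<i. \<Sum>q<i. \<Sum>c\<in>Mid n i. sg n c * M p q * chi i s (br n (br n X (sb n c p)) (sb n (cj n c) q)))
     = (\<Sum>p<i. \<Sum>q<i. \<Sum>c\<in>Mid n i. s * (M p q * X q (n + p)))"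
    by (intro sum.cong refl) (simp add: t)
  also have "\<dots> = of_nat (card (Mid n i)) * s * (\<Sum>p<i. \<Sum>q<i. M p q * X q (n + p))"
    by (simp add: sum_distrib_left mult.assoc)
  also have "(\<Sum>p<i. \<Sum>q<i. M p q * X q (n + p)) = 0"
  proof -
    have h: "M q p * X p (n + q) = - (M p q * X q (n + p))" if "p < i" "q < i" for p q
    proof -
      have "X p (n + q) = X q (n + p)"
        using sp_sym[OF grd_sp[OF X], of q "n + p"] that i by (simp add: cj_def sg_def add.commute)
      then show ?thesis using M[of q p] by simp
    qed
    have "(\<Sum>q<i. \<Sum>p<i. M q p * X p (n + q)) = - (\<Sum>q<i. \<Sum>p<i. M p q * X q (n + p))"
      unfolding sum_negf[symmetric] by (intro sum.cong refl h) auto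
    also have "(\<Sum>q<i. \<Sum>p<i. M p q * X q (n + p)) = (\<Sum>p<i. \<Sum>q<i. M p q * X q (n + p))"
      by (rule sum.swap)
    finally show ?thesis by simp
  qed
  finally show ?thesis by simp
qed

end

section \<open>Expansion of omega_2 in root vectors and its image in the module\<close>

lemma sum_Dg1:
  assumes "i \<le> n"
  shows "(\<Sum>\<beta>\<in>Dg1 n i. F \<beta>) = (\<Sum>p<i. \<Sum>c\<in>Mid n i. F (wtof n p c))"
  unfolding Dg1_wtof[OF assms] sum.reindex[OF inj_on_wtof[OF assms]] sum.cartesian_product
  by (simp add: case_prod_unfold)

lemma rv_rvd_Dg1:
  assumes "i \<le> n" "p < i" "c \<in> Mid n i"
  obtains t where "t \<noteq> 0" "rv n (wtof n p c) = msc t (sb n p c)"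
    "rvd n (wtof n p c) = msc (1 / (t * (4 * of_nat n + 4))) (sb n c p)"
proof -
  have lt: "p < 2*n" "c < 2*n" "p \<noteq> c" using assms by (auto simp: Mid_def)
  have al: "wtof n p c k = xi n p k - xi n c k" if "k < n" for k
    using wtof_xi that assms lt by auto
  obtain t where t: "t \<noteq> 0" "rv n (wtof n p c) = msc t (sb n p c)"
    using rv_line[OF lt al] by blast
  have "rvd n (wtof n p c) = msc (1 / (t * (4 * of_nat n + 4) * (1 + dl c (cj n p)))) (sb n c p)"
    by (rule rvd_line[OF lt _ t]) (rule al)
  moreover have "dl c (cj n p) = 0" using assms by (auto simp: dl_def Mid_def cj_def)
  ultimately show thesis using that[OF t] by simp
qed

text \<open>The scalars of \<open>rv\<close> in the bilinear P cancel against those of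
  \<open>rvd\<close>, leaving (4n+4)^2 in the denominator. The delta in P couples each c with its
  partner.\<close>

lemma contract_Dg1:
  assumes i: "i \<le> n" and hom: "\<And>a b A B. \<Theta> (msc a A) (msc b B) = a * b * \<Theta> A B"
    and P: "\<And>p c q d t t'. p < i \<Longrightarrow> c \<in> Mid n i \<Longrightarrow> q < i \<Longrightarrow> d \<in> Mid n i \<Longrightarrow>
      P (msc t (sb n p c)) (msc t' (sb n q d)) = t * t' * (dl d (cj n c) * (sg n c * M p q))"
  shows "(\<Sum>\<beta>\<in>Dg1 n i. \<Sum>\<beta>'\<in>Dg1 n i. P (rv n \<beta>) (rv n \<beta>') * \<Theta> (rvd n \<beta>) (rvd n \<beta>'))
    = (\<Sum>p<i. \<Sum>q<i. \<Sum>c\<in>Mid n i. sg n c * M p q * \<Theta> (sb n c p) (sb n (cj n c) q)) / (4 * of_nat n + 4)\<^sup>2"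
proof -
  let ?N = "4 * of_nat n + 4 :: complex"
  have t: "P (rv n (wtof n p c)) (rv n (wtof n q d)) * \<Theta> (rvd n (wtof n p c)) (rvd n (wtof n q d))
     = dl d (cj n c) * (sg n c * M p q * \<Theta> (sb n c p) (sb n d q) / ?N\<^sup>2)"
    if pc: "p < i" "c \<in> Mid n i" and qd: "q < i" "d \<in> Mid n i" for p c q d
  proof -
    obtain t where t: "t \<noteq> 0" "rv n (wtof n p c) = msc t (sb n p c)"
      "rvd n (wtof n p c) = msc (1 / (t * ?N)) (sb n c p)" using rv_rvd_Dg1[OF i pc] .
    obtain u where u: "u \<noteq> 0" "rv n (wtof n q d) = msc u (sb n q d)"
      "rvd n (wtof n q d) = msc (1 / (u * ?N)) (sb n d q)" using rv_rvd_Dg1[OF i qd] .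
    have a: "t * u * (D * (S * m)) * (1 / (t * N) * (1 / (u * N)) * T) = D * (S * m * T / N\<^sup>2)" for D S m T N :: complex
      using t(1) u(1) by (simp add: power2_eq_square)
    show ?thesis unfolding t u hom P[OF pc qd] by (rule a)
  qed
  have "(\<Sum>\<beta>\<in>Dg1 n i. \<Sum>\<beta>'\<in>Dg1 n i. P (rv n \<beta>) (rv n \<beta>') * \<Theta> (rvd n \<beta>) (rvd n \<beta>'))
     = (\<Sum>p<i. \<Sum>c\<in>Mid n i. \<Sum>q<i. \<Sum>d\<in>Mid n i. dl d (cj n c) * (sg n c * M p q * \<Theta> (sb n c p) (sb n d q) / ?N\<^sup>2))"
    unfolding sum_Dg1[OF i] by (intro sum.cong refl) (simp add: t)
  also have "\<dots> = (\<Sum>p<i. \<Sum>c\<in>Mid n i. \<Sum>q<i. sg n c * M p q * \<Theta> (sb n c p) (sb n (cj n c) q) / ?N\<^sup>2)"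
    using Mid_cj[OF i] by (intro sum.cong refl) (subst sum_dl(1), auto)
  also have "\<dots> = (\<Sum>p<i. \<Sum>q<i. \<Sum>c\<in>Mid n i. sg n c * M p q * \<Theta> (sb n c p) (sb n (cj n c) q) / ?N\<^sup>2)"
    by (rule sum.cong[OF refl]) (rule sum.swap)
  finally show ?thesis by (simp only: sum_divide_distrib)
qed

lemma polar_quadratic:
  assumes f: "\<And>X. X \<in> grd n i 1 \<Longrightarrow> f X = (\<Sum>j<i. \<Sum>k<i. G j k * mmul n X X j (n + k))"
    and x: "x \<in> grd n i 1" and y: "y \<in> grd n i 1"
  shows "polar f x y = (\<Sum>j<i. \<Sum>k<i. G j k * (mmul n x y j (n + k) + mmul n y x j (n + k))) / 2"
proof -
  have "mmul n (madd x y) (madd x y) a b = mmul n x x a b + mmul n y y a b + (mmul n x y a b + mmul n y x a b)" for a b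
    by (simp add: mmul_def madd_def sum.distrib algebra_simps)
  then show ?thesis
    unfolding polar_def f[OF x] f[OF y] f[OF madd_grd[OF x y]]
    by (simp add: distrib_left sum.distrib)
qed

text \<open>A product of two root matrices of g(1) reaches the upper right block only if their
  middle indices are partners. The two orders of the product have opposite signs, which extracts the
  skew part of G.\<close>

lemma polar_basis:
  assumes i: "i \<le> n" and f: "\<And>X. X \<in> grd n i 1 \<Longrightarrow> f X = (\<Sum>j<i. \<Sum>k<i. G j k * mmul n X X j (n + k))"
    and pc: "p < i" "c \<in> Mid n i" and qd: "q < i" "d \<in> Mid n i"
  shows "polar f (msc t (sb n p c)) (msc t' (sb n q d)) = t * t' * (dl d (cj n c) * (sg n c * ((G p q - G q p) / 2)))"
proof -
  have g: "msc t (sb n p c) \<in> grd n i 1" if "p < i" "c \<in> Mid n i" for p c t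
  proof -
    have "sb n p c \<in> grd n i 1"
      by (rule sb_grd[OF i]) (use that i in \<open>simp_all add: first_facts[OF i] Mid_facts[OF i]\<close>)
    then show ?thesis by (rule msc_grd)
  qed
  have m: "mmul n (msc t (sb n p c)) (msc t' (sb n q d)) j (n + k) = dl j p * (dl k q * (- (t * t' * (sg n d * dl d (cj n c)))))"
    if pc: "p < i" "c \<in> Mid n i" and qd: "q < i" "d \<in> Mid n i" and jk: "j < i" "k < i" for p c q d t t' j k
  proof -
    note F = first_facts[OF i pc(1)] first_facts[OF i qd(1)] Mid_facts[OF i pc(2)] Mid_facts[OF i qd(2)]
      first_facts[OF i jk(1)]
    have z: "dl j (cj n c) = 0" "dl c q = 0" by (rule dl_ht[of n i]; simp add: F)+
    have "dl (n + k) (cj n q) = dl k q" using jk qd i by (auto simp: dl_def cj_def)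
    moreover have "dl c (cj n d) = dl d (cj n c)" using F by (metis dl_cj(1) dl_sym)
    moreover have "mmul n (msc t (sb n p c)) (msc t' (sb n q d)) j (n + k) = t * t' * mmul n (sb n p c) (sb n q d) j (n + k)"
      by (simp add: mmul_def msc_def sum_distrib_left mult_ac)
    ultimately show ?thesis
      unfolding mmul_sb_left[OF F(1) F(9)] z using F(6) by (simp add: sb_dl z mult_ac)
  qed
  have s: "(\<Sum>j<i. \<Sum>k<i. G j k * (dl j p * (dl k q * z))) = G p q * z" if "p < i" "q < i" for p q z
  proof -
    have "(\<Sum>j<i. \<Sum>k<i. G j k * (dl j p * (dl k q * z))) = (\<Sum>j<i. dl j p * (\<Sum>k<i. dl k q * (G j k * z)))"
      unfolding sum_distrib_left by (simp only: mult_ac)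
    then show ?thesis using that by (simp add: sum_dl)
  qed
  have dd: "dl c (cj n d) = dl d (cj n c)" using Mid_facts[OF i] pc qd by (metis dl_cj(1) dl_sym)
  have sd: "dl d (cj n c) * sg n d = - (dl d (cj n c) * sg n c)"
    using Mid_facts[OF i pc(2)] by (auto simp: dl_def)
  have "polar f (msc t (sb n p c)) (msc t' (sb n q d))
     = (\<Sum>j<i. \<Sum>k<i. G j k * (dl j p * (dl k q * (- (t * t' * (sg n d * dl d (cj n c))))))
        + G j k * (dl j q * (dl k p * (- (t' * t * (sg n c * dl c (cj n d))))))) / 2"
  proof -
    have "polar f (msc t (sb n p c)) (msc t' (sb n q d)) = (\<Sum>j<i. \<Sum>k<i. G j k *
        (mmul n (msc t (sb n p c)) (msc t' (sb n q d)) j (n + k) + mmul n (msc t' (sb n q d)) (msc t (sb n p c)) j (n + k))) / 2"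
      by (rule polar_quadratic[OF _ g[OF pc] g[OF qd]]) (rule f)
    then show ?thesis unfolding distrib_left
      by (simp only:) (intro arg_cong2[where f = "(/)"] sum.cong refl, simp add: m pc qd)
  qed
  also have "\<dots> = (G p q * (- (t * t' * (sg n d * dl d (cj n c)))) + G q p * (- (t' * t * (sg n c * dl c (cj n d))))) / 2"
    unfolding sum.distrib s[OF pc(1) qd(1)] s[OF qd(1) pc(1)] ..
  also have "\<dots> = t * t' * (dl d (cj n c) * (sg n c * ((G p q - G q p) / 2)))"
  proof -
    have "sg n d * dl d (cj n c) = - (sg n c * dl d (cj n c))" using sd by (simp add: mult.commute)
    then show ?thesis unfolding dd by (simp add: field_simps)
  qed
  finally show ?thesis .
qed

text \<open>The polarization is symmetric, so the two halves of the symmetrization have equal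
  sums.\<close>

lemma omega2_words:
  "fa_mul (fa_gen X) (omega2 n i Y) = (\<lambda>w. \<Sum>z\<in>Dg1 n i \<times> Dg1 n i.
     polar (ttau2 n i Y) (rv n (fst z)) (rv n (snd z)) * sgl [X, rvd n (fst z), rvd n (snd z)] w)"
proof -
  let ?D = "Dg1 n i" and ?P = "\<lambda>\<beta> \<beta>'. polar (ttau2 n i Y) (rv n \<beta>) (rv n \<beta>')"
  have sym: "?P \<beta> \<beta>' = ?P \<beta>' \<beta>" for \<beta> \<beta>'
    by (simp add: polar_def madd_def add.commute)
  have "omega2 n i Y = (\<lambda>w. \<Sum>z\<in>?D \<times> ?D. fa_sc (?P (fst z) (snd z)) (sgl [rvd n (fst z), rvd n (snd z)]) w)"
  proof
    fix w
    have sw: "(\<Sum>\<beta>\<in>?D. \<Sum>\<beta>'\<in>?D. ?P \<beta> \<beta>' * sgl [rvd n \<beta>', rvd n \<beta>] w) = (\<Sum>\<beta>\<in>?D. \<Sum>\<beta>'\<in>?D. ?P \<beta> \<beta>' * sgl [rvd n \<beta>, rvd n \<beta>'] w)"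
      by (subst sum.swap) (subst sym, rule refl)
    have "omega2 n i Y w = (\<Sum>\<beta>\<in>?D. \<Sum>\<beta>'\<in>?D. (1/2) * (?P \<beta> \<beta>' * sgl [rvd n \<beta>, rvd n \<beta>'] w) + (1/2) * (?P \<beta> \<beta>' * sgl [rvd n \<beta>', rvd n \<beta>] w))"
      unfolding omega2_def fa_gen_sgl fa_mul_sgl by (intro sum.cong refl) (simp add: algebra_simps)
    also have "\<dots> = (\<Sum>\<beta>\<in>?D. \<Sum>\<beta>'\<in>?D. ?P \<beta> \<beta>' * sgl [rvd n \<beta>, rvd n \<beta>'] w)"
      unfolding sum.distrib sum_distrib_left[symmetric] sw by simp
    finally show "omega2 n i Y w = (\<Sum>z\<in>?D \<times> ?D. fa_sc (?P (fst z) (snd z)) (sgl [rvd n (fst z), rvd n (snd z)]) w)"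
      unfolding sum.cartesian_product by (simp add: fa_sc_def case_prod_unfold)
  qed
  then show ?thesis
    unfolding fa_gen_sgl by (simp only: fa_mul_sum fa_mul_sc fa_mul_sgl) (simp add: fa_sc_def)
qed

context
  fixes n i :: nat and s :: complex and Y :: tensor and G :: "nat \<Rightarrow> nat \<Rightarrow> complex"
  assumes i: "i \<le> n"
    and f: "\<And>X. X \<in> grd n i 1 \<Longrightarrow> ttau2 n i Y X = (\<Sum>j<i. \<Sum>k<i. G j k * mmul n X X j (n + k))"
begin

lemma rvd_grd: "\<beta> \<in> Dg1 n i \<Longrightarrow> rvd n \<beta> \<in> grd n i (-1)"
proof -
  assume "\<beta> \<in> Dg1 n i"
  then obtain p c where pc: "p < i" "c \<in> Mid n i" "\<beta> = wtof n p c"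
    unfolding Dg1_wtof[OF i] by auto
  obtain t where "rvd n \<beta> = msc (1 / (t * (4 * of_nat n + 4))) (sb n c p)"
    using rv_rvd_Dg1[OF i pc(1,2)] pc(3) by metis
  moreover have "sb n c p \<in> grd n i (-1)"
    by (rule sb_grd[OF i]) (use pc i in \<open>simp_all add: first_facts[OF i] Mid_facts[OF i]\<close>)
  ultimately show ?thesis by (simp add: msc_grd)
qed

lemma finite_Dg1: "finite (Dg1 n i)"
  unfolding Dg1_wtof[OF i] by simp

lemma omega2_contract:
  assumes "\<And>a b A B. \<Theta> (msc a A) (msc b B) = a * b * \<Theta> A B"
  shows "(\<Sum>z\<in>Dg1 n i \<times> Dg1 n i. polar (ttau2 n i Y) (rv n (fst z)) (rv n (snd z)) * \<Theta> (rvd n (fst z)) (rvd n (snd z)))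
    = (\<Sum>p<i. \<Sum>q<i. \<Sum>c\<in>Mid n i. sg n c * ((G p q - G q p) / 2) * \<Theta> (sb n c p) (sb n (cj n c) q)) / (4 * of_nat n + 4)\<^sup>2"
proof -
  have "(\<Sum>\<beta>\<in>Dg1 n i. \<Sum>\<beta>'\<in>Dg1 n i. polar (ttau2 n i Y) (rv n \<beta>) (rv n \<beta>') * \<Theta> (rvd n \<beta>) (rvd n \<beta>'))
    = (\<Sum>p<i. \<Sum>q<i. \<Sum>c\<in>Mid n i. sg n c * ((G p q - G q p) / 2) * \<Theta> (sb n c p) (sb n (cj n c) q)) / (4 * of_nat n + 4)\<^sup>2"
    by (rule contract_Dg1[OF i assms]) (rule polar_basis[OF i f])
  then show ?thesis unfolding sum.cartesian_product by (simp add: case_prod_unfold)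
qed

text \<open>The result is collected into one letter so that vanishing in the module becomes a
  question about matrix entries, which \<open>vid_detects_entries\<close> can answer.\<close>

lemma omega2_g1:
  assumes X: "X \<in> grd n i 1"
  shows "eqv n i s (fa_mul (fa_gen X) (omega2 n i Y)) (sgl [\<lambda>a b. (\<Sum>p<i. \<Sum>q<i. \<Sum>c\<in>Mid n i.
     sg n c * ((G p q - G q p) / 2) * zm n i s X (sb n c p) (sb n (cj n c) q) a b) / (4 * of_nat n + 4)\<^sup>2])"
proof -
  let ?S = "Dg1 n i \<times> Dg1 n i" and ?P = "\<lambda>z. polar (ttau2 n i Y) (rv n (fst z)) (rv n (snd z))"
  let ?Z = "\<lambda>z. zm n i s X (rvd n (fst z)) (rvd n (snd z))"
  have z: "?Z z \<in> sp n \<and> eqv n i s (sgl [X, rvd n (fst z), rvd n (snd z)]) (sgl [?Z z])" if "z \<in> ?S" for z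
  proof -
    let ?A = "rvd n (fst z)" and ?B = "rvd n (snd z)"
    have A: "?A \<in> grd n i (-1)" and B: "?B \<in> grd n i (-1)" using that rvd_grd by auto
    note sp = grd_sp[OF X] grd_sp[OF A] grd_sp[OF B]
    let ?C = "br n (br n X ?A) ?B" and ?a = "chi i s (br n X ?A)" and ?b = "chi i s (br n X ?B)"
    let ?D = "madd (msc 1 ?C) (msc ?a ?B)"
    have C: "?C \<in> sp n" by (intro br_in_sp sp)
    have D: "?D \<in> sp n" by (intro madd_in_sp msc_in_sp C sp)
    have e: "?Z z = madd (msc 1 ?D) (msc ?b ?A)" by (simp add: zm_def[OF i] madd_def msc_def)
    have "eqv n i s (sgl [?Z z]) (\<lambda>w. 1 * sgl [?D] w + ?b * sgl [?A] w)"
      unfolding e by (intro eqv_linear D sp)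
    moreover have "eqv n i s (\<lambda>w. 1 * sgl [?D] w + ?b * sgl [?A] w) (\<lambda>w. 1 * (1 * sgl [?C] w + ?a * sgl [?B] w) + ?b * sgl [?A] w)"
      by (intro eqv_lin eqv_refl eqv_linear C sp)
    ultimately have "eqv n i s (sgl [?Z z]) (\<lambda>w. sgl [?C] w + ?a * sgl [?B] w + ?b * sgl [?A] w)"
      using eqv_trans by fastforce
    then have "eqv n i s (sgl [X, ?A, ?B]) (sgl [?Z z])"
      using eqv_trans[OF reduce_g1[OF i X A B] eqv_sym] by blast
    moreover have "?Z z \<in> sp n" unfolding e by (intro madd_in_sp msc_in_sp D sp)
    ultimately show ?thesis by blast
  qed
  have "eqv n i s (fa_mul (fa_gen X) (omega2 n i Y)) (\<lambda>w. \<Sum>z\<in>?S. ?P z * sgl [?Z z] w)"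
    unfolding omega2_words using z by (intro eqv_sum) blast
  moreover have "eqv n i s (sgl [\<lambda>a b. \<Sum>z\<in>?S. ?P z * ?Z z a b]) (\<lambda>w. \<Sum>z\<in>?S. ?P z * sgl [?Z z] w)"
    using eqv_sgl_sum[of ?S ?Z n ?P i s] z finite_Dg1 by blast
  ultimately have "eqv n i s (fa_mul (fa_gen X) (omega2 n i Y)) (sgl [\<lambda>a b. \<Sum>z\<in>?S. ?P z * ?Z z a b])"
    using eqv_trans eqv_sym by blast
  moreover have "(\<lambda>a b. \<Sum>z\<in>?S. ?P z * ?Z z a b) = (\<lambda>a b. (\<Sum>p<i. \<Sum>q<i. \<Sum>c\<in>Mid n i.
     sg n c * ((G p q - G q p) / 2) * zm n i s X (sb n c p) (sb n (cj n c) q) a b) / (4 * of_nat n + 4)\<^sup>2)"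
  proof (intro ext)
    fix a b
    have h: "zm n i s X (msc k A) (msc l B) a b = k * l * zm n i s X A B a b" for k l A B
    proof -
      have c: "chi i s (msc k A) = k * chi i s A" for k A
        by (simp add: chi_def msc_def sum_distrib_left mult_ac)
      show ?thesis unfolding zm_def[OF i] br_msc c by (simp add: msc_def algebra_simps)
    qed
    show "(\<Sum>z\<in>?S. ?P z * ?Z z a b) = (\<Sum>p<i. \<Sum>q<i. \<Sum>c\<in>Mid n i.
     sg n c * ((G p q - G q p) / 2) * zm n i s X (sb n c p) (sb n (cj n c) q) a b) / (4 * of_nat n + 4)\<^sup>2"
      using omega2_contract[where \<Theta> = "\<lambda>A B. zm n i s X A B a b", OF h] .
  qed
  ultimately show ?thesis by simp
qed

lemma omega2_g2:
  assumes X: "X \<in> grd n i 2"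
  shows "fa_mul (fa_gen X) (omega2 n i Y) \<in> vid n i s"
proof -
  let ?S = "Dg1 n i \<times> Dg1 n i" and ?P = "\<lambda>z. polar (ttau2 n i Y) (rv n (fst z)) (rv n (snd z))"
  let ?c = "\<lambda>A B. chi i s (br n (br n X A) B)"
  have "eqv n i s (fa_mul (fa_gen X) (omega2 n i Y)) (\<lambda>w. \<Sum>z\<in>?S. ?P z * (?c (rvd n (fst z)) (rvd n (snd z)) * sgl [] w))"
    unfolding omega2_words using rvd_grd by (intro eqv_sum reduce_g2[OF i X]) auto
  moreover have "(\<Sum>z\<in>?S. ?P z * ?c (rvd n (fst z)) (rvd n (snd z))) = 0"
  proof -
    have h: "?c (msc k A) (msc l B) = k * l * ?c A B" for k l A B
      by (simp add: br_msc) (simp add: chi_def msc_def sum_distrib_left mult_ac)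
    show ?thesis unfolding omega2_contract[where \<Theta> = ?c, OF h]
      using contraction_g2_zero[OF i X, of "\<lambda>p q. (G p q - G q p) / 2" s] by (simp add: field_simps)
  qed
  then have "(\<lambda>w. \<Sum>z\<in>?S. ?P z * (?c (rvd n (fst z)) (rvd n (snd z)) * sgl [] w)) = fa_zero"
    by (simp add: fa_zero_def mult.assoc[symmetric] sum_distrib_right[symmetric])
  ultimately show ?thesis using eqv_vid vid.zero by metis
qed

lemma omega2_nilr:
  assumes s: "s = of_nat (n - i + 1)" and X: "X \<in> nilr n i"
  shows "fa_mul (fa_gen X) (omega2 n i Y) \<in> vid n i s"
proof -
  obtain A B where AB: "X = madd A B" "A \<in> grd n i 1" "B \<in> grd n i 2"
    using X unfolding nilr_def by blast
  have A: "fa_mul (fa_gen A) (omega2 n i Y) \<in> vid n i s"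
  proof -
    have "(\<Sum>p<i. \<Sum>q<i. \<Sum>c\<in>Mid n i.
      sg n c * ((G p q - G q p) / 2) * zm n i s A (sb n c p) (sb n (cj n c) q) a b) = 0" for a b
      by (rule contraction_g1_zero[OF i AB(2) _ s]) (simp add: field_simps)
    then have "eqv n i s (fa_mul (fa_gen A) (omega2 n i Y)) (sgl [\<lambda>a b. 0])"
      using omega2_g1[OF AB(2)] by simp
    moreover have "eqv n i s (sgl [\<lambda>a b. 0]) (\<lambda>w. 0)"
      using eqv_sgl_sum[of "{} :: nat set" "\<lambda>_. mzero" n "\<lambda>_. 0" i s] by simp
    moreover have "(\<lambda>w. 0) \<in> vid n i s" using vid.zero by (simp add: fa_zero_def)
    ultimately show ?thesis using eqv_vid by blast
  qed
  note B = omega2_g2[OF AB(3)]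
  let ?S = "Dg1 n i \<times> Dg1 n i" and ?P = "\<lambda>z. polar (ttau2 n i Y) (rv n (fst z)) (rv n (snd z))"
  have "eqv n i s (fa_mul (fa_gen X) (omega2 n i Y)) (\<lambda>w. \<Sum>z\<in>?S. ?P z *
     (1 * sgl [A, rvd n (fst z), rvd n (snd z)] w + 1 * sgl [B, rvd n (fst z), rvd n (snd z)] w))"
  proof -
    have "X = madd (msc 1 A) (msc 1 B)" using AB by (simp add: madd_def msc_def)
    then show ?thesis unfolding omega2_words using grd_sp[OF AB(2)] grd_sp[OF AB(3)] grd_sp[OF rvd_grd]
      by (simp only:) (intro eqv_sum eqv_linear_word, auto)
  qed
  also have "(\<lambda>w. \<Sum>z\<in>?S. ?P z *
     (1 * sgl [A, rvd n (fst z), rvd n (snd z)] w + 1 * sgl [B, rvd n (fst z), rvd n (snd z)] w))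
     = fa_add (fa_mul (fa_gen A) (omega2 n i Y)) (fa_mul (fa_gen B) (omega2 n i Y))"
    unfolding omega2_words by (simp add: fa_add_def distrib_left sum.distrib)
  finally show ?thesis using vid.add[OF A B] eqv_vid by blast
qed

text \<open>It suffices to test X of weight eps_1 - eps_(i+1), for which the contraction is a
  multiple of the first row of M.\<close>

lemma omega2_nilr_conv:
  assumes "i < n" "2 \<le> i" and G: "G 0 1 \<noteq> G 1 0"
    and v: "\<And>X. X \<in> nilr n i \<Longrightarrow> fa_mul (fa_gen X) (omega2 n i Y) \<in> vid n i s"
  shows "s = of_nat (n - i + 1)"
proof -
  let ?M = "\<lambda>p q. (G p q - G q p) / 2"
  have e: "i \<in> Mid n i" and z: "0 < i" "1 < i" using assms by (auto simp: Mid_def)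
  have X: "sb n 0 i \<in> grd n i 1"
    by (rule sb_grd[OF i]) (use e z assms(1) in \<open>simp_all add: first_facts[OF i] Mid_facts[OF i]\<close>)
  let ?Z = "\<lambda>a b. (\<Sum>p<i. \<Sum>q<i. \<Sum>c\<in>Mid n i.
     sg n c * ?M p q * zm n i s (sb n 0 i) (sb n c p) (sb n (cj n c) q) a b) / (4 * of_nat n + 4)\<^sup>2"
  have v1: "sgl [?Z] \<in> vid n i s"
    using omega2_g1[OF X] v[OF grd12_nilr] X eqv_vid by blast
  \<comment> \<open>The entry at row \<open>cj n i\<close> and column 1 (0-based) isolates the
    coefficient M_12. Its row lies outside the first i, as the detection lemma requires.\<close>
  have le: "i \<le> cj n i" using assms(1) by (simp add: cj_def)
  have "?Z (cj n i) 1 = 0"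
    using vid_detects_entries[OF i le z(2) v1] .
  moreover have "(4 * of_nat n + 4 :: complex)\<^sup>2 \<noteq> 0"
    by (metis of_nat_Suc of_nat_0_neq mult_eq_0_iff distrib_left mult.right_neutral add.commute zero_neq_numeral power_not_zero)
  ultimately have "(\<Sum>p<i. \<Sum>q<i. \<Sum>c\<in>Mid n i.
     sg n c * ?M p q * zm n i s (sb n 0 i) (sb n c p) (sb n (cj n c) q) (cj n i) 1) = 0" by simp
  moreover have "(\<Sum>p<i. \<Sum>q<i. \<Sum>c\<in>Mid n i.
     sg n c * ?M p q * zm n i s (sb n 0 i) (sb n c p) (sb n (cj n c) q) (cj n i) 1)
     = 2 * (of_nat (n - i) + 1 - s) * sg n i * (\<Sum>q<i. ?M 0 q * sb n (cj n i) q (cj n i) 1)"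
    by (rule contraction_g1_basis[OF i z(1) e]) (simp add: field_simps)
  moreover have "(\<Sum>q<i. ?M 0 q * sb n (cj n i) q (cj n i) 1) = ?M 0 1"
  proof -
    have "sb n (cj n i) q (cj n i) 1 = dl 1 q" if "q < i" for q
    proof -
      have "dl (cj n i) (cj n q) = 0"
        by (rule dl_ht[of n i]) (use that e in \<open>simp add: first_facts[OF i] Mid_facts[OF i]\<close>)
      then show ?thesis by (simp add: sb_dl)
    qed
    then have "(\<Sum>q<i. ?M 0 q * sb n (cj n i) q (cj n i) 1) = (\<Sum>q<i. dl 1 q * ?M 0 q)"
      by (intro sum.cong) auto
    then show ?thesis using z by (simp only: sum_dl finite_lessThan) simp
  qed
  ultimately have "2 * (of_nat (n - i) + 1 - s) * sg n i * ?M 0 1 = 0" by (simp only:)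
  then have "of_nat (n - i) + 1 - s = 0"
    unfolding mult_eq_0_iff divide_eq_0_iff using G sg_nonzero[of n i] by auto
  then show ?thesis by (simp add: algebra_simps)
qed

end

theorem theorem5p8:
  fixes n i :: nat and s :: complex and W Wd :: "tensor set"
  assumes "3 \<le> n" and "2 \<le> i" and "i \<le> n - 1"
    and "is_Vmu n i W" and "is_dual n i W Wd"
  shows "conf_inv n i s Wd \<longleftrightarrow> s = of_nat (n - i + 1)"
proof -
  have i: "i \<le> n" "i < n" using assms by auto
  note ctx = i(1) assms(2) assms(4) assms(5)
  \<comment> \<open>The factor 2n+2 of \<open>ttau2_formula\<close> is put into G; being nonzero, it
    does not affect whether G is symmetric at (0, 1).\<close>
  define G where "G Y j k = (2 * of_nat n + 2) * Phi n i Y j k" for Y j k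
  have f: "ttau2 n i Y X = (\<Sum>j<i. \<Sum>k<i. G Y j k * mmul n X X j (n + k))"
    if "Y \<in> Wd" "X \<in> grd n i 1" for X Y
    unfolding G_def mult.assoc sum_distrib_left[symmetric]
    by (rule ttau2_formula[OF i(1) Wd_tspan[OF ctx that(1)] Wd_Mid[OF ctx that(1)] that(2)])
  show ?thesis
  proof
    assume c: "conf_inv n i s Wd"
    obtain Y where Y: "Y \<in> Wd" "Phi n i Y 0 1 \<noteq> Phi n i Y 1 0" using exists_skew_Phi[OF ctx] by blast
    have "(2 * of_nat n + 2 :: complex) \<noteq> 0"
      by (metis of_nat_Suc of_nat_0_neq mult_eq_0_iff distrib_left mult.right_neutral add.commute zero_neq_numeral)
    then have "G Y 0 1 \<noteq> G Y 1 0" using Y(2) by (simp add: G_def)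
    then show "s = of_nat (n - i + 1)"
      using omega2_nilr_conv[OF i(1) f[OF Y(1)] i(2) assms(2)] c Y(1) unfolding conf_inv_def by blast
  next
    assume s: "s = of_nat (n - i + 1)"
    show "conf_inv n i s Wd"
      unfolding conf_inv_def using omega2_nilr[OF i(1) f s] by blast
  qed
qed

end
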